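(* Let $M\ge 1$. For all sizes $k_1,\dots,k_M$, $L_p^{\mathrm I},L_p^{\mathrm{II}}$ ($1\le p\le M-1$), $L_M$, all variables $\bm z^{(p)},\bm w_{\mathrm I}^{(p)},\bm w_{\mathrm{II}}^{(p)},\bm w^{(M)}$, every admissible colouring $\bm I$ and dynamical variables $\lambda$, the elliptic $\mathfrak{gl}_{M+1}$ partition function $\psi$ equals the extended elliptic weight function $W$: $$\psi\big(\bm z^{(1)},\dots,\bm z^{(M)}\,\big|\,\{\bm w_{\mathrm I}^{(1)},\bm w_{\mathrm{II}}^{(1)}\},\dots,\{\bm w_{\mathrm I}^{(M-1)},\bm w_{\mathrm{II}}^{(M-1)}\},\bm w^{(M)}\,\big|\,\bm I\,\big|\,\lambda\big)=W\big(\bm z^{(1)},\dots,\bm z^{(M)}\,\big|\,\{\bm w_{\mathrm I}^{(1)},\bm w_{\mathrm{II}}^{(1)}\},\dots,\{\bm w_{\mathrm I}^{(M-1)},\bm w_{\mathrm{II}}^{(M-1)}\},\bm w^{(M)}\,\big|\,\bm I\,\big|\,\lambda\big)$$ (an identity of meromorphic functions of the variables and of $\lambda$).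
   Context: **Theta function.** Fix $\tau,\gamma\in\mathbb C$ nonzero with $\operatorname{Im}\tau>0$, and $[z]=-\sum_{j\in\mathbb Z+1/2}e^{i\pi j^2\tau+2\pi i j(z+1/2)}$, an odd function. Put $\alpha(z,\lambda)=\dfrac{[z][\lambda+\gamma]}{[\lambda]}$ and $\beta(z,\lambda)=-\dfrac{[z+\lambda][\gamma]}{[\lambda]}$. The dynamical variable is $\lambda=(\lambda_1,\dots,\lambda_{M+1})=\sum_i\lambda_i\mu_i\in\mathbb C^{M+1}$ ($\mu_i$ the standard basis), taken generic so that all denominators $[\lambda_i-\lambda_j+n\gamma]$ ($i\neq j$, $n\in\mathbb Z$) are nonzero. **Sizes, variables, coordinates.** Fix $M\ge1$ and nonnegative integers $k_1,\dots,k_M$, $L_p^{\mathrm I},L_p^{\mathrm{II}}$ ($1\le p\le M-1$), $L_M$. There are ordered lists of variables $\bm z^{(p)}=(z^{(p)}_1,\dots,z^{(p)}_{k_p})$ ($1\le p\le M$), $\bm w^{(p)}_{\mathrm I}=(w^{(p)}_{\mathrm I,1},\dots,w^{(p)}_{\mathrm I,L^{\mathrm I}_p})$, $\bm w^{(p)}_{\mathrm{II}}=(w^{(p)}_{\mathrm{II},1},\dots,w^{(p)}_{\mathrm{II},L^{\mathrm{II}}_p})$ ($1\le p\le M-1$), $\bm w^{(M)}=(w^{(M)}_1,\dots,w^{(M)}_{L_M})$. The sizes are the lengths of the lists and are omitted from the notation of functions. Order the $w$-variables as $\bm w_{\mathrm I}^{(1)},\dots,\bm w_{\mathrm I}^{(M-1)},\bm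 w^{(M)},\bm w_{\mathrm{II}}^{(M-1)},\dots,\bm w_{\mathrm{II}}^{(1)}$; the $c$-th variable in this list defines the coordinate $c\in\{1,2,\dots\}$. A coordinate is in layer $p<M$ if its variable belongs to $\bm w_{\mathrm I}^{(p)}$ or $\bm w_{\mathrm{II}}^{(p)}$, and in layer $M$ if it belongs to $\bm w^{(M)}$. **Colourings.** A colouring assigns to each coordinate $c$ of layer $p$ a colour $i_c^{(p)}\in\{1,\dots,p+1\}$; we also write $i_c$ for the colour of coordinate $c$. For $1\le j\le M$, let $\widehat{\bm I}^{(j)}$ be the set of coordinates in layers $j,\dots,M$ and $\bm I^{(j)}=\bm I^{(j)}_{k_j}\subset\widehat{\bm I}^{(j)}$ the subset of those with colour in $\{1,\dots,j\}$. The colouring is admissible if $|\bm I^{(j)}|=k_j$ for all $j$; write $\bm I^{(j)}=\{I^{(j)}_1<\dots<I^{(j)}_{k_j}\}$ and $\bm I=(\bm I^{(1)},\dots,\bm I^{(M)})$ (this determines the colouring). For $1\le j\le M-1$, the elements of $\widehat{\bm I}^{(j)}$ with colour in $\{1,\dots,j+1\}$ number $k_{j+1}+L_j^{\mathrm I}+L_j^{\mathrm{II}}$; relabel them in increasing order by $1,2,\dots,k_{j+1}+L_j^{\mathrm I}+L_j^{\mathrm{II}}$, and let $\widetilde{\bm I}^{(j)}=\{\widetilde I^{(j)}_1<\dots<\widetilde I^{(j)}_{k_j}\}$ be the image of $\bm I^{(j)}$. Let $C^{(p)}(k,l)$ be the number of coordinates $c\le k$ lying in layers $p,\dots,M$ with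 colour $l$. For $1\le p\le M$ put $\lambda^{[p]}=\lambda+\gamma\sum_{c}\mu_{i_c}$, the sum over all coordinates $c$ whose variable belongs to $\bm w_{\mathrm I}^{(p)},\bm w_{\mathrm I}^{(p+1)},\dots,\bm w_{\mathrm I}^{(M-1)}$; so $\lambda^{[M]}=\lambda$. **Column variables.** For $p<M$, let $m_i(\bm w^{(p)}_{\mathrm I}|\bm z^{(p+1)}|\bm w^{(p)}_{\mathrm{II}})$ be the $i$-th entry of the concatenated ordered list $(\bm w^{(p)}_{\mathrm I},\bm z^{(p+1)},\bm w^{(p)}_{\mathrm{II}})$. **Partition function.** Put $N_p=L_p^{\mathrm I}+k_{p+1}+L_p^{\mathrm{II}}$ for $p<M$, $N_M=L_M$. Layer $p$ is a grid with rows $r=1,\dots,k_p$ (top to bottom; row $r$ carries $z^{(p)}_r$) and columns $s=1,\dots,N_p$ (left to right; column $s$ carries $m_s(\bm w^{(p)}_{\mathrm I}|\bm z^{(p+1)}|\bm w^{(p)}_{\mathrm{II}})$ if $p<M$, and $w^{(M)}_s$ if $p=M$). Edges carry colours in $\{1,\dots,M+1\}$: horizontal $h^{(p)}_{r,s}$ ($0\le s\le N_p$) and vertical $v^{(p)}_{r,s}$ ($0\le r\le k_p$); vertex $(r,s)$ has left, right, bottom, top edges $h^{(p)}_{r,s-1},h^{(p)}_{r,s},v^{(p)}_{r,s},v^{(p)}_{r-1,s}$. Boundary conditions: $h^{(p)}_{r,N_p}=p+1$ for all $r$; $v^{(p)}_{k_p,s}=p+1$ for all $s$ as bottom boundary colours;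 $h^{(1)}_{r,0}=1$; $h^{(p+1)}_{r,0}=v^{(p)}_{0,L_p^{\mathrm I}+r}$ for $1\le r\le k_{p+1}$, $p<M$; and the top edge $v^{(p)}_{0,s}$ of a column carrying a $w$-variable has the colour of the corresponding coordinate. The dynamical parameter at the upper-left corner of vertex $(r,s)$ of layer $p$ is $\Lambda=\lambda^{[p]}-\gamma\sum_{r'<r}\mu_{h^{(p)}_{r',0}}-\gamma\sum_{s'<s}\mu_{v^{(p)}_{r-1,s'}}$. A vertex with left, bottom, right, top colours $(a,b,c,d)$, row variable $z$, column variable $w$ and parameter $\Lambda$ has weight: $[z-w-\gamma]$ if $a=b=c=d$; $\alpha(z-w,\Lambda_a-\Lambda_b)$ if $c=a\neq b=d$; $\beta(z-w,\Lambda_b-\Lambda_a)$ if $c=b\ne a=d$; $0$ otherwise. Then $\psi$ is the sum over all edge colourings satisfying the boundary conditions of the product of the weights of all vertices in all layers. **Extended elliptic weight function.** With $\bm z^{(p)}_{\sigma_p}=(z^{(p)}_{\sigma_p(1)},\dots,z^{(p)}_{\sigma_p(k_p)})$, $m_i^{(p)}:=m_i(\bm w^{(p)}_{\mathrm I}|\bm z^{(p+1)}_{\sigma_{p+1}}|\bm w^{(p)}_{\mathrm{II}})$ for $p<M$, $m_i^{(M)}:=w_i^{(M)}$, and positions $s^{(p)}_a:=\widetilde I^{(p)}_a$ for $p<M$, $s^{(M)}_a:=I^{(M)}_a-L^{\mathrm I}_1-\dots-L^{\mathrm I}_{M-1}$, and $c_a^{(p)}:=i_{I^{(p)}_a}$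 (the colour of coordinate $I^{(p)}_a$), $$W=[\gamma]^{k_1+\dots+k_M}\sum_{\sigma_1\in S_{k_1}}\cdots\sum_{\sigma_M\in S_{k_M}}\prod_{p=1}^{M}\Bigg\{\prod_{a=1}^{k_p}\Bigg(\prod_{i=1}^{s^{(p)}_a-1}\big[z^{(p)}_{\sigma_p(a)}-m^{(p)}_i\big]\prod_{i=s^{(p)}_a+1}^{N_p}\big[z^{(p)}_{\sigma_p(a)}-m^{(p)}_i-\gamma\big]$$ $$\times\frac{\Big[z^{(p)}_{\sigma_p(a)}-m^{(p)}_{s^{(p)}_a}+\lambda^{[p]}_{p+1}-\lambda^{[p]}_{c^{(p)}_a}+\gamma\big(C^{(p)}(I^{(p)}_a,c^{(p)}_a)-C^{(p)}(I^{(p)}_a,p+1)-1\big)\Big]}{\Big[\lambda^{[p]}_{c^{(p)}_a}-\lambda^{[p]}_{p+1}+\gamma\big(1-C^{(p)}(I^{(p)}_a,c^{(p)}_a)\big)\Big]}\Bigg)\prod_{1\le a<b\le k_p}\frac{[z^{(p)}_{\sigma_p(a)}-z^{(p)}_{\sigma_p(b)}+\gamma]}{[z^{(p)}_{\sigma_p(a)}-z^{(p)}_{\sigma_p(b)}]}\Bigg\}.$$ *)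

theory Defs
  imports "HOL-Analysis.Analysis" "HOL-Combinatorics.Permutations"
begin

text \<open>The odd theta function \<open>[z]\<close>; the half-integer summation index is \<open>j = n + 1/2\<close> with \<open>n\<close>
  ranging over the integers.\<close>

definition theta :: "complex \<Rightarrow> complex \<Rightarrow> complex" where
  "theta \<tau> z = - (\<Sum>\<^sub>\<infinity>n\<in>(UNIV::int set).
     exp (\<i> * of_real pi * (of_int n + 1/2)^2 * \<tau> + 2 * of_real pi * \<i> * (of_int n + 1/2) * (z + 1/2)))"

definition mu :: "nat \<Rightarrow> nat \<Rightarrow> complex" where
  "mu i = (\<lambda>j. if j = i then 1 else 0)"

text \<open>The \<open>a\<close>-th smallest element, counting from 1, of a finite set.\<close>

definition nth_least :: "nat set \<Rightarrow> nat \<Rightarrow> nat" where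
  "nth_least A a = sorted_list_of_set A ! (a - 1)"

text \<open>All lists are indexed from 1, as are colours, layers, coordinates, rows and columns.
  The sizes \<open>k p\<close> are used for \<open>1 \<le> p \<le> M\<close> only, and \<open>LI p\<close>, \<open>LII p\<close> for \<open>1 \<le> p < M\<close> only.
  The variable \<open>z p a\<close> is the \<open>a\<close>-th entry of the list \<open>z\<close> of layer \<open>p\<close>, similarly \<open>wI p i\<close>,
  \<open>wII p i\<close>; \<open>wM i\<close> is the \<open>i\<close>-th of the \<open>w\<close>-variables of layer \<open>M\<close>. A colouring is a function
  \<open>col\<close> from coordinates to colours, and the dynamical variable is a function \<open>lam\<close> on
  \<open>{1..M+1}\<close>.\<close>

locale elliptic_lattice =
  fixes \<tau> \<gamma> :: complex
    and M :: nat
    and k LI LII :: "nat \<Rightarrow> nat"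
    and LM :: nat
begin

abbreviation \<theta> :: "complex \<Rightarrow> complex" where "\<theta> \<equiv> theta \<tau>"

definition \<alpha> :: "complex \<Rightarrow> complex \<Rightarrow> complex" where
  "\<alpha> x l = \<theta> x * \<theta> (l + \<gamma>) / \<theta> l"

definition \<beta> :: "complex \<Rightarrow> complex \<Rightarrow> complex" where
  "\<beta> x l = - (\<theta> (x + l) * \<theta> \<gamma> / \<theta> l)"

definition generic_dynamical :: "(nat \<Rightarrow> complex) \<Rightarrow> bool" where
  "generic_dynamical lam \<longleftrightarrow> (\<forall>i\<in>{1..M+1}. \<forall>j\<in>{1..M+1}. i \<noteq> j \<longrightarrow>
     (\<forall>n::int. \<theta> (lam i - lam j + of_int n * \<gamma>) \<noteq> 0))"

definition generic_spectral :: "(nat \<Rightarrow> nat \<Rightarrow> complex) \<Rightarrow> bool" where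
  "generic_spectral z \<longleftrightarrow> (\<forall>p\<in>{1..M}. \<forall>a\<in>{1..k p}. \<forall>b\<in>{1..k p}. a \<noteq> b \<longrightarrow>
     \<theta> (z p a - z p b) \<noteq> 0)"

text \<open>The coordinates of \<open>wI p i\<close>, \<open>wM i\<close> and \<open>wII p i\<close>, i.e. their places in the list
  \<open>wI 1, \<dots>, wI (M-1), wM, wII (M-1), \<dots>, wII 1\<close>.\<close>

definition coordI :: "nat \<Rightarrow> nat \<Rightarrow> nat" where
  "coordI p i = (\<Sum>q\<in>{1..<p}. LI q) + i"

definition coordM :: "nat \<Rightarrow> nat" where
  "coordM i = (\<Sum>q\<in>{1..<M}. LI q) + i"

definition coordII :: "nat \<Rightarrow> nat \<Rightarrow> nat" where
  "coordII p i = (\<Sum>q\<in>{1..<M}. LI q) + LM + (\<Sum>q\<in>{p<..<M}. LII q) + i"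

definition layer :: "nat \<Rightarrow> nat set" where
  "layer p = (if p < M then coordI p ` {1..LI p} \<union> coordII p ` {1..LII p}
              else coordM ` {1..LM})"

definition Ihat :: "nat \<Rightarrow> nat set" where
  "Ihat j = (\<Union>p\<in>{j..M}. layer p)"

definition Iset :: "(nat \<Rightarrow> nat) \<Rightarrow> nat \<Rightarrow> nat set" where
  "Iset col j = {c \<in> Ihat j. col c \<in> {1..j}}"

definition admissible :: "(nat \<Rightarrow> nat) \<Rightarrow> bool" where
  "admissible col \<longleftrightarrow> (\<forall>p\<in>{1..M}. \<forall>c\<in>layer p. col c \<in> {1..p+1}) \<and>
     (\<forall>j\<in>{1..M}. card (Iset col j) = k j)"

text \<open>The relabelling of the elements of \<open>Ihat j\<close> with colour at most \<open>j+1\<close> by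
  \<open>1, 2, \<dots>\<close> sends \<open>c\<close> to its rank in that set.\<close>

definition Itilde :: "(nat \<Rightarrow> nat) \<Rightarrow> nat \<Rightarrow> nat set" where
  "Itilde col j = (\<lambda>c. card {c' \<in> Ihat j. col c' \<in> {1..j+1} \<and> c' \<le> c}) ` Iset col j"

definition C :: "(nat \<Rightarrow> nat) \<Rightarrow> nat \<Rightarrow> nat \<Rightarrow> nat \<Rightarrow> nat" where
  "C col p m l = card {c \<in> Ihat p. c \<le> m \<and> col c = l}"

definition lam_shift :: "(nat \<Rightarrow> nat) \<Rightarrow> (nat \<Rightarrow> complex) \<Rightarrow> nat \<Rightarrow> nat \<Rightarrow> complex" where
  "lam_shift col lam p =
     (\<lambda>j. lam j + \<gamma> * (\<Sum>c\<in>(\<Union>q\<in>{p..<M}. coordI q ` {1..LI q}). mu (col c) j))"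

definition N :: "nat \<Rightarrow> nat" where
  "N p = (if p < M then LI p + k (p+1) + LII p else LM)"

definition col_var :: "(nat \<Rightarrow> nat \<Rightarrow> complex) \<Rightarrow> (nat \<Rightarrow> nat \<Rightarrow> complex) \<Rightarrow> (nat \<Rightarrow> nat \<Rightarrow> complex)
    \<Rightarrow> (nat \<Rightarrow> complex) \<Rightarrow> nat \<Rightarrow> nat \<Rightarrow> complex" where
  "col_var z wI wII wM p i =
     (if p < M then
        (if i \<le> LI p then wI p i
         else if i \<le> LI p + k (p+1) then z (p+1) (i - LI p)
         else wII p (i - LI p - k (p+1)))
      else wM i)"

text \<open>An edge colouring is a pair \<open>(h, v)\<close>: \<open>h (p, r, s)\<close> and \<open>v (p, r, s)\<close> are the colours of the
  horizontal and vertical edges of layer \<open>p\<close>, with vertex \<open>(r, s)\<close> having left, right, bottom, top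
  edges \<open>h (p, r, s-1)\<close>, \<open>h (p, r, s)\<close>, \<open>v (p, r, s)\<close>, \<open>v (p, r-1, s)\<close>.\<close>

type_synonym edge_colours = "nat \<times> nat \<times> nat \<Rightarrow> nat"

definition h_edges :: "(nat \<times> nat \<times> nat) set" where
  "h_edges = {(p, r, s). p \<in> {1..M} \<and> r \<in> {1..k p} \<and> s \<in> {0..N p}}"

definition v_edges :: "(nat \<times> nat \<times> nat) set" where
  "v_edges = {(p, r, s). p \<in> {1..M} \<and> r \<in> {0..k p} \<and> s \<in> {1..N p}}"

definition boundary :: "(nat \<Rightarrow> nat) \<Rightarrow> edge_colours \<Rightarrow> edge_colours \<Rightarrow> bool" where
  "boundary col h v \<longleftrightarrow>
     (\<forall>p\<in>{1..M}. \<forall>r\<in>{1..k p}. h (p, r, N p) = p + 1) \<and>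
     (\<forall>p\<in>{1..M}. \<forall>s\<in>{1..N p}. v (p, k p, s) = p + 1) \<and>
     (\<forall>r\<in>{1..k 1}. h (1, r, 0) = 1) \<and>
     (\<forall>p\<in>{1..<M}. \<forall>r\<in>{1..k (p+1)}. h (p+1, r, 0) = v (p, 0, LI p + r)) \<and>
     (\<forall>p\<in>{1..<M}. \<forall>i\<in>{1..LI p}. v (p, 0, i) = col (coordI p i)) \<and>
     (\<forall>p\<in>{1..<M}. \<forall>i\<in>{1..LII p}. v (p, 0, LI p + k (p+1) + i) = col (coordII p i)) \<and>
     (\<forall>i\<in>{1..LM}. v (M, 0, i) = col (coordM i))"

definition configs :: "(nat \<Rightarrow> nat) \<Rightarrow> (edge_colours \<times> edge_colours) set" where
  "configs col = {(h, v). h \<in> h_edges \<rightarrow>\<^sub>E {1..M+1} \<and> v \<in> v_edges \<rightarrow>\<^sub>E {1..M+1} \<and> boundary col h v}"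

text \<open>The dynamical parameter at the upper-left corner of vertex \<open>(r, s)\<close> of layer \<open>p\<close>.\<close>

definition corner :: "(nat \<Rightarrow> nat) \<Rightarrow> (nat \<Rightarrow> complex) \<Rightarrow> edge_colours \<Rightarrow> edge_colours
    \<Rightarrow> nat \<Rightarrow> nat \<Rightarrow> nat \<Rightarrow> nat \<Rightarrow> complex" where
  "corner col lam h v p r s =
     (\<lambda>j. lam_shift col lam p j
          - \<gamma> * (\<Sum>r'\<in>{1..<r}. mu (h (p, r', 0)) j)
          - \<gamma> * (\<Sum>s'\<in>{1..<s}. mu (v (p, r - 1, s')) j))"

text \<open>Arguments: the difference of row and column variable, the dynamical parameter, and the
  left, bottom, right, top colours.\<close>

definition vertex_weight ::
    "complex \<Rightarrow> (nat \<Rightarrow> complex) \<Rightarrow> nat \<Rightarrow> nat \<Rightarrow> nat \<Rightarrow> nat \<Rightarrow> complex" where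
  "vertex_weight x \<Lambda> a b c d =
     (if a = b \<and> b = c \<and> c = d then \<theta> (x - \<gamma>)
      else if c = a \<and> a \<noteq> b \<and> b = d then \<alpha> x (\<Lambda> a - \<Lambda> b)
      else if c = b \<and> b \<noteq> a \<and> a = d then \<beta> x (\<Lambda> b - \<Lambda> a)
      else 0)"

definition partition_function :: "(nat \<Rightarrow> nat \<Rightarrow> complex) \<Rightarrow> (nat \<Rightarrow> nat \<Rightarrow> complex)
    \<Rightarrow> (nat \<Rightarrow> nat \<Rightarrow> complex) \<Rightarrow> (nat \<Rightarrow> complex) \<Rightarrow> (nat \<Rightarrow> nat) \<Rightarrow> (nat \<Rightarrow> complex) \<Rightarrow> complex" where
  "partition_function z wI wII wM col lam =
     (\<Sum>(h, v)\<in>configs col. \<Prod>p\<in>{1..M}. \<Prod>r\<in>{1..k p}. \<Prod>s\<in>{1..N p}.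
        vertex_weight (z p r - col_var z wI wII wM p s) (corner col lam h v p r s)
          (h (p, r, s - 1)) (v (p, r, s)) (h (p, r, s)) (v (p, r - 1, s)))"

text \<open>\<open>pos col p a\<close> is the number of the column, within layer \<open>p\<close>, of the \<open>a\<close>-th
  element of \<open>Iset col p\<close>. The subtraction does not truncate, since the coordinates of layer \<open>M\<close>
  exceed the subtrahend.\<close>

definition pos :: "(nat \<Rightarrow> nat) \<Rightarrow> nat \<Rightarrow> nat \<Rightarrow> nat" where
  "pos col p a = (if p < M then nth_least (Itilde col p) a
                  else nth_least (Iset col M) a - (\<Sum>q\<in>{1..<M}. LI q))"

definition weight_function :: "(nat \<Rightarrow> nat \<Rightarrow> complex) \<Rightarrow> (nat \<Rightarrow> nat \<Rightarrow> complex)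
    \<Rightarrow> (nat \<Rightarrow> nat \<Rightarrow> complex) \<Rightarrow> (nat \<Rightarrow> complex) \<Rightarrow> (nat \<Rightarrow> nat) \<Rightarrow> (nat \<Rightarrow> complex) \<Rightarrow> complex" where
  "weight_function z wI wII wM col lam =
     \<theta> \<gamma> ^ (\<Sum>p\<in>{1..M}. k p) *
     (\<Sum>\<sigma>\<in>(\<Pi>\<^sub>E p\<in>{1..M}. {\<pi>. \<pi> permutes {1..k p}}).
        let z\<sigma> = (\<lambda>p a. z p (\<sigma> p a));
            m = col_var z\<sigma> wI wII wM
        in \<Prod>p\<in>{1..M}.
          (\<Prod>a\<in>{1..k p}.
             let s = pos col p a; I = nth_least (Iset col p) a; c = col I; L = lam_shift col lam p
             in (\<Prod>i\<in>{1..<s}. \<theta> (z\<sigma> p a - m p i)) *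
                (\<Prod>i\<in>{s<..N p}. \<theta> (z\<sigma> p a - m p i - \<gamma>)) *
                (\<theta> (z\<sigma> p a - m p s + L (p+1) - L c
                     + \<gamma> * (of_nat (C col p I c) - of_nat (C col p I (p+1)) - 1)) /
                 \<theta> (L c - L (p+1) + \<gamma> * (1 - of_nat (C col p I c))))) *
          (\<Prod>(a, b)\<in>{(a, b). a \<in> {1..k p} \<and> b \<in> {1..k p} \<and> a < b}.
             \<theta> (z\<sigma> p a - z\<sigma> p b + \<gamma>) / \<theta> (z\<sigma> p a - z\<sigma> p b)))"

end

end

theory Submission
  imports Defs "HOL-Combinatorics.Multiset_Permutations"
begin

text \<open>The products \<open>\<theta> (x + y) * \<theta> (x - y)\<close> are \<open>2 \<times> 2\<close> determinants in theta series of \<open>2\<tau>\<close>, which gives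
  the three-term relation of theta functions and from it the dynamical Yang--Baxter equation. Hence the weight
  of the columns to the left of a cut through a layer satisfies an exchange relation in neighbouring rows, and
  the weight of layers \<open>1, \<dots>, p\<close> satisfies one in neighbouring columns carrying the variables of layer
  \<open>p + 1\<close>. In layer \<open>p\<close> consider only the cut states in which the first \<open>j\<close> rows carry the colour \<open>p + 1\<close>
  and the other rows smaller colours. If the next column ends in \<open>p + 1\<close>, such a state has a single
  predecessor. Otherwise a colour leaves in one of the first \<open>j + 1\<close> rows; the exchange relation moves it
  to row \<open>j + 1\<close>, and the three-term relation sums up the coefficient of each row variable as a product. Induction
  on the columns yields the symmetrization over the row variables of one layer, and induction on the layers the
  weight function.\<close>

section \<open>The theta function\<close>

text \<open>The choice of \<open>\<lambda>^[p]\<close> makes the layers fit: passing to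
  \<open>\<lambda>^[p+1]\<close> subtracts \<gamma> times the colours of \<open>w_I^(p)\<close>, so
  the parameter of layer p at its first column with a variable \<open>z^(p+1)\<close> is the initial
  parameter of layer p + 1. The column relation of layer p is then the row relation
  \<open>exchangeable\<close> required of the left boundary of layer p + 1, and nothing else is
  remembered of the earlier layers. Hence the one-layer formula is stated for an arbitrary left
  boundary \<open>F\<close>. On the right boundary all rows carry p + 1, but the recursion on
  columns leaves such states: to the left of a column with a smaller top colour c, one row carries
  c. The state therefore has an upper block of rows with colour p + 1 and a lower block with a word
  \<open>as\<close> of smaller colours. The lower block stays frozen, since the bottom colour p + 1
  cannot turn into any of its rows. Nonzero vertices conserve the multiset of colours. So the
  dynamical parameter does not depend on the lattice path along which it is computed, and the
  definition, which goes along rows, can be read column by column.\<close>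

lemma abs_summable_exp_quadratic:
  fixes A B :: complex
  assumes "Re A < 0"
  shows "(\<lambda>n::int. norm (exp (A * of_int n ^ 2 + B * of_int n))) summable_on S"
proof -
  define a where "a = - Re A"
  \<comment> \<open>The exponent of \<open>K\<close> is the maximum of (b + 1) m - a m^2 over real
    m, with b = |Re B|. Taking b + 1 instead of b leaves a factor exp(-m) for the comparison with a
    geometric series.\<close>
  define K where "K = exp ((\<bar>Re B\<bar> + 1) ^ 2 / (4 * a))"
  have a: "a > 0" using assms by (simp add: a_def)
  have bound: "norm (exp (A * of_int n ^ 2 + B * of_int n)) \<le> K * exp (-1) ^ nat \<bar>n\<bar>" for n :: int
  proof -
    let ?m = "\<bar>real_of_int n\<bar>"
    have "Re (A * of_int n ^ 2 + B * of_int n) = - a * ?m ^ 2 + Re B * of_int n"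
      by (simp add: a_def power2_eq_square)
    also have "\<dots> \<le> - a * ?m ^ 2 + \<bar>Re B\<bar> * ?m"
      by (metis abs_ge_self abs_mult add_left_mono)
    also have "\<dots> \<le> (\<bar>Re B\<bar> + 1) ^ 2 / (4 * a) - ?m"
    proof -
      have "0 \<le> (2 * a * ?m - (\<bar>Re B\<bar> + 1)) ^ 2 / (4 * a)" using a by simp
      also have "\<dots> = a * ?m ^ 2 - (\<bar>Re B\<bar> + 1) * ?m + (\<bar>Re B\<bar> + 1) ^ 2 / (4 * a)"
        using a by (simp add: power2_diff power_mult_distrib field_simps power2_eq_square)
      finally show ?thesis by (simp add: algebra_simps)
    qed
    finally have "norm (exp (A * of_int n ^ 2 + B * of_int n)) \<le> K * exp (- ?m)"
      by (simp add: K_def exp_add[symmetric])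
    also have "exp (- ?m) = exp (-1) ^ nat \<bar>n\<bar>"
      by (simp add: exp_of_nat_mult[symmetric])
    finally show ?thesis .
  qed
  have geo: "(\<lambda>n::nat. K * exp (-1) ^ n) summable_on UNIV"
    by (rule summable_on_cmult_right, subst summable_on_UNIV_nonneg_real_iff)
       (auto intro: summable_geometric)
  have 1: "(\<lambda>n::int. K * exp (-1) ^ nat \<bar>n\<bar>) summable_on range int"
    using geo by (subst summable_on_reindex) (auto simp: o_def)
  have 2: "(\<lambda>n::int. K * exp (-1) ^ nat \<bar>n\<bar>) summable_on range (\<lambda>n. - int n)"
    using geo by (subst summable_on_reindex) (auto simp: o_def inj_def)
  have "range int \<union> range (\<lambda>n. - int n) = UNIV"
  proof -
    have "n \<in> range int \<union> range (\<lambda>n. - int n)" for n by (cases n rule: int_cases2) auto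
    then show ?thesis by auto
  qed
  with 1 2 have "(\<lambda>n::int. K * exp (-1) ^ nat \<bar>n\<bar>) summable_on UNIV"
    using summable_on_union by metis
  then have "(\<lambda>n::int. K * exp (-1) ^ nat \<bar>n\<bar>) summable_on S"
    by (rule summable_on_subset_banach) auto
  then show ?thesis
    by (rule summable_on_comparison_test) (use bound in auto)
qed

lemma abs_summable_times:
  fixes f :: "'a \<Rightarrow> complex" and g :: "'b \<Rightarrow> complex"
  assumes f: "(\<lambda>x. norm (f x)) summable_on A" and g: "(\<lambda>y. norm (g y)) summable_on B"
  shows "(\<lambda>(x, y). f x * g y) summable_on A \<times> B"
    and "(\<Sum>\<^sub>\<infinity>(x, y)\<in>A \<times> B. f x * g y) = infsum f A * infsum g B"
proof -
  have "(\<lambda>p. norm ((\<lambda>(x, y). f x * g y) p)) summable_on A \<times> B"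
  proof (rule Infinite_Sum.abs_summable_on_Sigma_iff[THEN iffD2], intro conjI ballI)
    show "(\<lambda>y. norm ((\<lambda>(x, y). f x * g y) (x, y))) summable_on B" for x
      using g by (simp add: norm_mult summable_on_cmult_right)
    show "(\<lambda>x. norm (\<Sum>\<^sub>\<infinity>y\<in>B. norm ((\<lambda>(x, y). f x * g y) (x, y)))) summable_on A"
      using f by (simp add: norm_mult infsum_cmult_right' abs_mult summable_on_cmult_left)
  qed
  then show s: "(\<lambda>(x, y). f x * g y) summable_on A \<times> B"
    using abs_summable_summable by blast
  show "(\<Sum>\<^sub>\<infinity>(x, y)\<in>A \<times> B. f x * g y) = infsum f A * infsum g B"
    by (subst infsum_Sigma'_banach[symmetric])
      (use s in \<open>simp_all add: infsum_cmult_right' infsum_cmult_left'\<close>)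
qed

text \<open>On the even and the odd integers these are the Jacobi series theta_3 and theta_2 with
  modulus 2 \<tau>, at the point 2 x.\<close>

definition theta_half :: "complex \<Rightarrow> int set \<Rightarrow> complex \<Rightarrow> complex" where
  "theta_half \<tau> S x =
     (\<Sum>\<^sub>\<infinity>a\<in>S. exp (\<i> * of_real pi * of_int a ^ 2 * \<tau> / 2 + 2 * of_real pi * \<i> * of_int a * x))"

text \<open>With \<open>a = m + n + 1\<close> and \<open>b = m - n\<close> the exponents of the double series separate, and
  \<open>(m, n)\<close> ranges over all pairs of integers exactly when \<open>(a, b)\<close> ranges over the pairs of
  opposite parity.\<close>

lemma theta_mult_theta:
  assumes "Im \<tau> > 0"
  shows "theta \<tau> (x + y) * theta \<tau> (x - y) =
    theta_half \<tau> {a. even a} x * theta_half \<tau> {a. odd a} y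
    - theta_half \<tau> {a. odd a} x * theta_half \<tau> {a. even a} y"
proof -
  define f where "f z n = exp (\<i> * of_real pi * (of_int n + 1/2)^2 * \<tau>
    + 2 * of_real pi * \<i> * (of_int n + 1/2) * (z + 1/2))" for z :: complex and n :: int
  define g where "g z a = exp (\<i> * of_real pi * of_int a ^ 2 * \<tau> / 2
    + 2 * of_real pi * \<i> * of_int a * z)" for z :: complex and a :: int
  have f_sum: "(\<lambda>n. norm (f z n)) summable_on UNIV" for z
  proof -
    define c where "c = exp (\<i> * of_real pi * \<tau> / 4 + of_real pi * \<i> * (z + 1/2))"
    have "f z n = c * exp ((\<i> * of_real pi * \<tau>) * of_int n ^ 2
        + (\<i> * of_real pi * \<tau> + 2 * of_real pi * \<i> * (z + 1/2)) * of_int n)" for n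
      unfolding f_def c_def exp_add[symmetric]
      by (rule arg_cong[of _ _ exp]) (simp add: field_simps power2_eq_square)
    moreover have "(\<lambda>n. norm (exp ((\<i> * of_real pi * \<tau>) * of_int n ^ 2
        + (\<i> * of_real pi * \<tau> + 2 * of_real pi * \<i> * (z + 1/2)) * of_int n))) summable_on UNIV"
      using assms by (intro abs_summable_exp_quadratic) (simp add: mult.commute)
    ultimately show ?thesis
      by (simp add: norm_mult summable_on_cmult_right)
  qed
  have g_sum: "(\<lambda>a. norm (g z a)) summable_on S" for z S
    using abs_summable_exp_quadratic[of "\<i> * of_real pi * \<tau> / 2" "2 * of_real pi * \<i> * z" S] assms
    by (simp add: g_def[abs_def] mult_ac)
  let ?ev = "{a::int. even a}" and ?od = "{a::int. odd a}"
  let ?h = "\<lambda>(m, n). (m + n + 1, m - n) :: int \<times> int"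
  have inj: "inj ?h" by (auto simp: inj_def)
  have img: "range ?h = ?ev \<times> ?od \<union> ?od \<times> ?ev"
  proof -
    have "(a, b) \<in> range ?h" if "odd (a + b)" for a b :: int
    proof
      show "(a, b) = ?h ((a + b - 1) div 2, (a - b - 1) div 2)" using that by auto presburger+
    qed simp
    then show ?thesis by auto
  qed
  \<comment> \<open>The sign stems from the 1/2 in z + 1/2: the two factors together contribute
    exp(i pi (m + n + 1)). It gives the two parity classes opposite signs, hence a
    determinant.\<close>
  have term_eq: "f (x + y) m * f (x - y) n = (-1) powi (m + n + 1) * (g x (m + n + 1) * g y (m - n))"
    for m n
  proof -
    have s: "(-1::complex) powi (m + n + 1) = exp (of_real pi * \<i> * of_int (m + n + 1))"
      using exp_power_int[of "of_real pi * \<i>" "m + n + 1"] by (simp add: mult.commute)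
    show ?thesis
      unfolding s f_def g_def exp_add[symmetric]
      by (rule arg_cong[of _ _ exp]) (simp add: field_simps power2_eq_square)
  qed
  have "theta \<tau> (x + y) * theta \<tau> (x - y) = (\<Sum>\<^sub>\<infinity>m. f (x + y) m) * (\<Sum>\<^sub>\<infinity>n. f (x - y) n)"
    by (simp add: theta_def f_def)
  also have "\<dots> = (\<Sum>\<^sub>\<infinity>(m, n)\<in>UNIV \<times> UNIV. f (x + y) m * f (x - y) n)"
    by (rule abs_summable_times(2)[OF f_sum f_sum, symmetric])
  also have "\<dots> = (\<Sum>\<^sub>\<infinity>p\<in>UNIV. (\<lambda>(a, b). (-1) powi a * (g x a * g y b)) (?h p))"
    by (auto intro!: infsum_cong simp: term_eq)
  also have "\<dots> = (\<Sum>\<^sub>\<infinity>(a, b)\<in>range ?h. (-1) powi a * (g x a * g y b))"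
    by (rule infsum_reindex[OF inj, symmetric, unfolded o_def])
  also have "\<dots> = (\<Sum>\<^sub>\<infinity>(a, b)\<in>?ev \<times> ?od. (-1) powi a * (g x a * g y b))
      + (\<Sum>\<^sub>\<infinity>(a, b)\<in>?od \<times> ?ev. (-1) powi a * (g x a * g y b))"
    unfolding img
  proof (rule infsum_Un_disjoint)
    show "(\<lambda>(a, b). (-1) powi a * (g x a * g y b)) summable_on ?ev \<times> ?od"
      using abs_summable_times(1)[OF g_sum[of x ?ev] g_sum[of y ?od]]
      by (rule summable_on_cong[THEN iffD1, rotated]) (auto simp: power_int_minus_left)
    show "(\<lambda>(a, b). (-1) powi a * (g x a * g y b)) summable_on ?od \<times> ?ev"
      using summable_on_uminus[THEN iffD2, OF abs_summable_times(1)[OF g_sum[of x ?od] g_sum[of y ?ev]]]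
      by (rule summable_on_cong[THEN iffD1, rotated]) (auto simp: power_int_minus_left)
  qed auto
  also have "(\<Sum>\<^sub>\<infinity>(a, b)\<in>?ev \<times> ?od. (-1) powi a * (g x a * g y b))
      = (\<Sum>\<^sub>\<infinity>(a, b)\<in>?ev \<times> ?od. g x a * g y b)"
    by (rule infsum_cong) (auto simp: power_int_minus_left)
  also have "\<dots> = theta_half \<tau> ?ev x * theta_half \<tau> ?od y"
    by (subst abs_summable_times(2)[OF g_sum g_sum]) (simp add: theta_half_def g_def[abs_def])
  also have "(\<Sum>\<^sub>\<infinity>(a, b)\<in>?od \<times> ?ev. (-1) powi a * (g x a * g y b))
      = (\<Sum>\<^sub>\<infinity>p\<in>?od \<times> ?ev. - (case p of (a, b) \<Rightarrow> g x a * g y b))"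
    by (rule infsum_cong) (auto simp: power_int_minus_left)
  also have "\<dots> = - (theta_half \<tau> ?od x * theta_half \<tau> ?ev y)"
    by (subst infsum_uminus, subst abs_summable_times(2)[OF g_sum g_sum])
      (simp add: theta_half_def g_def[abs_def])
  finally show ?thesis by simp
qed

text \<open>The determinant in \<open>theta_mult_theta\<close> changes sign when x and y are
  exchanged. Cancelling a nonzero value at some w gives oddness; without such a w both sides
  vanish.\<close>

lemma theta_minus:
  assumes "Im \<tau> > 0"
  shows "theta \<tau> (- z) = - theta \<tau> z"
proof (cases "\<exists>w. theta \<tau> w \<noteq> 0")
  case True
  then obtain w where w: "theta \<tau> w \<noteq> 0" by blast
  define x y where "x = (w + z) / 2" and "y = (w - z) / 2"
  have "x + y = w" "x - y = z" "y + x = w" "y - x = - z"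
    by (simp_all add: x_def y_def field_simps)
  then have "theta \<tau> w * theta \<tau> z = - (theta \<tau> w * theta \<tau> (- z))"
    using theta_mult_theta[OF assms, of x y] theta_mult_theta[OF assms, of y x] by simp
  then show ?thesis using w by (metis add.inverse_inverse minus_mult_right mult_left_cancel)
qed auto

text \<open>The Pluecker relation for the determinants of \<open>theta_mult_theta\<close>, in integral parameters.\<close>

lemma theta_three_term:
  assumes "Im \<tau> > 0"
  shows "theta \<tau> t * theta \<tau> p * theta \<tau> (t - p - 2 * q - r) * theta \<tau> r
    - theta \<tau> (t - q) * theta \<tau> (p + q) * theta \<tau> (t - p - q - r) * theta \<tau> (q + r)
    + theta \<tau> (t - q - r) * theta \<tau> (p + q + r) * theta \<tau> (t - p - q) * theta \<tau> q = 0"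
proof -
  \<comment> \<open>Each pair among these four points yields one 2 x 2 minor, and each of the three
    terms is a product of two complementary minors.\<close>
  define x y u v where "x = (t + p) / 2" and "y = (t - p) / 2" and "u = y - q" and "v = u - r"
  note xyuv = this
  have args: "x + y = t" "x - y = p" "u + v = t - p - 2 * q - r" "u - v = r"
    "x + u = t - q" "x - u = p + q" "y + v = t - p - q - r" "y - v = q + r"
    "x + v = t - q - r" "x - v = p + q + r" "y + u = t - p - q" "y - u = q"
    by (simp_all add: xyuv field_simps)
  note prods = theta_mult_theta[OF assms]
  show ?thesis
    using prods[of x y] prods[of u v] prods[of x u] prods[of y v] prods[of x v] prods[of y u]
    unfolding args mult.assoc by (simp only: mult.assoc[symmetric]) (simp add: algebra_simps)
qed

section \<open>The dynamical Yang--Baxter equation\<close>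

context elliptic_lattice
begin

context
  assumes Im_tau: "Im \<tau> > 0"
begin

lemma \<theta>_neg: "\<theta> (- z) = - \<theta> z"
  by (rule theta_minus[OF Im_tau])

lemmas three_term = theta_three_term[OF Im_tau]

text \<open>Orientation rules for the identities below: they leave one sign of each argument, since
  \<open>algebra\<close> would treat [x] and [-x] as unrelated atoms.\<close>

lemma \<theta>_flip:
  "\<theta> (\<gamma> - P) = - \<theta> (P - \<gamma>)" "\<theta> (\<gamma> * 2 - P) = - \<theta> (P - \<gamma> * 2)" "\<theta> (- P - Q) = - \<theta> (P + Q)"
  using \<theta>_neg[of "P - \<gamma>"] \<theta>_neg[of "P - \<gamma> * 2"] \<theta>_neg[of "P + Q"] by simp_all

text \<open>The names give the incoming and the outgoing colours of the matrix entry. P stands for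
  \<Lambda> a - \<Lambda> b, with a the doubled colour; for three different colours, P = \<Lambda> a
  - \<Lambda> b and Q = \<Lambda> b - \<Lambda> c. Entries with one term on each side, as here, hold
  by cancellation.\<close>

lemma dybe_aab_aab:
  assumes "\<theta> P \<noteq> 0" "\<theta> (P - \<gamma>) \<noteq> 0"
  shows "\<theta> (x - \<gamma>) * \<alpha> (x + y) (P - \<gamma>) * \<alpha> y P =
    \<alpha> y (P - \<gamma>) * \<alpha> (x + y) P * \<theta> (x - \<gamma>)"
  using assms unfolding \<alpha>_def \<beta>_def
  by (simp add: \<theta>_neg \<theta>_flip divide_simps algebra_simps)

text \<open>Three terms in all, which become the three products of one instance of
  \<open>three_term\<close> once denominators are cleared. The same happens wherever a single
  instance is used below.\<close>

lemma dybe_aab_aba: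
  assumes "\<theta> P \<noteq> 0" "\<theta> (P - \<gamma>) \<noteq> 0"
  shows "\<theta> (x - \<gamma>) * \<alpha> (x + y) (P - \<gamma>) * \<beta> y (- P) =
    \<beta> y (\<gamma> - P) * \<theta> (x + y - \<gamma>) * \<alpha> x (P - \<gamma>)
    + \<alpha> y (P - \<gamma>) * \<beta> (x + y) (- P) * \<beta> x (P - \<gamma>)"
  using assms three_term[of "x + y" "P - \<gamma>" "\<gamma>" "y - P"]
  unfolding \<alpha>_def \<beta>_def
  by (simp add: \<theta>_neg \<theta>_flip divide_simps algebra_simps) algebra

lemma dybe_aab_baa:
  assumes "\<theta> P \<noteq> 0" "\<theta> (P - \<gamma>) \<noteq> 0"
  shows "\<theta> (x - \<gamma>) * \<beta> (x + y) (\<gamma> - P) * \<theta> (y - \<gamma>) =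
    \<beta> y (\<gamma> - P) * \<theta> (x + y - \<gamma>) * \<beta> x (\<gamma> - P)
    + \<alpha> y (P - \<gamma>) * \<beta> (x + y) (- P) * \<alpha> x (\<gamma> - P)"
  using assms three_term[of "x + y - \<gamma>" "\<gamma>" "P - 2 * \<gamma>" "y - P + \<gamma>"]
  unfolding \<alpha>_def \<beta>_def
  by (simp add: \<theta>_neg \<theta>_flip divide_simps algebra_simps) algebra

lemma dybe_aba_aab:
  assumes "\<theta> P \<noteq> 0" "\<theta> (P - \<gamma>) \<noteq> 0"
  shows "\<alpha> x P * \<theta> (x + y - \<gamma>) * \<beta> y P
    + \<beta> x (- P) * \<beta> (x + y) (P - \<gamma>) * \<alpha> y P =
    \<beta> y (P - \<gamma>) * \<alpha> (x + y) P * \<theta> (x - \<gamma>)"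
  using assms three_term[of "x + y + P - \<gamma>" "\<gamma>" "P - \<gamma>" "y"]
  unfolding \<alpha>_def \<beta>_def
  by (simp add: \<theta>_neg \<theta>_flip divide_simps algebra_simps) algebra

text \<open>Two of the four terms share the factor [x] [y] [x + y - \<gamma>] and differ only in
  their dynamical coefficients. The second instance of \<open>three_term\<close>, free of x and y,
  evaluates the difference of these coefficients; the first then relates what remains.\<close>

lemma dybe_aba_aba:
  assumes "\<theta> P \<noteq> 0" "\<theta> (P - \<gamma>) \<noteq> 0"
  shows "\<alpha> x P * \<theta> (x + y - \<gamma>) * \<alpha> y (- P)
    + \<beta> x (- P) * \<beta> (x + y) (P - \<gamma>) * \<beta> y (- P) =
    \<alpha> y (\<gamma> - P) * \<theta> (x + y - \<gamma>) * \<alpha> x (P - \<gamma>)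
    + \<beta> y (P - \<gamma>) * \<beta> (x + y) (- P) * \<beta> x (P - \<gamma>)"
  using assms three_term[of "x + y + P - \<gamma>" "P - \<gamma>" "P" "y - P"]
    three_term[of "P + (P - \<gamma>)" "\<gamma>" "P - \<gamma> - \<gamma>" "\<gamma>"]
  unfolding \<alpha>_def \<beta>_def
  by (simp add: \<theta>_neg \<theta>_flip divide_simps algebra_simps) algebra

lemma dybe_aba_baa:
  assumes "\<theta> P \<noteq> 0" "\<theta> (P - \<gamma>) \<noteq> 0"
  shows "\<beta> x (- P) * \<alpha> (x + y) (\<gamma> - P) * \<theta> (y - \<gamma>) =
    \<alpha> y (\<gamma> - P) * \<theta> (x + y - \<gamma>) * \<beta> x (\<gamma> - P)
    + \<beta> y (P - \<gamma>) * \<beta> (x + y) (- P) * \<alpha> x (\<gamma> - P)"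
  using assms three_term[of "x + y" "P - \<gamma>" "\<gamma>" "y - \<gamma>"]
  unfolding \<alpha>_def \<beta>_def
  by (simp add: \<theta>_neg \<theta>_flip divide_simps algebra_simps) algebra

lemma dybe_baa_aab:
  assumes "\<theta> P \<noteq> 0" "\<theta> (P - \<gamma>) \<noteq> 0"
  shows "\<beta> x P * \<theta> (x + y - \<gamma>) * \<beta> y P
    + \<alpha> x (- P) * \<beta> (x + y) (P - \<gamma>) * \<alpha> y P =
    \<theta> (y - \<gamma>) * \<beta> (x + y) P * \<theta> (x - \<gamma>)"
  using assms three_term[of "x + y + P" "P" "\<gamma>" "y - \<gamma>"]
  unfolding \<alpha>_def \<beta>_def
  by (simp add: \<theta>_neg \<theta>_flip divide_simps algebra_simps) algebra

lemma dybe_baa_aba: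
  assumes "\<theta> P \<noteq> 0" "\<theta> (P - \<gamma>) \<noteq> 0"
  shows "\<beta> x P * \<theta> (x + y - \<gamma>) * \<alpha> y (- P)
    + \<alpha> x (- P) * \<beta> (x + y) (P - \<gamma>) * \<beta> y (- P) =
    \<theta> (y - \<gamma>) * \<alpha> (x + y) (- P) * \<beta> x (P - \<gamma>)"
  using assms three_term[of "x + y + P - \<gamma>" "\<gamma>" "P - \<gamma>" "y - P"]
  unfolding \<alpha>_def \<beta>_def
  by (simp add: \<theta>_neg \<theta>_flip divide_simps algebra_simps) algebra

lemma dybe_baa_baa:
  assumes "\<theta> P \<noteq> 0" "\<theta> (P - \<gamma>) \<noteq> 0"
  shows "\<alpha> x (- P) * \<alpha> (x + y) (\<gamma> - P) * \<theta> (y - \<gamma>) =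
    \<theta> (y - \<gamma>) * \<alpha> (x + y) (- P) * \<alpha> x (\<gamma> - P)"
  using assms unfolding \<alpha>_def \<beta>_def
  by (simp add: \<theta>_neg \<theta>_flip divide_simps algebra_simps)

lemma dybe_abc_abc:
  assumes "\<theta> P \<noteq> 0" "\<theta> Q \<noteq> 0" "\<theta> (P + Q) \<noteq> 0"
  shows "\<alpha> x P * \<alpha> (x + y) (P + Q) * \<alpha> y Q =
    \<alpha> y Q * \<alpha> (x + y) (P + Q) * \<alpha> x P"
  using assms unfolding \<alpha>_def \<beta>_def
  by (simp add: \<theta>_neg \<theta>_flip divide_simps algebra_simps)

lemma dybe_abc_acb:
  assumes "\<theta> P \<noteq> 0" "\<theta> Q \<noteq> 0" "\<theta> (P + Q) \<noteq> 0"
  shows "\<alpha> x P * \<alpha> (x + y) (P + Q) * \<beta> y (- Q) =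
    \<beta> y (- Q) * \<alpha> (x + y) P * \<alpha> x (P + Q)"
  using assms unfolding \<alpha>_def \<beta>_def
  by (simp add: \<theta>_neg \<theta>_flip divide_simps algebra_simps)

lemma dybe_abc_bac:
  assumes "\<theta> P \<noteq> 0" "\<theta> Q \<noteq> 0" "\<theta> (P + Q) \<noteq> 0"
  shows "\<beta> x (- P) * \<alpha> (x + y) Q * \<alpha> y (P + Q) =
    \<alpha> y Q * \<alpha> (x + y) (P + Q) * \<beta> x (- P)"
  using assms unfolding \<alpha>_def \<beta>_def
  by (simp add: \<theta>_neg \<theta>_flip divide_simps algebra_simps)

lemma dybe_abc_bca:
  assumes "\<theta> P \<noteq> 0" "\<theta> Q \<noteq> 0" "\<theta> (P + Q) \<noteq> 0"
  shows "\<beta> x (- P) * \<alpha> (x + y) Q * \<beta> y (- P - Q) =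
    \<beta> y (- Q) * \<beta> (x + y) (- P) * \<alpha> x Q
    + \<alpha> y Q * \<beta> (x + y) (- P - Q) * \<beta> x Q"
  using assms three_term[of "x + y" "Q" "P" "y - P - Q"]
  unfolding \<alpha>_def \<beta>_def
  by (simp add: \<theta>_neg \<theta>_flip divide_simps algebra_simps) algebra

lemma dybe_abc_cab:
  assumes "\<theta> P \<noteq> 0" "\<theta> Q \<noteq> 0" "\<theta> (P + Q) \<noteq> 0"
  shows "\<alpha> x P * \<beta> (x + y) (- P - Q) * \<beta> y P
    + \<beta> x (- P) * \<beta> (x + y) (- Q) * \<alpha> y P =
    \<beta> y (- Q) * \<alpha> (x + y) P * \<beta> x (- P - Q)"
  using assms three_term[of "x + y" "P" "Q" "y - Q"]
  unfolding \<alpha>_def \<beta>_def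
  by (simp add: \<theta>_neg \<theta>_flip divide_simps algebra_simps) algebra

text \<open>As for \<open>dybe_aba_aba\<close>: the second instance compares the coefficients of the
  two terms containing [x] [y], which depend only on P and Q.\<close>

lemma dybe_abc_cba:
  assumes "\<theta> P \<noteq> 0" "\<theta> Q \<noteq> 0" "\<theta> (P + Q) \<noteq> 0"
  shows "\<alpha> x P * \<beta> (x + y) (- P - Q) * \<alpha> y (- P)
    + \<beta> x (- P) * \<beta> (x + y) (- Q) * \<beta> y (- P) =
    \<beta> y (- Q) * \<beta> (x + y) (- P) * \<beta> x (- Q)
    + \<alpha> y Q * \<beta> (x + y) (- P - Q) * \<alpha> x (- Q)"
  using assms three_term[of "x + y - Q" "Q" "P - Q" "y - P"]
    three_term[of "P + Q" "\<gamma>" "Q - \<gamma>" "\<gamma>"]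
  unfolding \<alpha>_def \<beta>_def
  by (simp add: \<theta>_neg \<theta>_flip divide_simps algebra_simps) algebra

end

section \<open>Dynamical shifts and the Yang--Baxter equation for all colours\<close>

definition colours :: "nat set" where "colours = {1..M+1}"

lemma finite_colours [simp]: "finite colours"
  by (simp add: colours_def)

text \<open>The parameter after crossing edges of colours \<open>xs\<close>. It depends only on the
  multiset of \<open>xs\<close>, so every use of colour conservation ends in
  \<open>shift_mset\<close>.\<close>

definition shift :: "(nat \<Rightarrow> complex) \<Rightarrow> nat list \<Rightarrow> nat \<Rightarrow> complex" where
  "shift \<Lambda> xs = (\<lambda>j. \<Lambda> j - \<gamma> * of_nat (count_list xs j))"

lemma shift_Nil [simp]: "shift \<Lambda> [] = \<Lambda>"
  by (simp add: shift_def)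

lemma shift_shift [simp]: "shift (shift \<Lambda> xs) ys = shift \<Lambda> (xs @ ys)"
  by (simp add: shift_def fun_eq_iff algebra_simps)

lemma shift_mset: "mset xs = mset ys \<Longrightarrow> shift \<Lambda> xs = shift \<Lambda> ys"
  unfolding shift_def count_mset[symmetric] by simp

lemma generic_shift: "generic_dynamical \<Lambda> \<Longrightarrow> generic_dynamical (shift \<Lambda> xs)"
  unfolding generic_dynamical_def colours_def[symmetric]
proof (intro ballI impI allI)
  fix i j and n :: int
  assume *: "\<forall>i\<in>colours. \<forall>j\<in>colours. i \<noteq> j \<longrightarrow>
    (\<forall>n::int. \<theta> (\<Lambda> i - \<Lambda> j + of_int n * \<gamma>) \<noteq> 0)" "i \<in> colours" "j \<in> colours" "i \<noteq> j"
  have "shift \<Lambda> xs i - shift \<Lambda> xs j + of_int n * \<gamma> =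
    \<Lambda> i - \<Lambda> j + of_int (n - int (count_list xs i) + int (count_list xs j)) * \<gamma>"
    by (simp add: shift_def algebra_simps)
  then show "\<theta> (shift \<Lambda> xs i - shift \<Lambda> xs j + of_int n * \<gamma>) \<noteq> 0"
    using * by metis
qed

lemma genericD:
  assumes "generic_dynamical \<Lambda>" "i \<in> colours" "j \<in> colours" "i \<noteq> j"
  shows "\<theta> (\<Lambda> i - \<Lambda> j + of_int n * \<gamma>) \<noteq> 0"
  using assms unfolding generic_dynamical_def colours_def by blast

abbreviation R :: "complex \<Rightarrow> (nat \<Rightarrow> complex) \<Rightarrow> nat \<Rightarrow> nat \<Rightarrow> nat \<Rightarrow> nat \<Rightarrow> complex" where
  "R \<equiv> vertex_weight"

lemma R_conserve: "R x \<Lambda> a b c d \<noteq> 0 \<Longrightarrow> {#a, b#} = {#c, d#}"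
  by (auto simp: vertex_weight_def split: if_splits)

definition vsum :: "complex \<Rightarrow> (nat \<Rightarrow> complex) \<Rightarrow> nat \<Rightarrow> nat \<Rightarrow> (nat \<Rightarrow> nat \<Rightarrow> complex) \<Rightarrow> complex"
  \<comment> \<open>A vertex applied to a function of its outgoing colours. Nested, it has at most
    two surviving terms per vertex, and all outgoing colours are treated at once.\<close>
  where "vsum x \<Lambda> a b F = (\<Sum>c\<in>colours. \<Sum>d\<in>colours. R x \<Lambda> a b c d * F c d)"

lemma vsum_same: "a \<in> colours \<Longrightarrow> vsum x \<Lambda> a a F = \<theta> (x - \<gamma>) * F a a"
proof -
  assume a: "a \<in> colours"
  have "R x \<Lambda> a a c d * F c d = (if d = a then if c = a then \<theta> (x - \<gamma>) * F a a else 0 else 0)" for c d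
    by (auto simp: vertex_weight_def)
  then show ?thesis using a by (simp add: vsum_def)
qed

lemma vsum_distinct:
  assumes "a \<in> colours" "b \<in> colours" "a \<noteq> b"
  shows "vsum x \<Lambda> a b F = \<alpha> x (\<Lambda> a - \<Lambda> b) * F a b + \<beta> x (\<Lambda> b - \<Lambda> a) * F b a"
proof -
  have "R x \<Lambda> a b c d * F c d =
      (if d = b then if c = a then \<alpha> x (\<Lambda> a - \<Lambda> b) * F a b else 0 else 0) +
      (if d = a then if c = b then \<beta> x (\<Lambda> b - \<Lambda> a) * F b a else 0 else 0)" for c d
    using assms(3) by (auto simp: vertex_weight_def)
  then show ?thesis using assms by (simp add: vsum_def sum.distrib)
qed

text \<open>Bundles three of the coefficient identities above; \<open>g1\<close>, \<open>g2\<close>,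
  \<open>g3\<close> become values of the test function.\<close>

lemma linear_combination_cong:
  fixes c1 :: complex
  assumes "c1 = d1" "c2 = d2" "c3 = d3"
  shows "c1 * g1 + c2 * g2 + c3 * g3 = d1 * g1 + d2 * g2 + d3 * g3"
  using assms by simp

lemma vsum_zero [simp]: "vsum x \<Lambda> a b (\<lambda>c d. 0) = 0"
  by (simp add: vsum_def)

lemma vsum_indicator1:
  assumes "c \<in> colours"
  shows "vsum x \<Lambda> a b (\<lambda>c' d. if c' = c then F d else 0) = (\<Sum>d\<in>colours. R x \<Lambda> a b c d * F d)"
proof -
  have "R x \<Lambda> a b c' d * (if c' = c then F d else 0) = (if c' = c then R x \<Lambda> a b c d * F d else 0)"
    for c' d by simp
  then show ?thesis using assms
    by (simp add: vsum_def sum.swap[of _ colours colours])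
qed

lemma vsum_indicator2:
  assumes "d \<in> colours"
  shows "vsum x \<Lambda> a b (\<lambda>c d'. if d' = d then F c d' else 0) = (\<Sum>c\<in>colours. R x \<Lambda> a b c d * F c d)"
proof -
  have "R x \<Lambda> a b c d' * (if d' = d then F c d' else 0) = (if d' = d then R x \<Lambda> a b c d * F c d else 0)"
    for c d' by simp
  then show ?thesis using assms by (simp add: vsum_def)
qed

context
  assumes Im_tau: "Im \<tau> > 0"
begin

text \<open>By colour conservation both sides are combinations of the values of G at the
  rearrangements of (i1, i2, i3). The cases say which incoming colours coincide, leaving one, three
  or six coefficients to compare, each by its own \<open>dybe\<close> identity.\<close>

lemma dybe_vsum:
  assumes gen: "generic_dynamical \<Lambda>" and i: "i1 \<in> colours" "i2 \<in> colours" "i3 \<in> colours"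
  shows "vsum x \<Lambda> i1 i2 (\<lambda>m1 m2. vsum (x + y) (shift \<Lambda> [m2]) m1 i3
      (\<lambda>o1 m3. vsum y \<Lambda> m2 m3 (\<lambda>o2 o3. G o1 o2 o3))) =
    vsum y (shift \<Lambda> [i1]) i2 i3 (\<lambda>m2 m3. vsum (x + y) \<Lambda> i1 m3
      (\<lambda>m1 o3. vsum x (shift \<Lambda> [o3]) m1 m2 (\<lambda>o1 o2. G o1 o2 o3)))"
    (is "?L = ?R")
proof -
  have nz: "\<theta> (\<Lambda> a - \<Lambda> b) \<noteq> 0" "\<theta> (\<Lambda> a - \<Lambda> b - \<gamma>) \<noteq> 0"
    if "a \<in> colours" "b \<in> colours" "a \<noteq> b" for a b
    using genericD[OF gen that, of 0] genericD[OF gen that, of "-1"] by simp_all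
  consider (same) "i1 = i2" "i2 = i3" | (aab) "i1 = i2" "i2 \<noteq> i3" | (aba) "i1 = i3" "i1 \<noteq> i2"
    | (baa) "i2 = i3" "i1 \<noteq> i2" | (abc) "i1 \<noteq> i2" "i2 \<noteq> i3" "i1 \<noteq> i3" by metis
  then show ?thesis
  proof cases
    case same
    then show ?thesis using i by (simp add: vsum_same)
  next
    case aab
    define a b P where "a = i1" and "b = i3" and "P = \<Lambda> a - \<Lambda> b"
    have eqs: "i1 = a" "i2 = a" "i3 = b" and ab: "a \<in> colours" "b \<in> colours" "a \<noteq> b" "b \<noteq> a"
      and P: "\<Lambda> a = P + \<Lambda> b"
      using aab i by (simp_all add: a_def b_def P_def)
    note ids = dybe_aab_aab[OF Im_tau nz[OF ab(1-3), folded P_def], of x y]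
      dybe_aab_aba[OF Im_tau nz[OF ab(1-3), folded P_def], of x y]
      dybe_aab_baa[OF Im_tau nz[OF ab(1-3), folded P_def], of x y]
    show ?thesis
      unfolding eqs
      by (rule trans[OF _ trans[OF linear_combination_cong[OF ids, of "G a a b" "G a b a" "G b a a"]]])
        (use ab in \<open>simp_all add: vsum_same vsum_distinct shift_def P algebra_simps\<close>)
  next
    case aba
    define a b P where "a = i1" and "b = i2" and "P = \<Lambda> a - \<Lambda> b"
    have eqs: "i1 = a" "i2 = b" "i3 = a" and ab: "a \<in> colours" "b \<in> colours" "a \<noteq> b" "b \<noteq> a"
      and P: "\<Lambda> a = P + \<Lambda> b"
      using aba i by (simp_all add: a_def b_def P_def)
    note ids = dybe_aba_aab[OF Im_tau nz[OF ab(1-3), folded P_def], of x y]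
      dybe_aba_aba[OF Im_tau nz[OF ab(1-3), folded P_def], of x y]
      dybe_aba_baa[OF Im_tau nz[OF ab(1-3), folded P_def], of x y]
    show ?thesis
      unfolding eqs
      by (rule trans[OF _ trans[OF linear_combination_cong[OF ids, of "G a a b" "G a b a" "G b a a"]]])
        (use ab in \<open>simp_all add: vsum_same vsum_distinct shift_def P algebra_simps\<close>)
  next
    case baa
    define a b P where "a = i2" and "b = i1" and "P = \<Lambda> a - \<Lambda> b"
    have eqs: "i1 = b" "i2 = a" "i3 = a" and ab: "a \<in> colours" "b \<in> colours" "a \<noteq> b" "b \<noteq> a"
      and P: "\<Lambda> a = P + \<Lambda> b"
      using baa i by (simp_all add: a_def b_def P_def)
    note ids = dybe_baa_aab[OF Im_tau nz[OF ab(1-3), folded P_def], of x y]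
      dybe_baa_aba[OF Im_tau nz[OF ab(1-3), folded P_def], of x y]
      dybe_baa_baa[OF Im_tau nz[OF ab(1-3), folded P_def], of x y]
    show ?thesis
      unfolding eqs
      by (rule trans[OF _ trans[OF linear_combination_cong[OF ids, of "G a a b" "G a b a" "G b a a"]]])
        (use ab in \<open>simp_all add: vsum_same vsum_distinct shift_def P algebra_simps\<close>)
  next
    case abc
    define a b c P Q where "a = i1" and "b = i2" and "c = i3"
      and "P = \<Lambda> a - \<Lambda> b" and "Q = \<Lambda> b - \<Lambda> c"
    have eqs: "i1 = a" "i2 = b" "i3 = c" and abc: "a \<in> colours" "b \<in> colours" "c \<in> colours"
      "a \<noteq> b" "b \<noteq> a" "b \<noteq> c" "c \<noteq> b" "a \<noteq> c" "c \<noteq> a"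
      and PQ: "\<Lambda> a = P + Q + \<Lambda> c" "\<Lambda> b = Q + \<Lambda> c"
      using abc i by (simp_all add: a_def b_def c_def P_def Q_def)
    have nz3: "\<theta> P \<noteq> 0" "\<theta> Q \<noteq> 0" "\<theta> (P + Q) \<noteq> 0"
      using nz(1)[of a b] nz(1)[of b c] nz(1)[of a c] abc by (simp_all add: PQ)
    note ids = dybe_abc_abc[OF Im_tau nz3, of x y]
      dybe_abc_acb[OF Im_tau nz3, of x y]
      dybe_abc_bac[OF Im_tau nz3, of x y]
      dybe_abc_bca[OF Im_tau nz3, of x y]
      dybe_abc_cab[OF Im_tau nz3, of x y]
      dybe_abc_cba[OF Im_tau nz3, of x y]
    show ?thesis
      unfolding eqs
      by (rule trans[OF _ trans[OF arg_cong2[of _ _ _ _ "(+)",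
              OF linear_combination_cong[OF ids(1-3), of "G a b c" "G a c b" "G b a c"]
              linear_combination_cong[OF ids(4-6), of "G b c a" "G c a b" "G c b a"]]]])
        (use abc in \<open>simp_all add: vsum_same vsum_distinct shift_def PQ algebra_simps\<close>)
  qed
qed

theorem dybe:
  assumes "generic_dynamical \<Lambda>" "i1 \<in> colours" "i2 \<in> colours" "i3 \<in> colours"
    and o: "o1 \<in> colours" "o2 \<in> colours" "o3 \<in> colours"
  shows "(\<Sum>m1\<in>colours. \<Sum>m2\<in>colours. R x \<Lambda> i1 i2 m1 m2 * (\<Sum>m3\<in>colours.
      R (x + y) (shift \<Lambda> [m2]) m1 i3 o1 m3 * R y \<Lambda> m2 m3 o2 o3)) =
    (\<Sum>m2\<in>colours. \<Sum>m3\<in>colours. R y (shift \<Lambda> [i1]) i2 i3 m2 m3 * (\<Sum>m1\<in>colours.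
      R (x + y) \<Lambda> i1 m3 m1 o3 * R x (shift \<Lambda> [o3]) m1 m2 o1 o2))"
proof -
  \<comment> \<open>Testing against the indicator of (o1, o2, o3) extracts one matrix entry.\<close>
  define G where "G a b c = (if a = o1 then if b = o2 then if c = o3 then 1 else 0 else 0 else 0 :: complex)"
    for a b c
  have "vsum y \<Lambda> a b (G c) = (if c = o1 then R y \<Lambda> a b o2 o3 else 0)" for a b c
    using o by (cases "c = o1") (simp_all add: G_def[abs_def] vsum_indicator1 mult_delta_right)
  moreover have "vsum z \<Lambda>' a b (\<lambda>c d. G c d e) =
      (if e = o3 then R z \<Lambda>' a b o1 o2 else 0)" for z \<Lambda>' a b e
    using o by (cases "e = o3") (simp_all add: G_def[abs_def] vsum_indicator1 mult_delta_right)
  ultimately show ?thesis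
    using dybe_vsum[OF assms(1-4), of x y G] o
    by (simp add: vsum_indicator1 vsum_indicator2) (simp add: vsum_def)
qed

end
end

section \<open>Exchange relations for columns of vertices\<close>

lemma sum_rotate3:
  "(\<Sum>a\<in>A. \<Sum>b\<in>B. \<Sum>c\<in>C. f a b c) = (\<Sum>c\<in>C. \<Sum>a\<in>A. \<Sum>b\<in>B. f a b c)"
proof -
  have "(\<Sum>a\<in>A. \<Sum>b\<in>B. \<Sum>c\<in>C. f a b c) = (\<Sum>a\<in>A. \<Sum>c\<in>C. \<Sum>b\<in>B. f a b c)"
    by (intro sum.cong refl sum.swap)
  then show ?thesis by (simp only: sum.swap[of _ A C])
qed

lemma sum_rotate4:
  "(\<Sum>a\<in>A. \<Sum>b\<in>B. \<Sum>c\<in>C. \<Sum>d\<in>D. f a b c d) = (\<Sum>d\<in>D. \<Sum>a\<in>A. \<Sum>b\<in>B. \<Sum>c\<in>C. f a b c d)"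
  by (subst sum_rotate3) (rule sum.swap)

lemma sum_swap_outer4:
  "(\<Sum>a\<in>A. \<Sum>b\<in>B. \<Sum>c\<in>C. \<Sum>d\<in>D. f a b c d) = (\<Sum>d\<in>D. \<Sum>b\<in>B. \<Sum>c\<in>C. \<Sum>a\<in>A. f a b c d)"
  by (subst sum_rotate4, subst sum_rotate3) (intro sum.cong refl sum_rotate3[symmetric])

context elliptic_lattice
begin

definition words :: "nat \<Rightarrow> nat list set" where
  "words n = {xs. length xs = n \<and> set xs \<subseteq> colours}"

lemma finite_words [simp]: "finite (words n)"
  unfolding words_def using finite_lists_length_eq[OF finite_colours, of n]
  by (simp add: conj_commute)

lemma words_0 [simp]: "words 0 = {[]}"
  by (auto simp: words_def)

lemma Nil_in_words [simp]: "[] \<in> words n \<longleftrightarrow> n = 0"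
  by (auto simp: words_def)

lemma Cons_in_words [simp]: "x # xs \<in> words (Suc n) \<longleftrightarrow> x \<in> colours \<and> xs \<in> words n"
  by (auto simp: words_def)

lemma words_Suc: "words (Suc n) = (\<lambda>(x, xs). x # xs) ` (colours \<times> words n)"
  by (auto simp: words_def length_Suc_conv image_iff)

lemma sum_words_Suc:
  "(\<Sum>xs\<in>words (Suc n). f xs) = (\<Sum>x\<in>colours. \<Sum>xs\<in>words n. f (x # xs))"
  unfolding words_Suc
  by (subst sum.reindex) (auto simp: inj_on_def sum.cartesian_product split_def o_def)

lemma sum_words_add:
  "(\<Sum>xs\<in>words (n + l). f xs) = (\<Sum>xs\<in>words n. \<Sum>ys\<in>words l. f (xs @ ys))"
  by (induction n arbitrary: f) (simp_all add: sum_words_Suc)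

text \<open>One column \<open>w\<close>, with the rows \<open>zs\<close> listed from top to bottom: \<open>xs\<close> are the left colours, \<open>ys\<close> the
  right ones, \<open>b\<close> and \<open>t\<close> the bottom and top colours, and \<open>\<Lambda>\<close> is the parameter at the upper-left corner.\<close>

fun colw :: "(nat \<Rightarrow> complex) \<Rightarrow> complex list \<Rightarrow> complex \<Rightarrow> nat list \<Rightarrow> nat \<Rightarrow> nat list \<Rightarrow> nat \<Rightarrow> complex"
where
  "colw \<Lambda> (z # zs) w (x # xs) b (y # ys) t =
     (\<Sum>m\<in>colours. R (z - w) \<Lambda> x m y t * colw (shift \<Lambda> [x]) zs w xs b ys m)"
| "colw \<Lambda> [] w [] b [] t = (if b = t then 1 else 0)"
| "colw \<Lambda> _ w _ b _ t = 0"

lemma colw_conserve: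
  "colw \<Lambda> zs w xs b ys t \<noteq> 0 \<Longrightarrow> add_mset b (mset xs) = add_mset t (mset ys)"
proof (induction \<Lambda> zs w xs b ys t rule: colw.induct)
  case (1 \<Lambda> z zs w x xs b y ys t)
  then obtain m where m: "R (z - w) \<Lambda> x m y t \<noteq> 0" "colw (shift \<Lambda> [x]) zs w xs b ys m \<noteq> 0"
    "m \<in> colours"
    by (metis (no_types, lifting) colw.simps(1) mult_eq_0_iff sum.neutral)
  have "add_mset b (mset (x # xs)) = add_mset x (add_mset m (mset ys))"
    using "1.IH"[OF m(3,2)] by simp
  also have "\<dots> = {#x, m#} + mset ys" by simp
  also have "\<dots> = {#y, t#} + mset ys" using R_conserve[OF m(1)] by simp
  finally show ?case by simp
qed (auto split: if_splits)

lemma colw_append: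
  assumes "length xs1 = length zs1" "length ys1 = length zs1" and "t \<in> colours"
  shows "colw \<Lambda> (zs1 @ zs2) w (xs1 @ xs2) b (ys1 @ ys2) t =
    (\<Sum>m\<in>colours. colw \<Lambda> zs1 w xs1 m ys1 t * colw (shift \<Lambda> xs1) zs2 w xs2 b ys2 m)"
  using assms
proof (induction zs1 arbitrary: xs1 ys1 \<Lambda> t)
  case Nil
  then have "colw \<Lambda> [] w [] m [] t * colw \<Lambda> zs2 w xs2 b ys2 m =
    (if m = t then colw \<Lambda> zs2 w xs2 b ys2 m else 0)" for m by simp
  then show ?case using Nil by simp
next
  case (Cons z zs1)
  obtain x xs y ys where eqs: "xs1 = x # xs" "ys1 = y # ys" "length xs = length zs1" "length ys = length zs1"
    using Cons.prems by (auto simp: length_Suc_conv)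
  show ?case
    unfolding eqs(1,2)
    by (simp add: Cons.IH eqs sum_distrib_left sum_distrib_right mult.assoc) (rule sum.swap)
qed

text \<open>A vertex of the row lines u and v is pulled through the column w. At the two rows
  themselves this is \<open>dybe\<close> for the lines u, v, w; the rows above are stripped off by
  induction, and the rows below see only the total colour content of the two edges.\<close>

lemma colw_row_exchange:
  assumes "Im \<tau> > 0" and "generic_dynamical \<Lambda>"
    and "length xs1 = length zs1" "length ys1 = length zs1"
    and "t \<in> colours" "x1 \<in> colours" "x2 \<in> colours" "c \<in> colours" "d \<in> colours"
  shows "(\<Sum>a\<in>colours. \<Sum>b\<in>colours. R (u - v) (shift \<Lambda> (t # ys1)) a b c d *
      colw \<Lambda> (zs1 @ u # v # zs2) w (xs1 @ x1 # x2 # xs2) e (ys1 @ a # b # ys2) t) =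
    (\<Sum>a\<in>colours. \<Sum>b\<in>colours. R (u - v) (shift \<Lambda> xs1) x1 x2 a b *
      colw \<Lambda> (zs1 @ v # u # zs2) w (xs1 @ b # a # xs2) e (ys1 @ d # c # ys2) t)"
  using assms(2-5)
proof (induction zs1 arbitrary: xs1 ys1 \<Lambda> t)
  case Nil
  let ?C = "\<lambda>m. colw (shift \<Lambda> [x1, x2]) zs2 w xs2 e ys2 m"
  have "(\<Sum>a\<in>colours. \<Sum>b\<in>colours. R (u - v) (shift \<Lambda> [t]) a b c d *
      colw \<Lambda> (u # v # zs2) w (x1 # x2 # xs2) e (a # b # ys2) t) =
    (\<Sum>a\<in>colours. \<Sum>b\<in>colours. \<Sum>m\<in>colours. \<Sum>m'\<in>colours. ?C m' *
      (R (v - w) (shift \<Lambda> [x1]) x2 m' b m * (R (u - w) \<Lambda> x1 m a t * R (u - v) (shift \<Lambda> [t]) a b c d)))"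
    by (simp add: sum_distrib_left mult_ac)
  also have "\<dots> = (\<Sum>m'\<in>colours. ?C m' * (\<Sum>b\<in>colours. \<Sum>m\<in>colours. R (v - w) (shift \<Lambda> [x1]) x2 m' b m *
      (\<Sum>a\<in>colours. R (u - w) \<Lambda> x1 m a t * R (u - v) (shift \<Lambda> [t]) a b c d)))"
    unfolding sum_distrib_left by (subst sum_swap_outer4) simp
  also have "\<dots> = (\<Sum>m'\<in>colours. ?C m' * (\<Sum>a\<in>colours. \<Sum>b\<in>colours. R (u - v) \<Lambda> x1 x2 a b *
      (\<Sum>m\<in>colours. R (u - w) (shift \<Lambda> [b]) a m' c m * R (v - w) \<Lambda> b m d t)))"
  proof (rule sum.cong[OF refl], rule arg_cong2[of _ _ _ _ "(*)", OF refl])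
    fix m assume m: "m \<in> colours"
    show "(\<Sum>b\<in>colours. \<Sum>m'\<in>colours. R (v - w) (shift \<Lambda> [x1]) x2 m b m' *
        (\<Sum>a\<in>colours. R (u - w) \<Lambda> x1 m' a t * R (u - v) (shift \<Lambda> [t]) a b c d)) =
      (\<Sum>a\<in>colours. \<Sum>b\<in>colours. R (u - v) \<Lambda> x1 x2 a b *
        (\<Sum>m'\<in>colours. R (u - w) (shift \<Lambda> [b]) a m c m' * R (v - w) \<Lambda> b m' d t))"
      using dybe[OF assms(1) Nil(1) assms(6,7) m assms(8,9) Nil(4), of "u - v" "v - w"] by simp
  qed
  also have "\<dots> = (\<Sum>a\<in>colours. \<Sum>b\<in>colours. R (u - v) \<Lambda> x1 x2 a b *
      (\<Sum>m\<in>colours. R (v - w) \<Lambda> b m d t * (\<Sum>m'\<in>colours. R (u - w) (shift \<Lambda> [b]) a m' c m * ?C m')))"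
    unfolding sum_distrib_left by (subst sum_rotate4[symmetric]) (simp add: mult_ac)
  also have "\<dots> = (\<Sum>a\<in>colours. \<Sum>b\<in>colours. R (u - v) \<Lambda> x1 x2 a b *
      colw \<Lambda> (v # u # zs2) w (b # a # xs2) e (d # c # ys2) t)"
  proof (intro sum.cong refl)
    fix a b
    show "R (u - v) \<Lambda> x1 x2 a b * (\<Sum>m\<in>colours. R (v - w) \<Lambda> b m d t *
        (\<Sum>m'\<in>colours. R (u - w) (shift \<Lambda> [b]) a m' c m * ?C m')) =
      R (u - v) \<Lambda> x1 x2 a b * colw \<Lambda> (v # u # zs2) w (b # a # xs2) e (d # c # ys2) t"
    proof (cases "R (u - v) \<Lambda> x1 x2 a b = 0")
      case False
      \<comment> \<open>The rows below start from the parameter past x1 and x2, which is the one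
        past b and a whenever the vertex does not vanish.\<close>
      then have "shift \<Lambda> [x1, x2] = shift \<Lambda> [b, a]"
        using R_conserve by (intro shift_mset) fastforce
      then show ?thesis by simp
    qed simp
  qed
  finally show ?case using Nil by simp
next
  case (Cons z zs1)
  obtain x xs y ys where eqs: "xs1 = x # xs" "ys1 = y # ys" "length xs = length zs1" "length ys = length zs1"
    using Cons.prems by (auto simp: length_Suc_conv)
  let ?L = "\<lambda>a b m. colw (shift \<Lambda> [x]) (zs1 @ u # v # zs2) w (xs @ x1 # x2 # xs2) e (ys @ a # b # ys2) m"
  let ?K = "\<lambda>a b m. colw (shift \<Lambda> [x]) (zs1 @ v # u # zs2) w (xs @ b # a # xs2) e (ys @ d # c # ys2) m"
  have "(\<Sum>a\<in>colours. \<Sum>b\<in>colours. R (u - v) (shift \<Lambda> (t # ys1)) a b c d *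
      colw \<Lambda> ((z # zs1) @ u # v # zs2) w (xs1 @ x1 # x2 # xs2) e (ys1 @ a # b # ys2) t) =
    (\<Sum>m\<in>colours. R (z - w) \<Lambda> x m y t * (\<Sum>a\<in>colours. \<Sum>b\<in>colours.
      R (u - v) (shift \<Lambda> (t # y # ys)) a b c d * ?L a b m))"
    unfolding eqs sum_distrib_left
    by (subst sum_rotate3[symmetric]) (simp add: sum_distrib_left mult_ac)
  also have "\<dots> = (\<Sum>m\<in>colours. R (z - w) \<Lambda> x m y t * (\<Sum>a\<in>colours. \<Sum>b\<in>colours.
      R (u - v) (shift \<Lambda> (x # xs)) x1 x2 a b * ?K a b m))"
  proof (intro sum.cong refl)
    fix m assume m: "m \<in> colours"
    show "R (z - w) \<Lambda> x m y t * (\<Sum>a\<in>colours. \<Sum>b\<in>colours.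
        R (u - v) (shift \<Lambda> (t # y # ys)) a b c d * ?L a b m) =
      R (z - w) \<Lambda> x m y t * (\<Sum>a\<in>colours. \<Sum>b\<in>colours.
        R (u - v) (shift \<Lambda> (x # xs)) x1 x2 a b * ?K a b m)"
    proof (cases "R (z - w) \<Lambda> x m y t = 0")
      case False
      then have "shift \<Lambda> (t # y # ys) = shift (shift \<Lambda> [x]) (m # ys)"
        using R_conserve[OF False] by (subst shift_shift, intro shift_mset) (simp add: add_mset_commute)
      then show ?thesis
        using Cons.IH[OF generic_shift[OF Cons.prems(1)] eqs(3,4) m, of "[x]"] by simp
    qed simp
  qed
  also have "\<dots> = (\<Sum>a\<in>colours. \<Sum>b\<in>colours. R (u - v) (shift \<Lambda> xs1) x1 x2 a b *
      colw \<Lambda> ((z # zs1) @ v # u # zs2) w (xs1 @ b # a # xs2) e (ys1 @ d # c # ys2) t)"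
    unfolding eqs sum_distrib_left
    by (subst sum_rotate3[symmetric]) (simp add: sum_distrib_left mult_ac)
  finally show ?case .
qed

end

section \<open>Exchange of two adjacent columns\<close>

lemma sum_swap_2_2:
  "(\<Sum>a\<in>A. \<Sum>b\<in>B. \<Sum>c\<in>C. \<Sum>d\<in>D. f a b c d) = (\<Sum>c\<in>C. \<Sum>d\<in>D. \<Sum>a\<in>A. \<Sum>b\<in>B. f a b c d)"
  by (subst sum_rotate4, subst sum_rotate4) simp

lemma sum_swap_2_3:
  "(\<Sum>a\<in>A. \<Sum>b\<in>B. \<Sum>c\<in>C. \<Sum>d\<in>D. \<Sum>e\<in>E. f a b c d e) =
    (\<Sum>c\<in>C. \<Sum>d\<in>D. \<Sum>e\<in>E. \<Sum>a\<in>A. \<Sum>b\<in>B. f a b c d e)"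
  by (subst sum_swap_2_2) (intro sum.cong refl sum_rotate3)

context elliptic_lattice
begin

definition colw2 :: "(nat \<Rightarrow> complex) \<Rightarrow> complex list \<Rightarrow> complex \<Rightarrow> complex \<Rightarrow> nat list \<Rightarrow> nat \<Rightarrow> nat
    \<Rightarrow> nat list \<Rightarrow> nat \<Rightarrow> nat \<Rightarrow> complex" where
  "colw2 \<Lambda> zs u v xs b1 b2 ys t1 t2 = (\<Sum>ms\<in>words (length zs).
     colw \<Lambda> zs u xs b1 ms t1 * colw (shift \<Lambda> [t1]) zs v ms b2 ys t2)"

lemma colw2_Nil: "colw2 \<Lambda> [] u v [] b1 b2 [] t1 t2 = (if b1 = t1 \<and> b2 = t2 then 1 else 0)"
  by (simp add: colw2_def)

text \<open>In the recursion of the second column the lower rows begin past the colours t1 and m, in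
  that of the pair past x and p. Conservation at the first vertex identifies the two
  parameters.\<close>

lemma colw2_Cons:
  "colw2 \<Lambda> (z # zs) u v (x # xs) b1 b2 (y # ys) t1 t2 =
    (\<Sum>p\<in>colours. \<Sum>q\<in>colours. (\<Sum>m\<in>colours. R (z - u) \<Lambda> x p m t1 * R (z - v) (shift \<Lambda> [t1]) m q y t2) *
      colw2 (shift \<Lambda> [x]) zs u v xs b1 b2 ys p q)"
proof -
  let ?A = "\<lambda>m p. R (z - u) \<Lambda> x p m t1" and ?B = "\<lambda>m q. R (z - v) (shift \<Lambda> [t1]) m q y t2"
  let ?c = "\<lambda>ms p. colw (shift \<Lambda> [x]) zs u xs b1 ms p"
  let ?d = "\<lambda>\<Lambda> ms q. colw \<Lambda> zs v ms b2 ys q"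
  have "colw2 \<Lambda> (z # zs) u v (x # xs) b1 b2 (y # ys) t1 t2 =
    (\<Sum>m\<in>colours. \<Sum>ms\<in>words (length zs). \<Sum>p\<in>colours. \<Sum>q\<in>colours.
      ?A m p * ?B m q * (?c ms p * ?d (shift \<Lambda> [t1, m]) ms q))"
    by (simp add: colw2_def sum_words_Suc sum_product mult_ac)
  also have "\<dots> = (\<Sum>m\<in>colours. \<Sum>ms\<in>words (length zs). \<Sum>p\<in>colours. \<Sum>q\<in>colours.
      ?A m p * ?B m q * (?c ms p * ?d (shift \<Lambda> [x, p]) ms q))"
  proof (intro sum.cong refl)
    fix m ms p q
    show "?A m p * ?B m q * (?c ms p * ?d (shift \<Lambda> [t1, m]) ms q) =
        ?A m p * ?B m q * (?c ms p * ?d (shift \<Lambda> [x, p]) ms q)"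
    proof (cases "?A m p = 0")
      case False
      then have "shift \<Lambda> [t1, m] = shift \<Lambda> [x, p]"
        using R_conserve[OF False] by (intro shift_mset) (simp add: add_mset_commute)
      then show ?thesis by simp
    qed simp
  qed
  also have "\<dots> = (\<Sum>p\<in>colours. \<Sum>q\<in>colours. \<Sum>m\<in>colours. \<Sum>ms\<in>words (length zs).
      ?A m p * ?B m q * (?c ms p * ?d (shift \<Lambda> [x, p]) ms q))"
    by (subst sum_swap_2_2) (intro sum.cong refl sum.swap)
  also have "\<dots> = (\<Sum>p\<in>colours. \<Sum>q\<in>colours. (\<Sum>m\<in>colours. ?A m p * ?B m q) *
      colw2 (shift \<Lambda> [x]) zs u v xs b1 b2 ys p q)"
    by (simp add: colw2_def sum_product)
  finally show ?thesis .
qed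

text \<open>The zipper argument: the vertex of the two column lines enters at the top and is pushed
  down one row at a time by \<open>dybe\<close>, swapping u and v on its way, until it acts on the
  bottom colours.\<close>

lemma colw2_exchange:
  assumes "Im \<tau> > 0" and "generic_dynamical \<Lambda>"
    and "length xs = length zs" "length ys = length zs" "set xs \<subseteq> colours" "set ys \<subseteq> colours"
    and "c \<in> colours" "d \<in> colours" "b1 \<in> colours" "b2 \<in> colours"
  shows "(\<Sum>t1\<in>colours. \<Sum>t2\<in>colours. R (u - v) \<Lambda> t1 t2 c d * colw2 \<Lambda> zs u v xs b1 b2 ys t1 t2) =
    (\<Sum>a\<in>colours. \<Sum>b\<in>colours. R (u - v) (shift \<Lambda> xs) b1 b2 a b * colw2 \<Lambda> zs v u xs b a ys d c)"
  using assms(2-8)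
proof (induction zs arbitrary: xs ys \<Lambda> c d)
  case Nil
  have 1: "R (u - v) \<Lambda> t1 t2 c d * colw2 \<Lambda> [] u v [] b1 b2 [] t1 t2 =
      (if t2 = b2 then if t1 = b1 then R (u - v) \<Lambda> b1 b2 c d else 0 else 0)" for t1 t2
    by (simp add: colw2_Nil)
  have 2: "R (u - v) \<Lambda> b1 b2 a b * colw2 \<Lambda> [] v u [] b a [] d c =
      (if b = d then if a = c then R (u - v) \<Lambda> b1 b2 c d else 0 else 0)" for a b
    by (simp add: colw2_Nil)
  show ?case using Nil assms(9,10) by (simp add: 1 2)
next
  case (Cons z zs)
  obtain x xs' y ys' where eqs: "xs = x # xs'" "ys = y # ys'" "length xs' = length zs" "length ys' = length zs"
    using Cons.prems by (auto simp: length_Suc_conv)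
  have xy: "x \<in> colours" "y \<in> colours" "set xs' \<subseteq> colours" "set ys' \<subseteq> colours"
    using Cons.prems eqs by auto
  let ?\<Lambda> = "shift \<Lambda> [x]"
  let ?A = "\<lambda>\<Lambda> p m t. R (z - u) \<Lambda> x p m t" and ?B = "\<lambda>\<Lambda> m q t. R (z - v) \<Lambda> m q y t"
  have "(\<Sum>t1\<in>colours. \<Sum>t2\<in>colours. R (u - v) \<Lambda> t1 t2 c d * colw2 \<Lambda> (z # zs) u v xs b1 b2 ys t1 t2) =
    (\<Sum>t1\<in>colours. \<Sum>t2\<in>colours. \<Sum>p\<in>colours. \<Sum>q\<in>colours. \<Sum>m\<in>colours. colw2 ?\<Lambda> zs u v xs' b1 b2 ys' p q *
      (R (z - u) \<Lambda> x p m t1 * (R (z - v) (shift \<Lambda> [t1]) m q y t2 * R (u - v) \<Lambda> t1 t2 c d)))"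
    by (simp add: eqs colw2_Cons sum_distrib_left sum_distrib_right mult_ac)
  also have "\<dots> = (\<Sum>p\<in>colours. \<Sum>q\<in>colours. colw2 ?\<Lambda> zs u v xs' b1 b2 ys' p q *
      (\<Sum>m\<in>colours. \<Sum>t1\<in>colours. R (z - u) \<Lambda> x p m t1 * (\<Sum>t2\<in>colours.
        R (z - v) (shift \<Lambda> [t1]) m q y t2 * R (u - v) \<Lambda> t1 t2 c d)))"
    unfolding sum_distrib_left
    by (rule sum_swap_2_3)
  also have "\<dots> = (\<Sum>p\<in>colours. \<Sum>q\<in>colours. colw2 ?\<Lambda> zs u v xs' b1 b2 ys' p q *
      (\<Sum>s1\<in>colours. \<Sum>s2\<in>colours. R (u - v) ?\<Lambda> p q s1 s2 * (\<Sum>m\<in>colours.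
        R (z - v) \<Lambda> x s2 m d * R (z - u) (shift \<Lambda> [d]) m s1 y c)))"
  proof (rule sum.cong[OF refl], rule sum.cong[OF refl], rule arg_cong2[of _ _ _ _ "(*)", OF refl])
    fix p q assume "p \<in> colours" "q \<in> colours"
    then show "(\<Sum>m\<in>colours. \<Sum>t1\<in>colours. R (z - u) \<Lambda> x p m t1 * (\<Sum>t2\<in>colours.
        R (z - v) (shift \<Lambda> [t1]) m q y t2 * R (u - v) \<Lambda> t1 t2 c d)) =
      (\<Sum>s1\<in>colours. \<Sum>s2\<in>colours. R (u - v) ?\<Lambda> p q s1 s2 * (\<Sum>m\<in>colours.
        R (z - v) \<Lambda> x s2 m d * R (z - u) (shift \<Lambda> [d]) m s1 y c))"
      using dybe[OF assms(1) Cons.prems(1) xy(1) _ _ xy(2) Cons.prems(6,7), of p q "z - u" "u - v"] by simp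
  qed
  also have "\<dots> = (\<Sum>s1\<in>colours. \<Sum>s2\<in>colours. (\<Sum>p\<in>colours. \<Sum>q\<in>colours. R (u - v) ?\<Lambda> p q s1 s2 *
      colw2 ?\<Lambda> zs u v xs' b1 b2 ys' p q) * (\<Sum>m\<in>colours.
        R (z - v) \<Lambda> x s2 m d * R (z - u) (shift \<Lambda> [d]) m s1 y c))"
    unfolding sum_distrib_left sum_distrib_right
    by (subst sum_swap_2_3) (simp add: mult_ac)
  also have "\<dots> = (\<Sum>s1\<in>colours. \<Sum>s2\<in>colours. (\<Sum>a\<in>colours. \<Sum>b\<in>colours. R (u - v) (shift \<Lambda> xs) b1 b2 a b *
      colw2 ?\<Lambda> zs v u xs' b a ys' s2 s1) * (\<Sum>m\<in>colours.
        R (z - v) \<Lambda> x s2 m d * R (z - u) (shift \<Lambda> [d]) m s1 y c))"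
    by (rule sum.cong[OF refl], rule sum.cong[OF refl], rule arg_cong2[of _ _ _ _ "(*)", OF _ refl])
      (simp add: Cons.IH[OF generic_shift[OF Cons.prems(1)] eqs(3,4) xy(3,4)] eqs(1))
  also have "\<dots> = (\<Sum>a\<in>colours. \<Sum>b\<in>colours. R (u - v) (shift \<Lambda> xs) b1 b2 a b * (\<Sum>s2\<in>colours. \<Sum>s1\<in>colours.
      (\<Sum>m\<in>colours. R (z - v) \<Lambda> x s2 m d * R (z - u) (shift \<Lambda> [d]) m s1 y c) *
        colw2 ?\<Lambda> zs v u xs' b a ys' s2 s1))"
    unfolding sum_distrib_left sum_distrib_right
    by (subst sum.swap, subst sum_swap_2_3[symmetric]) (simp add: mult_ac)
  also have "\<dots> = (\<Sum>a\<in>colours. \<Sum>b\<in>colours. R (u - v) (shift \<Lambda> xs) b1 b2 a b *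
      colw2 \<Lambda> (z # zs) v u xs b a ys d c)"
    by (simp add: eqs colw2_Cons)
  finally show ?case .
qed


text \<open>\<open>F zs xs\<close> is the weight of everything to the left of the rows \<open>zs\<close> carrying the colours \<open>xs\<close>. For
  \<open>c = d\<close> the relation only says that \<open>F\<close> is symmetric up to a factor which may vanish.\<close>

definition exchangeable ::
    "(nat \<Rightarrow> complex) \<Rightarrow> (complex list \<Rightarrow> nat list \<Rightarrow> complex) \<Rightarrow> bool" where
  "exchangeable \<Lambda> F \<longleftrightarrow> (\<forall>zs1 u v zs2. \<forall>xs1\<in>words (length zs1). \<forall>xs2\<in>words (length zs2).
     \<forall>c\<in>colours. \<forall>d\<in>colours.
       (\<Sum>a\<in>colours. \<Sum>b\<in>colours. R (u - v) (shift \<Lambda> xs1) a b c d *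
         F (zs1 @ u # v # zs2) (xs1 @ a # b # xs2)) =
       \<theta> (u - v - \<gamma>) * F (zs1 @ v # u # zs2) (xs1 @ d # c # xs2))"

text \<open>\<open>n\<close> is the colour at the bottom, p + 1 in layer p, and
  \<open>\<Lambda>\<close> is the parameter at the upper-left corner, before the top colour
  \<open>t\<close> is crossed.\<close>

definition column :: "nat \<Rightarrow> (nat \<Rightarrow> complex) \<Rightarrow> complex \<Rightarrow> nat \<Rightarrow> (complex list \<Rightarrow> nat list \<Rightarrow> complex)
    \<Rightarrow> complex list \<Rightarrow> nat list \<Rightarrow> complex" where
  "column n \<Lambda> w t F = (\<lambda>zs ys. \<Sum>xs\<in>words (length zs). F zs xs * colw \<Lambda> zs w xs n ys t)"

fun columns :: "nat \<Rightarrow> (nat \<Rightarrow> complex) \<Rightarrow> (complex list \<Rightarrow> nat list \<Rightarrow> complex)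
    \<Rightarrow> complex list \<Rightarrow> nat list \<Rightarrow> complex list \<Rightarrow> nat list \<Rightarrow> complex" where
  "columns n \<Lambda> F (w # ws) (t # ts) = columns n (shift \<Lambda> [t]) (column n \<Lambda> w t F) ws ts"
| "columns n \<Lambda> F _ _ = F"

lemma columns_append:
  assumes "length ws1 = length ts1"
  shows "columns n \<Lambda> F (ws1 @ ws2) (ts1 @ ts2) =
    columns n (shift \<Lambda> ts1) (columns n \<Lambda> F ws1 ts1) ws2 ts2"
  using assms by (induction ws1 ts1 arbitrary: \<Lambda> F rule: list_induct2) simp_all

lemma columns_cong:
  assumes "\<And>ys. ys \<in> words (length zs) \<Longrightarrow> F zs ys = G zs ys" "ys \<in> words (length zs)"
  shows "columns n \<Lambda> F ws ts zs ys = columns n \<Lambda> G ws ts zs ys"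
  using assms(1)
proof (induction ws arbitrary: ts \<Lambda> F G)
  case Nil
  then show ?case using assms(2) by simp
next
  case (Cons w ws)
  show ?case
  proof (cases ts)
    case (Cons t us)
    have "column n \<Lambda> w t F zs ys = column n \<Lambda> w t G zs ys" for ys
      unfolding column_def by (intro sum.cong[OF refl] arg_cong2[of _ _ _ _ "(*)"] Cons.prems refl)
    then show ?thesis unfolding Cons columns.simps by (rule Cons.IH)
  qed (use Cons.prems assms(2) in simp)
qed

lemma column_linear:
  "column n \<Lambda> w t (\<lambda>zs ys. \<Sum>i\<in>I. c i * G i zs ys) =
    (\<lambda>zs ys. \<Sum>i\<in>I. c i * column n \<Lambda> w t (G i) zs ys)"
  unfolding column_def sum_distrib_left sum_distrib_right fun_eq_iff
  by (intro allI, subst sum.swap) (simp add: mult_ac)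

lemma columns_linear:
  "columns n \<Lambda> (\<lambda>zs ys. \<Sum>i\<in>I. c i * G i zs ys) ws ts =
    (\<lambda>zs ys. \<Sum>i\<in>I. c i * columns n \<Lambda> (G i) ws ts zs ys)"
proof (induction ws arbitrary: ts \<Lambda> G)
  case (Cons w ws)
  then show ?case by (cases ts) (simp_all add: column_linear)
qed simp

text \<open>\<open>colw_row_exchange\<close> moves the vertex of the two row lines from the right
  side of the column to its left side, where the hypothesis on \<open>F\<close> absorbs it.\<close>

lemma exchangeable_column:
  assumes "Im \<tau> > 0" and "generic_dynamical \<Lambda>" and F: "exchangeable \<Lambda> F" and "t \<in> colours"
  shows "exchangeable (shift \<Lambda> [t]) (column n \<Lambda> w t F)"
  unfolding exchangeable_def
proof (intro allI ballI)
  fix zs1 zs2 :: "complex list" and u v ys1 ys2 c d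
  assume ys: "ys1 \<in> words (length zs1)" "ys2 \<in> words (length zs2)" and cd: "c \<in> colours" "d \<in> colours"
  let ?W1 = "words (length zs1)" and ?W2 = "words (length zs2)"
  let ?zs = "zs1 @ u # v # zs2" and ?zs' = "zs1 @ v # u # zs2"
  let ?R = "\<lambda>a b. R (u - v) (shift (shift \<Lambda> [t]) ys1) a b c d"
  let ?K = "\<lambda>xs1 a b xs2. colw \<Lambda> ?zs' w (xs1 @ b # a # xs2) n (ys1 @ d # c # ys2) t"
  have split: "(\<Sum>xs\<in>words (length (zs1 @ p # q # zs2)). f xs) =
      (\<Sum>xs1\<in>?W1. \<Sum>xs2\<in>?W2. \<Sum>a\<in>colours. \<Sum>b\<in>colours. f (xs1 @ a # b # xs2))"
    for f :: "nat list \<Rightarrow> complex" and p q :: complex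
  proof -
    have "length (zs1 @ p # q # zs2) = length zs1 + Suc (Suc (length zs2))" by simp
    then show ?thesis
      unfolding \<open>length _ = _\<close> sum_words_add sum_words_Suc
      by (intro sum.cong[OF refl] sum_rotate3)
  qed
  have "(\<Sum>a\<in>colours. \<Sum>b\<in>colours. ?R a b * column n \<Lambda> w t F ?zs (ys1 @ a # b # ys2)) =
      (\<Sum>xs\<in>words (length ?zs). F ?zs xs * (\<Sum>a\<in>colours. \<Sum>b\<in>colours. ?R a b *
        colw \<Lambda> ?zs w xs n (ys1 @ a # b # ys2) t))"
    unfolding column_def sum_distrib_left
    by (subst sum_rotate3) (simp add: mult_ac)
  also have "\<dots> = (\<Sum>xs1\<in>?W1. \<Sum>xs2\<in>?W2. \<Sum>x1\<in>colours. \<Sum>x2\<in>colours. F ?zs (xs1 @ x1 # x2 # xs2) *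
      (\<Sum>a\<in>colours. \<Sum>b\<in>colours. R (u - v) (shift \<Lambda> xs1) x1 x2 a b * ?K xs1 a b xs2))"
    unfolding split
  proof ((rule sum.cong[OF refl])+)
    fix xs1 xs2 x1 x2
    assume "xs1 \<in> ?W1" "xs2 \<in> ?W2" "x1 \<in> colours" "x2 \<in> colours"
    then have "(\<Sum>a\<in>colours. \<Sum>b\<in>colours. R (u - v) (shift \<Lambda> (t # ys1)) a b c d *
        colw \<Lambda> ?zs w (xs1 @ x1 # x2 # xs2) n (ys1 @ a # b # ys2) t) =
      (\<Sum>a\<in>colours. \<Sum>b\<in>colours. R (u - v) (shift \<Lambda> xs1) x1 x2 a b * ?K xs1 a b xs2)"
      using ys cd assms by (intro colw_row_exchange) (auto simp: words_def)
    then show "F ?zs (xs1 @ x1 # x2 # xs2) * (\<Sum>a\<in>colours. \<Sum>b\<in>colours. ?R a b *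
        colw \<Lambda> ?zs w (xs1 @ x1 # x2 # xs2) n (ys1 @ a # b # ys2) t) =
      F ?zs (xs1 @ x1 # x2 # xs2) *
      (\<Sum>a\<in>colours. \<Sum>b\<in>colours. R (u - v) (shift \<Lambda> xs1) x1 x2 a b * ?K xs1 a b xs2)" by simp
  qed
  also have "\<dots> = (\<Sum>xs1\<in>?W1. \<Sum>xs2\<in>?W2. \<Sum>a\<in>colours. \<Sum>b\<in>colours. ?K xs1 a b xs2 *
      (\<Sum>x1\<in>colours. \<Sum>x2\<in>colours. R (u - v) (shift \<Lambda> xs1) x1 x2 a b * F ?zs (xs1 @ x1 # x2 # xs2)))"
    unfolding sum_distrib_left
    by (rule sum.cong[OF refl], rule sum.cong[OF refl], subst sum_swap_2_2) (simp add: mult_ac)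
  also have "\<dots> = (\<Sum>xs1\<in>?W1. \<Sum>xs2\<in>?W2. \<Sum>a\<in>colours. \<Sum>b\<in>colours. ?K xs1 a b xs2 *
      (\<theta> (u - v - \<gamma>) * F ?zs' (xs1 @ b # a # xs2)))"
    by ((rule sum.cong[OF refl])+, rule arg_cong2[of _ _ _ _ "(*)", OF refl])
      (use F in \<open>unfold exchangeable_def, blast\<close>)
  also have "\<dots> = \<theta> (u - v - \<gamma>) * column n \<Lambda> w t F ?zs' (ys1 @ d # c # ys2)"
    unfolding column_def split sum_distrib_left
    by (rule sum.cong[OF refl], rule sum.cong[OF refl], subst sum.swap) (simp add: mult_ac)
  finally show "(\<Sum>a\<in>colours. \<Sum>b\<in>colours. ?R a b * column n \<Lambda> w t F ?zs (ys1 @ a # b # ys2)) =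
    \<theta> (u - v - \<gamma>) * column n \<Lambda> w t F ?zs' (ys1 @ d # c # ys2)" .
qed

lemma column_column:
  "column n (shift \<Lambda> [t1]) v t2 (column n \<Lambda> u t1 F) zs ys =
    (\<Sum>xs\<in>words (length zs). F zs xs * colw2 \<Lambda> zs u v xs n n ys t1 t2)"
  unfolding column_def colw2_def sum_distrib_left sum_distrib_right
  by (subst sum.swap) (simp add: mult_ac)

text \<open>After the zipper the vertex sits at the bottom between two edges of colour n, where it
  is diagonal and leaves the scalar [u - v - \<gamma>]. This holds for every
  \<open>F\<close>.\<close>

lemma column_column_exchange:
  assumes "Im \<tau> > 0" and "generic_dynamical \<Lambda>" and "n \<in> colours" "c \<in> colours" "d \<in> colours"
    and ys: "ys \<in> words (length zs)"
  shows "(\<Sum>a\<in>colours. \<Sum>b\<in>colours. R (u - v) \<Lambda> a b c d *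
      column n (shift \<Lambda> [a]) v b (column n \<Lambda> u a F) zs ys) =
    \<theta> (u - v - \<gamma>) * column n (shift \<Lambda> [d]) u c (column n \<Lambda> v d F) zs ys"
proof -
  have "(\<Sum>a\<in>colours. \<Sum>b\<in>colours. R (u - v) \<Lambda> a b c d *
      column n (shift \<Lambda> [a]) v b (column n \<Lambda> u a F) zs ys) =
    (\<Sum>xs\<in>words (length zs). F zs xs * (\<Sum>a\<in>colours. \<Sum>b\<in>colours. R (u - v) \<Lambda> a b c d *
      colw2 \<Lambda> zs u v xs n n ys a b))"
    unfolding column_column sum_distrib_left by (subst sum_rotate3) (simp add: mult_ac)
  also have "\<dots> = (\<Sum>xs\<in>words (length zs). F zs xs *
      vsum (u - v) (shift \<Lambda> xs) n n (\<lambda>a b. colw2 \<Lambda> zs v u xs b a ys d c))"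
  proof (rule sum.cong[OF refl], rule arg_cong2[of _ _ _ _ "(*)", OF refl])
    fix xs assume "xs \<in> words (length zs)"
    then show "(\<Sum>a\<in>colours. \<Sum>b\<in>colours. R (u - v) \<Lambda> a b c d * colw2 \<Lambda> zs u v xs n n ys a b) =
        vsum (u - v) (shift \<Lambda> xs) n n (\<lambda>a b. colw2 \<Lambda> zs v u xs b a ys d c)"
      unfolding vsum_def using assms by (intro colw2_exchange) (auto simp: words_def)
  qed
  also have "\<dots> = \<theta> (u - v - \<gamma>) * column n (shift \<Lambda> [d]) u c (column n \<Lambda> v d F) zs ys"
    by (simp add: vsum_same assms(3) column_column sum_distrib_left mult_ac)
  finally show ?thesis .
qed

text \<open>The columns \<open>us\<close> in the middle will carry the row variables of the next
  layer. The columns to their left only move the parameter to \<open>shift \<Lambda> ts1\<close>;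
  those to their right act linearly on the relation for the middle ones.\<close>

lemma exchangeable_columns:
  assumes "Im \<tau> > 0" and "generic_dynamical \<Lambda>" and "n \<in> colours" and "ys \<in> words (length zs)"
    and "length ws1 = length ts1"
  shows "exchangeable (shift \<Lambda> ts1)
    (\<lambda>us xs. columns n \<Lambda> F (ws1 @ us @ ws2) (ts1 @ xs @ ts2) zs ys)"
  unfolding exchangeable_def
proof (intro allI ballI)
  fix us1 us2 :: "complex list" and u v xs1 xs2 c d
  assume xs: "xs1 \<in> words (length us1)" "xs2 \<in> words (length us2)" and cd: "c \<in> colours" "d \<in> colours"
  define \<Lambda>' G where "\<Lambda>' = shift \<Lambda> (ts1 @ xs1)" and "G = columns n \<Lambda> F (ws1 @ us1) (ts1 @ xs1)"
  have col: "columns n \<Lambda> F (ws1 @ (us1 @ p # q # us2) @ ws2) (ts1 @ (xs1 @ a # b # xs2) @ ts2) =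
      columns n (shift \<Lambda>' [a, b]) (column n (shift \<Lambda>' [a]) q b (column n \<Lambda>' p a G))
        (us2 @ ws2) (xs2 @ ts2)" for p q a b
    using columns_append[of "ws1 @ us1" "ts1 @ xs1" n \<Lambda> F "p # q # us2 @ ws2" "a # b # xs2 @ ts2"]
      xs assms(5) by (simp add: \<Lambda>'_def G_def words_def)
  let ?H = "\<lambda>p q a b. column n (shift \<Lambda>' [a]) q b (column n \<Lambda>' p a G)"
  let ?c = "\<lambda>H. columns n (shift \<Lambda>' [d, c]) H (us2 @ ws2) (xs2 @ ts2) zs ys"
  \<comment> \<open>The columns further right start from the same parameter in all nonvanishing
    terms, so one linear operator \<open>?c\<close> can be applied to the whole sum.\<close>
  have same_shift: "R (u - v) \<Lambda>' a b c d * columns n (shift \<Lambda>' [a, b]) (?H u v a b) (us2 @ ws2) (xs2 @ ts2) zs ys =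
      R (u - v) \<Lambda>' a b c d * ?c (?H u v a b)" for a b
  proof (cases "R (u - v) \<Lambda>' a b c d = 0")
    case False
    then have "shift \<Lambda>' [a, b] = shift \<Lambda>' [d, c]"
      using R_conserve[OF False] by (intro shift_mset) (simp add: add_mset_commute)
    then show ?thesis by simp
  qed simp
  have "(\<Sum>a\<in>colours. \<Sum>b\<in>colours. R (u - v) (shift (shift \<Lambda> ts1) xs1) a b c d *
      columns n \<Lambda> F (ws1 @ (us1 @ u # v # us2) @ ws2) (ts1 @ (xs1 @ a # b # xs2) @ ts2) zs ys) =
    (\<Sum>a\<in>colours. \<Sum>b\<in>colours. R (u - v) \<Lambda>' a b c d * ?c (?H u v a b))"
    unfolding col shift_shift[of _ ts1] \<Lambda>'_def[symmetric]
    by ((rule sum.cong[OF refl])+, rule same_shift)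
  also have "\<dots> = ?c (\<lambda>zs ys. \<Sum>(a, b)\<in>colours \<times> colours. R (u - v) \<Lambda>' a b c d * ?H u v a b zs ys)"
    by (simp add: columns_linear[where c = "\<lambda>(a, b). R (u - v) \<Lambda>' a b c d"
          and G = "\<lambda>(a, b). ?H u v a b", unfolded split_def] split_def sum.cartesian_product)
  \<comment> \<open>The sum over a singleton writes a scalar multiple as a linear combination, so
    that \<open>columns_linear\<close> applies to it as well.\<close>
  also have "\<dots> = ?c (\<lambda>zs ys. \<Sum>i\<in>{()}. \<theta> (u - v - \<gamma>) * ?H v u d c zs ys)"
    using column_column_exchange[OF assms(1) generic_shift[OF assms(2), of "ts1 @ xs1", folded \<Lambda>'_def]
        assms(3) cd]
    by (intro columns_cong assms(4)) (simp add: sum.cartesian_product[symmetric])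
  also have "\<dots> = \<theta> (u - v - \<gamma>) * columns n \<Lambda> F (ws1 @ (us1 @ v # u # us2) @ ws2)
      (ts1 @ (xs1 @ d # c # xs2) @ ts2) zs ys"
    unfolding col columns_linear by simp
  finally show "(\<Sum>a\<in>colours. \<Sum>b\<in>colours. R (u - v) (shift (shift \<Lambda> ts1) xs1) a b c d *
      columns n \<Lambda> F (ws1 @ (us1 @ u # v # us2) @ ws2) (ts1 @ (xs1 @ a # b # xs2) @ ts2) zs ys) =
    \<theta> (u - v - \<gamma>) * columns n \<Lambda> F (ws1 @ (us1 @ v # u # us2) @ ws2)
      (ts1 @ (xs1 @ d # c # xs2) @ ts2) zs ys" .
qed


subsection \<open>Moving a colour through a column\<close>

fun pass :: "nat \<Rightarrow> (nat \<Rightarrow> complex) \<Rightarrow> complex \<Rightarrow> complex list \<Rightarrow> nat list \<Rightarrow> complex" where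
  "pass n \<Lambda> w (z # zs) (x # xs) = \<alpha> (z - w) (\<Lambda> x - \<Lambda> n) * pass n (shift \<Lambda> [x]) w zs xs"
| "pass n \<Lambda> w _ _ = 1"

text \<open>The colour n entering at the bottom can never turn right, as no right edge carries n. It
  must run straight up, and every row goes straight through.\<close>

lemma colw_pass:
  assumes "n \<in> colours" "n \<notin> set ys" "length xs = length zs" "length ys = length zs"
  shows "colw \<Lambda> zs w xs n ys t = (if xs = ys \<and> t = n then pass n \<Lambda> w zs ys else 0)"
  using assms(2-)
proof (induction zs arbitrary: xs ys \<Lambda> t)
  case (Cons z zs)
  obtain x xs' y ys' where eqs: "xs = x # xs'" "ys = y # ys'" "length xs' = length zs" "length ys' = length zs"
    using Cons.prems by (auto simp: length_Suc_conv)
  have "n \<notin> set ys'" "y \<noteq> n" using Cons.prems eqs by auto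
  then have "R (z - w) \<Lambda> x m y t * colw (shift \<Lambda> [x]) zs w xs' n ys' m =
      (if m = n then if xs = ys \<and> t = n then pass n \<Lambda> w (z # zs) ys else 0 else 0)" for m
    using Cons.IH[OF _ eqs(3,4)] by (auto simp: eqs vertex_weight_def)
  then show ?case using assms(1) by (simp add: eqs)
qed auto

lemma colw_no_exit:
  assumes "n \<in> colours" "length xs = length zs"
  shows "colw \<Lambda> zs w xs n (replicate (length zs) n) n =
    (if xs = replicate (length zs) n then \<Prod>z\<leftarrow>zs. \<theta> (z - w - \<gamma>) else 0)"
  using assms(2)
proof (induction zs arbitrary: xs \<Lambda>)
  case (Cons z zs)
  obtain x xs' where eqs: "xs = x # xs'" "length xs' = length zs"
    using Cons.prems by (auto simp: length_Suc_conv)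
  have "R (z - w) \<Lambda> x m n n * colw (shift \<Lambda> [x]) zs w xs' n (replicate (length zs) n) m =
      (if m = n then if xs = replicate (length (z # zs)) n then \<Prod>z\<leftarrow>z # zs. \<theta> (z - w - \<gamma>) else 0 else 0)"
    for m
    using Cons.IH[OF eqs(2)] by (auto simp: eqs vertex_weight_def)
  then show ?case using assms(1) by (simp add: eqs)
qed auto

text \<open>The colour c leaving at the top either enters in the first row and turns upwards
  (\<beta>), so that all rows below carry n, or comes from below and crosses the first row
  (\<alpha>).\<close>

lemma sum_colw_exit_Cons:
  assumes "n \<in> colours" "c \<in> colours" "c \<noteq> n"
  shows "(\<Sum>xs\<in>words (length (z # zs)). f xs * colw \<Lambda> (z # zs) w xs n (replicate (length (z # zs)) n) c) =
    \<beta> (z - w) (\<Lambda> n - \<Lambda> c) * (\<Prod>y\<leftarrow>zs. \<theta> (y - w - \<gamma>)) * f (c # replicate (length zs) n) +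
    \<alpha> (z - w) (\<Lambda> n - \<Lambda> c) * (\<Sum>xs\<in>words (length zs).
      f (n # xs) * colw (shift \<Lambda> [n]) zs w xs n (replicate (length zs) n) c)"
proof -
  let ?r = "replicate (length zs) n"
  have R: "R (z - w) \<Lambda> x m n c * g m =
      (if m = n then if x = c then \<beta> (z - w) (\<Lambda> n - \<Lambda> c) * g n else 0 else 0) +
      (if m = c then if x = n then \<alpha> (z - w) (\<Lambda> n - \<Lambda> c) * g c else 0 else 0)" for x m g
    using assms(3) by (auto simp: vertex_weight_def)
  have "(\<Sum>xs\<in>words (length (z # zs)). f xs * colw \<Lambda> (z # zs) w xs n (replicate (length (z # zs)) n) c) =
    (\<Sum>x\<in>colours. \<Sum>xs\<in>words (length zs). f (x # xs) *
      ((if x = c then \<beta> (z - w) (\<Lambda> n - \<Lambda> c) * colw (shift \<Lambda> [c]) zs w xs n ?r n else 0) +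
       (if x = n then \<alpha> (z - w) (\<Lambda> n - \<Lambda> c) * colw (shift \<Lambda> [n]) zs w xs n ?r c else 0)))"
  proof -
    have "colw \<Lambda> (z # zs) w (x # xs) n (n # ?r) c =
      (if x = c then \<beta> (z - w) (\<Lambda> n - \<Lambda> c) * colw (shift \<Lambda> [c]) zs w xs n ?r n else 0) +
       (if x = n then \<alpha> (z - w) (\<Lambda> n - \<Lambda> c) * colw (shift \<Lambda> [n]) zs w xs n ?r c else 0)" for x xs
      using assms(1,2) by (auto simp: R[of x _ "colw (shift \<Lambda> [x]) zs w xs n ?r"] sum.distrib)
    then show ?thesis by (simp add: sum_words_Suc)
  qed
  also have "\<dots> = (\<Sum>xs\<in>words (length zs). \<Sum>x\<in>colours.
      (if x = c then f (c # xs) * (\<beta> (z - w) (\<Lambda> n - \<Lambda> c) * colw (shift \<Lambda> [c]) zs w xs n ?r n) else 0) +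
      (if x = n then f (n # xs) * (\<alpha> (z - w) (\<Lambda> n - \<Lambda> c) * colw (shift \<Lambda> [n]) zs w xs n ?r c) else 0))"
    by (subst sum.swap) (auto intro!: sum.cong simp: algebra_simps)
  also have "\<dots> = (\<Sum>xs\<in>words (length zs).
      f (c # xs) * (\<beta> (z - w) (\<Lambda> n - \<Lambda> c) * colw (shift \<Lambda> [c]) zs w xs n ?r n)) +
    (\<Sum>xs\<in>words (length zs).
      f (n # xs) * (\<alpha> (z - w) (\<Lambda> n - \<Lambda> c) * colw (shift \<Lambda> [n]) zs w xs n ?r c))"
    using assms by (simp add: sum.distrib)
  also have "(\<Sum>xs\<in>words (length zs).
      f (c # xs) * (\<beta> (z - w) (\<Lambda> n - \<Lambda> c) * colw (shift \<Lambda> [c]) zs w xs n ?r n)) =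
    (\<Sum>xs\<in>words (length zs). if xs = ?r then
      \<beta> (z - w) (\<Lambda> n - \<Lambda> c) * (\<Prod>y\<leftarrow>zs. \<theta> (y - w - \<gamma>)) * f (c # ?r) else 0)"
    using assms by (intro sum.cong refl) (auto simp: colw_no_exit words_def)
  also have "\<dots> = \<beta> (z - w) (\<Lambda> n - \<Lambda> c) * (\<Prod>y\<leftarrow>zs. \<theta> (y - w - \<gamma>)) * f (c # ?r)"
  proof -
    have "?r \<in> words (length zs)" using assms by (auto simp: words_def)
    then show ?thesis by simp
  qed
  finally show ?thesis by (simp add: sum_distrib_left mult_ac)
qed

section \<open>A colour leaving through the top of a column\<close>

definition separated :: "complex set \<Rightarrow> bool" where
  "separated A \<longleftrightarrow> (\<forall>u\<in>A. \<forall>v\<in>A. u \<noteq> v \<longrightarrow> \<theta> (u - v) \<noteq> 0)"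

lemma separatedD: "separated A \<Longrightarrow> u \<in> A \<Longrightarrow> v \<in> A \<Longrightarrow> u \<noteq> v \<Longrightarrow> \<theta> (u - v) \<noteq> 0"
  by (simp add: separated_def)

lemma separated_subset: "separated A \<Longrightarrow> B \<subseteq> A \<Longrightarrow> separated B"
  by (auto simp: separated_def)

lemma exchangeableD:
  assumes "exchangeable \<Lambda> F" "xs1 \<in> words (length zs1)" "xs2 \<in> words (length zs2)"
    and "c \<in> colours" "d \<in> colours"
  shows "(\<Sum>a\<in>colours. \<Sum>b\<in>colours. R (u - v) (shift \<Lambda> xs1) a b c d *
      F (zs1 @ u # v # zs2) (xs1 @ a # b # xs2)) =
    \<theta> (u - v - \<gamma>) * F (zs1 @ v # u # zs2) (xs1 @ d # c # xs2)"
  using assms unfolding exchangeable_def by blast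

lemma exchangeable_Cons:
  assumes "exchangeable \<Lambda> F" "n \<in> colours"
  shows "exchangeable (shift \<Lambda> [n]) (\<lambda>zs xs. F (z # zs) (n # xs))"
  unfolding exchangeable_def
proof (intro allI ballI)
  fix zs1 zs2 :: "complex list" and u v xs1 xs2 c d
  assume "xs1 \<in> words (length zs1)" "xs2 \<in> words (length zs2)" "c \<in> colours" "d \<in> colours"
  then have "(\<Sum>a\<in>colours. \<Sum>b\<in>colours. R (u - v) (shift \<Lambda> (n # xs1)) a b c d *
         F ((z # zs1) @ u # v # zs2) ((n # xs1) @ a # b # xs2)) =
       \<theta> (u - v - \<gamma>) * F ((z # zs1) @ v # u # zs2) ((n # xs1) @ d # c # xs2)"
    using assms by (intro exchangeableD) simp_all
  then show "(\<Sum>a\<in>colours. \<Sum>b\<in>colours. R (u - v) (shift (shift \<Lambda> [n]) xs1) a b c d *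
         F (z # zs1 @ u # v # zs2) (n # xs1 @ a # b # xs2)) =
       \<theta> (u - v - \<gamma>) * F (z # zs1 @ v # u # zs2) (n # xs1 @ d # c # xs2)" by simp
qed

lemma exchangeable_append:
  assumes "exchangeable \<Lambda> F" "as \<in> words (length zs)"
  shows "exchangeable \<Lambda> (\<lambda>us xs. F (us @ zs) (xs @ as))"
  unfolding exchangeable_def
proof (intro allI ballI)
  fix zs1 zs2 :: "complex list" and u v xs1 xs2 c d
  assume *: "xs1 \<in> words (length zs1)" "xs2 \<in> words (length zs2)" "c \<in> colours" "d \<in> colours"
  then have "(xs2 @ as) \<in> words (length (zs2 @ zs))" using assms(2) by (auto simp: words_def)
  then have "(\<Sum>a\<in>colours. \<Sum>b\<in>colours. R (u - v) (shift \<Lambda> xs1) a b c d *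
         F (zs1 @ u # v # zs2 @ zs) (xs1 @ a # b # xs2 @ as)) =
       \<theta> (u - v - \<gamma>) * F (zs1 @ v # u # zs2 @ zs) (xs1 @ d # c # xs2 @ as)"
    using exchangeableD[OF assms(1) *(1) _ *(3,4), of _ "zs2 @ zs"] by blast
  then show "(\<Sum>a\<in>colours. \<Sum>b\<in>colours. R (u - v) (shift \<Lambda> xs1) a b c d *
         F ((zs1 @ u # v # zs2) @ zs) ((xs1 @ a # b # xs2) @ as)) =
       \<theta> (u - v - \<gamma>) * F ((zs1 @ v # u # zs2) @ zs) ((xs1 @ d # c # xs2) @ as)" by simp
qed

context
  assumes Im_tau: "Im \<tau> > 0"
begin

text \<open>The coefficient comparison in \<open>transport\<close>, with z - y and v - y for x and
  y. The left side comes from the induction hypothesis, where the dynamical difference is P +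
  \<gamma>.\<close>

lemma transport_identity:
  assumes "\<theta> P \<noteq> 0" "\<theta> (x - y) \<noteq> 0" "\<theta> x \<noteq> 0" "\<theta> y \<noteq> 0"
  shows "\<theta> (x - y - \<gamma>) * (\<theta> (x + P + \<gamma>) / \<theta> x) - \<beta> (x - y) P * (\<theta> (y + P + \<gamma>) / \<theta> y) =
    \<alpha> (x - y) P * (\<theta> (x + P) / \<theta> x * (\<theta> (y + \<gamma>) / \<theta> y))"
  using three_term[OF Im_tau, of "x + P + \<gamma>" "x - y - \<gamma>" \<gamma> P] assms
  unfolding \<alpha>_def \<beta>_def
  by (simp add: divide_simps algebra_simps)

text \<open>Used in \<open>sum_colw_exit\<close> with z - w and y - w for x and y. It adds the
  contributions of leaving in the first row and of leaving further down, and turns their sum into a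
  product.\<close>

lemma exit_identity:
  assumes "\<theta> P \<noteq> 0" "\<theta> (x - y) \<noteq> 0"
  shows "\<alpha> x (- P) * \<theta> (y - P - \<gamma>) + \<beta> x (- P) * \<theta> (y - \<gamma>) * (\<theta> (x - y + P) / \<theta> (x - y)) =
    \<theta> (y - P) * \<theta> (x - \<gamma>) * (\<theta> (x - y + \<gamma>) / \<theta> (x - y))"
  using three_term[OF Im_tau, of x "y - P - \<gamma>" \<gamma> "P - \<gamma>"] assms
  unfolding \<alpha>_def \<beta>_def
  by (simp add: divide_simps \<theta>_neg[OF Im_tau] \<theta>_flip[OF Im_tau] algebra_simps)

lemma \<theta>_quotient_flip: "\<theta> (v - u - \<gamma>) / \<theta> (v - u) = \<theta> (u - v + \<gamma>) / \<theta> (u - v)"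
  using \<theta>_neg[OF Im_tau, of "u - v"] \<theta>_neg[OF Im_tau, of "u - v + \<gamma>"] by simp

end

context
  assumes Im_tau: "Im \<tau> > 0"
begin

abbreviation \<rho> :: "complex \<Rightarrow> complex \<Rightarrow> complex" where
  "\<rho> y u \<equiv> \<theta> (y - u - \<gamma>) / \<theta> (y - u)"

lemma diff_sums:
  fixes a :: complex
  shows "a * (p + sum f S) - b * (q + sum g S) = a * p - b * q + (\<Sum>y\<in>S. a * f y - b * g y)"
  by (simp add: sum_subtractf sum_distrib_left algebra_simps)

lemma sum_R_out:
  assumes "c \<in> colours" "d \<in> colours" "c \<noteq> d"
  shows "(\<Sum>a\<in>colours. \<Sum>b\<in>colours. R x \<Lambda> a b c d * f a b) =
    \<alpha> x (\<Lambda> c - \<Lambda> d) * f c d + \<beta> x (\<Lambda> c - \<Lambda> d) * f d c"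
proof -
  have "R x \<Lambda> a b c d * f a b =
      (if b = d then if a = c then \<alpha> x (\<Lambda> c - \<Lambda> d) * f c d else 0 else 0) +
      (if b = c then if a = d then \<beta> x (\<Lambda> c - \<Lambda> d) * f d c else 0 else 0)" for a b
    using assms(3) by (auto simp: vertex_weight_def)
  then show ?thesis using assms by (simp add: sum.distrib)
qed

text \<open>The colour c moves from the first row to the last. The exchange relation for the two top
  rows is solved for the state with c on top, dividing by \<alpha> (z - v) P, nonzero by genericity;
  both other states have c in the second row and fall under the induction hypothesis.
  \<open>H y\<close> is the value when c has reached the last row, with variable y there; it must
  not depend on the order of the other variables.\<close>

lemma transport:
  assumes "n \<in> colours" "c \<in> colours" "c \<noteq> n"
    and "generic_dynamical \<Lambda>" "exchangeable \<Lambda> F" "distinct (z # zs)" "separated (set (z # zs))"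
    and "\<And>ys y. mset (ys @ [y]) = mset (z # zs) \<Longrightarrow> F (ys @ [y]) (replicate (length zs) n @ [c]) = H y"
  shows "F (z # zs) (c # replicate (length zs) n) =
    \<theta> (\<Lambda> c - \<Lambda> n) / \<theta> (\<Lambda> c - \<Lambda> n + of_nat (length zs) * \<gamma>) * (\<Prod>u\<in>set zs. \<rho> z u) * H z +
    (\<Sum>y\<in>set zs. \<theta> \<gamma> / \<theta> (\<Lambda> c - \<Lambda> n + of_nat (length zs) * \<gamma>) *
      (\<theta> (z - y + (\<Lambda> c - \<Lambda> n)) / \<theta> (z - y)) * (\<Prod>u\<in>set zs - {y}. \<rho> y u) * H y)"
  using assms(4-)
proof (induction zs arbitrary: z \<Lambda> F)
  case Nil
  have "\<theta> (\<Lambda> c - \<Lambda> n) \<noteq> 0" using genericD[OF Nil(1) assms(2,1,3), of 0] by simp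
  then show ?case using Nil(5)[of "[]" z] by simp
next
  case (Cons v zs)
  define P where "P = \<Lambda> c - \<Lambda> n"
  define D where "D = \<theta> (P + of_nat (length (v # zs)) * \<gamma>)"
  let ?r = "replicate (length zs) n"
  note gen = genericD[OF Cons.prems(1) assms(2,1,3)]
  have nz: "\<theta> P \<noteq> 0" "\<theta> (P + \<gamma>) \<noteq> 0" using gen[of 0] gen[of 1] by (simp_all add: P_def)
  have P': "shift \<Lambda> [n] c - shift \<Lambda> [n] n = P + \<gamma>"
    using assms(3) by (simp add: shift_def P_def)
  have dist: "v \<noteq> z" "v \<notin> set zs" "z \<notin> set zs" "distinct zs" using Cons.prems(3) by auto
  have zv: "\<theta> (z - v) \<noteq> 0" using dist by (intro separatedD[OF Cons.prems(4)]) auto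
  have zy: "\<theta> (z - y) \<noteq> 0" and vy: "\<theta> (v - y) \<noteq> 0" if "y \<in> set zs" for y
    using separatedD[OF Cons.prems(4), of z y] separatedD[OF Cons.prems(4), of v y] dist that by auto
  have D: "\<theta> (P + \<gamma> + of_nat (length zs) * \<gamma>) = D" by (simp add: D_def algebra_simps)
  have IH: "F (a # b # zs) (n # c # ?r) = \<theta> (P + \<gamma>) / D * (\<Prod>u\<in>set zs. \<rho> b u) * H b +
    (\<Sum>y\<in>set zs. \<theta> \<gamma> / D * (\<theta> (b - y + (P + \<gamma>)) / \<theta> (b - y)) * (\<Prod>u\<in>set zs - {y}. \<rho> y u) * H y)"
    if ab: "mset [a, b] = mset [z, v]" for a b
  proof -
    have ab': "mset (a # b # zs) = mset (z # v # zs)"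
      using ab by (metis append_Cons append_Nil mset_append)
    have "distinct (b # zs)" "separated (set (b # zs))"
      using mset_eq_imp_distinct_iff[OF ab'] mset_eq_setD[OF ab'] Cons.prems(3,4)
      by (auto elim!: separated_subset)
    moreover have "F (a # ys @ [y]) (n # ?r @ [c]) = H y" if "mset (ys @ [y]) = mset (b # zs)" for ys y
      using Cons.prems(5)[of "a # ys" y] that ab' by simp
    ultimately show ?thesis
      using Cons.IH[OF generic_shift[OF Cons.prems(1)] exchangeable_Cons[OF Cons.prems(2) assms(1)], of b a]
      by (simp only: P' D)
  qed
  let ?A = "\<lambda>b. \<theta> (P + \<gamma>) / D * (\<Prod>u\<in>set zs. \<rho> b u) * H b"
  let ?E = "\<lambda>b y. \<theta> \<gamma> / D * (\<theta> (b - y + (P + \<gamma>)) / \<theta> (b - y)) * (\<Prod>u\<in>set zs - {y}. \<rho> y u) * H y"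
  let ?G = "\<lambda>y. \<theta> \<gamma> / D * (\<theta> (z - y + P) / \<theta> (z - y)) * (\<Prod>u\<in>set (v # zs) - {y}. \<rho> y u) * H y"
  let ?V = "\<theta> \<gamma> / D * (\<theta> (z - v + P) / \<theta> (z - v)) * (\<Prod>u\<in>set zs. \<rho> v u) * H v"
  let ?Z = "\<theta> P / D * (\<Prod>u\<in>set (v # zs). \<rho> z u) * H z"
  let ?t = "\<theta> (z - v - \<gamma>)" and ?b = "\<beta> (z - v) P" and ?a = "\<alpha> (z - v) P"
  have swapped: "mset [v, z] = mset [z, v]" by (simp add: add_mset_commute)
  have "?t * F (v # z # zs) (n # c # ?r) =
      ?a * F (z # v # zs) (c # n # ?r) + ?b * F (z # v # zs) (n # c # ?r)"
    using exchangeableD[OF Cons.prems(2), of "[]" "[]" ?r zs c n z v] assms(1-3)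
    by (simp add: sum_R_out P_def words_def set_replicate_conv_if)
  then have "?a * F (z # v # zs) (c # n # ?r) =
     ?t * F (v # z # zs) (n # c # ?r) - ?b * F (z # v # zs) (n # c # ?r)"
    by simp
  also have "\<dots> = ?t * (?A z)
     - ?b * (?A v) +
     (\<Sum>y\<in>set zs.
        ?t * (?E z y) - ?b * (?E v y))"
    unfolding IH[OF swapped] IH[OF refl]
    by (rule diff_sums)
  also have "?t * (?A z) =
      ?a * (?Z)"
    using nz zv dist by (simp add: \<alpha>_def)
  \<comment> \<open>The term of the induction hypothesis in which v keeps the colour c supplies the
    summand y = v.\<close>
  also have "?b * (?A v) =
      - (?a * (?V))"
    using nz zv by (simp add: \<alpha>_def \<beta>_def)
  also have "(\<Sum>y\<in>set zs.
        ?t * (?E z y) - ?b * (?E v y)) =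
      (\<Sum>y\<in>set zs. ?a *
        (?G y))"
  proof (rule sum.cong[OF refl])
    fix y assume y: "y \<in> set zs"
    have "set (v # zs) - {y} = insert v (set zs - {y})" using y dist by auto
    then have prod: "(\<Prod>u\<in>set (v # zs) - {y}. \<rho> y u) = \<theta> (v - y + \<gamma>) / \<theta> (v - y) * (\<Prod>u\<in>set zs - {y}. \<rho> y u)"
      using dist \<theta>_quotient_flip[OF Im_tau, of y v] by simp
    define p where "p = \<theta> \<gamma> / D * ((\<Prod>u\<in>set zs - {y}. \<rho> y u) * H y)"
    have id: "?t * (\<theta> (z - y + (P + \<gamma>)) / \<theta> (z - y)) -
        ?b * (\<theta> (v - y + (P + \<gamma>)) / \<theta> (v - y)) =
      ?a * (\<theta> (z - y + P) / \<theta> (z - y) * (\<theta> (v - y + \<gamma>) / \<theta> (v - y)))"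
      using transport_identity[OF Im_tau, of P "z - y" "v - y"] nz zv zy[OF y] vy[OF y] by (simp add: add.assoc)
    have "?t * (?E z y) - ?b * (?E v y) =
      p * (?t * (\<theta> (z - y + (P + \<gamma>)) / \<theta> (z - y)) -
        ?b * (\<theta> (v - y + (P + \<gamma>)) / \<theta> (v - y)))"
      unfolding p_def by (simp only: right_diff_distrib mult_ac)
    also have "\<dots> = ?a *
        (?G y)"
      unfolding id prod p_def by (simp only: mult_ac)
    finally show "?t * (?E z y) - ?b * (?E v y) =
      ?a *
        (?G y)" .
  qed
  also have "?a * (?Z) -
      - (?a * (?V)) +
      (\<Sum>y\<in>set zs. ?a *
        (?G y)) =
      ?a * (?Z +
      (?V +
      (\<Sum>y\<in>set zs. ?G y)))"
    by (simp only: distrib_left sum_distrib_left diff_minus_eq_add add.assoc)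
  also have "?V +
     (\<Sum>y\<in>set zs. ?G y) =
     (\<Sum>y\<in>set (v # zs). ?G y)"
  proof -
    have "set (v # zs) - {v} = set zs" using dist by auto
    then show ?thesis using dist by (simp only: list.set sum.insert finite_set not_False_eq_True)
  qed
  finally have "?a * F (z # v # zs) (c # n # ?r) = ?a *
    (?Z + (\<Sum>y\<in>set (v # zs).
      ?G y))" .
  moreover have "?a \<noteq> 0" using nz zv by (simp add: \<alpha>_def)
  ultimately have "F (z # v # zs) (c # n # ?r) =
    ?Z + (\<Sum>y\<in>set (v # zs).
      ?G y)"
    using mult_left_cancel by blast
  then show ?case
    unfolding P_def[symmetric] D_def[symmetric] by (simp only: length_Cons replicate_Suc)
qed

end

lemma pass_eq:
  assumes "n \<notin> set as" "length zs = length as"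
  shows "pass n \<Lambda> w zs as = (\<Prod>i<length as.
    \<alpha> (zs ! i - w) (\<Lambda> (as ! i) - \<Lambda> n - \<gamma> * of_nat (count_list (take i as) (as ! i))))"
  using assms(2,1)
proof (induction zs as arbitrary: \<Lambda> rule: list_induct2)
  case (Cons z zs a as)
  have notin: "n \<noteq> a" "n \<notin> set as" using Cons.prems by auto
  have "shift \<Lambda> [a] (as ! i) - shift \<Lambda> [a] n - \<gamma> * of_nat (count_list (take i as) (as ! i)) =
      \<Lambda> (as ! i) - \<Lambda> n - \<gamma> * of_nat (count_list (a # take i as) (as ! i))" for i
    using notin by (simp add: shift_def algebra_simps)
  then show ?case
    unfolding length_Cons prod.lessThan_Suc_shift pass.simps Cons.IH[OF notin(2)] by simp
qed simp

text \<open>No right edge of the lower block carries n, so \<open>colw_pass\<close> freezes that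
  block and the colour n arrives at the cut. The upper block thus sees a column that again ends in
  n.\<close>

lemma column_replicate_append:
  assumes "n \<in> colours" "t \<in> colours" "as \<in> words (length zs2)" "n \<notin> set as"
  shows "column n \<Lambda> w t F (zs1 @ zs2) (replicate (length zs1) n @ as) =
    (\<Sum>xs\<in>words (length zs1). F (zs1 @ zs2) (xs @ as) * colw \<Lambda> zs1 w xs n (replicate (length zs1) n) t *
      pass n (shift \<Lambda> xs) w zs2 as)"
proof -
  let ?r = "replicate (length zs1) n"
  have "column n \<Lambda> w t F (zs1 @ zs2) (?r @ as) = (\<Sum>xs\<in>words (length zs1). \<Sum>bs\<in>words (length zs2).
      F (zs1 @ zs2) (xs @ bs) * colw \<Lambda> (zs1 @ zs2) w (xs @ bs) n (?r @ as) t)"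
    by (simp add: column_def sum_words_add)
  also have "\<dots> = (\<Sum>xs\<in>words (length zs1). \<Sum>bs\<in>words (length zs2).
      if bs = as then F (zs1 @ zs2) (xs @ as) * colw \<Lambda> zs1 w xs n ?r t * pass n (shift \<Lambda> xs) w zs2 as else 0)"
  proof ((rule sum.cong[OF refl])+)
    fix xs bs assume xs: "xs \<in> words (length zs1)" and bs: "bs \<in> words (length zs2)"
    have "colw \<Lambda> (zs1 @ zs2) w (xs @ bs) n (?r @ as) t =
        (\<Sum>m\<in>colours. colw \<Lambda> zs1 w xs m ?r t * colw (shift \<Lambda> xs) zs2 w bs n as m)"
      using xs assms(2) by (intro colw_append) (auto simp: words_def)
    also have "\<dots> = (\<Sum>m\<in>colours. if m = n then
        if bs = as then colw \<Lambda> zs1 w xs n ?r t * pass n (shift \<Lambda> xs) w zs2 as else 0 else 0)"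
      using colw_pass[OF assms(1,4)] assms(3) bs by (intro sum.cong refl) (auto simp: words_def)
    finally show "F (zs1 @ zs2) (xs @ bs) * colw \<Lambda> (zs1 @ zs2) w (xs @ bs) n (?r @ as) t =
      (if bs = as then F (zs1 @ zs2) (xs @ as) * colw \<Lambda> zs1 w xs n ?r t * pass n (shift \<Lambda> xs) w zs2 as else 0)"
      using assms(1) by simp
  qed
  also have "\<dots> = (\<Sum>xs\<in>words (length zs1). F (zs1 @ zs2) (xs @ as) * colw \<Lambda> zs1 w xs n ?r t *
      pass n (shift \<Lambda> xs) w zs2 as)"
    using assms(3) by simp
  finally show ?thesis .
qed

lemma column_no_exit:
  assumes "n \<in> colours" "as \<in> words (length zs2)" "n \<notin> set as"
  shows "column n \<Lambda> w n F (zs1 @ zs2) (replicate (length zs1) n @ as) =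
    F (zs1 @ zs2) (replicate (length zs1) n @ as) * (\<Prod>z\<leftarrow>zs1. \<theta> (z - w - \<gamma>)) *
      pass n (shift \<Lambda> (replicate (length zs1) n)) w zs2 as"
proof -
  let ?r = "replicate (length zs1) n"
  have "?r \<in> words (length zs1)" using assms(1) by (auto simp: words_def)
  moreover have "F (zs1 @ zs2) (xs @ as) * colw \<Lambda> zs1 w xs n ?r n * pass n (shift \<Lambda> xs) w zs2 as =
    (if xs = ?r then F (zs1 @ zs2) (?r @ as) * (\<Prod>z\<leftarrow>zs1. \<theta> (z - w - \<gamma>)) *
      pass n (shift \<Lambda> ?r) w zs2 as else 0)" if "xs \<in> words (length zs1)" for xs
    using colw_no_exit[OF assms(1), of xs zs1] that by (auto simp: words_def)
  ultimately show ?thesis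
    unfolding column_replicate_append[OF assms(1,1,2,3)] by simp
qed

context
  assumes Im_tau: "Im \<tau> > 0"
begin

text \<open>Induction on the rows: if c leaves in the first row, \<open>transport\<close> expresses
  the state by the values \<open>H y\<close>; otherwise the induction hypothesis does.
  \<open>exit_identity\<close> merges the two coefficients of each \<open>H y\<close>, so the order
  of the rows disappears from the result.\<close>

lemma sum_colw_exit:
  assumes "n \<in> colours" "c \<in> colours" "c \<noteq> n"
    and "generic_dynamical \<Lambda>" "exchangeable \<Lambda> F" "distinct zs" "separated (set zs)" "zs \<noteq> []"
    and "\<And>ys y. mset (ys @ [y]) = mset zs \<Longrightarrow> F (ys @ [y]) (replicate (length zs - 1) n @ [c]) = H y"
  shows "(\<Sum>xs\<in>words (length zs). F zs xs * colw \<Lambda> zs w xs n (replicate (length zs) n) c) =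
    (\<Sum>y\<in>set zs. \<theta> \<gamma> / \<theta> (\<Lambda> c - \<Lambda> n + of_nat (length zs - 1) * \<gamma>) * \<theta> (y - w - (\<Lambda> c - \<Lambda> n)) *
      (\<Prod>u\<in>set zs - {y}. \<theta> (u - w - \<gamma>) * (\<theta> (y - u - \<gamma>) / \<theta> (y - u))) * H y)"
  using assms(4-)
proof (induction zs arbitrary: \<Lambda> F)
  case Nil
  then show ?case by simp
next
  case (Cons z zs)
  define P where "P = \<Lambda> c - \<Lambda> n"
  define D where "D = \<theta> (P + of_nat (length zs) * \<gamma>)"
  let ?r = "replicate (length zs) n"
  let ?\<rho> = "\<lambda>y u. \<theta> (y - u - \<gamma>) / \<theta> (y - u)"
  let ?q = "\<lambda>y u. \<theta> (u - w - \<gamma>) * ?\<rho> y u"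
  have nz: "\<theta> P \<noteq> 0" using genericD[OF Cons.prems(1) assms(2,1,3), of 0] by (simp add: P_def)
  have dist: "z \<notin> set zs" "distinct zs" using Cons.prems(2,3) by auto
  have P: "\<Lambda> n - \<Lambda> c = - P" by (simp add: P_def)
  have exits: "(\<Sum>xs\<in>words (length zs). F (z # zs) (n # xs) * colw (shift \<Lambda> [n]) zs w xs n ?r c) =
    (\<Sum>y\<in>set zs. \<theta> \<gamma> / D * \<theta> (y - w - P - \<gamma>) * (\<Prod>u\<in>set zs - {y}. ?q y u) * H y)"
  proof (cases "zs = []")
    case True
    then show ?thesis using assms(3) by auto
  next
    case False
    have 1: "shift \<Lambda> [n] c - shift \<Lambda> [n] n + of_nat (length zs - 1) * \<gamma> = P + of_nat (length zs) * \<gamma>"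
      using assms(3) False by (cases zs) (simp_all add: shift_def P_def algebra_simps)
    have 2: "y - w - (shift \<Lambda> [n] c - shift \<Lambda> [n] n) = y - w - P - \<gamma>" for y
      using assms(3) by (simp add: shift_def P_def algebra_simps)
    have "F (z # ys @ [y]) (n # replicate (length zs - 1) n @ [c]) = H y"
      if "mset (ys @ [y]) = mset zs" for ys y
      using Cons.prems(6)[of "z # ys" y] that False by (cases zs) simp_all
    then show ?thesis
      using Cons.IH[OF generic_shift[OF Cons.prems(1)] exchangeable_Cons[OF Cons.prems(2) assms(1)] dist(2) _ False]
        separated_subset[OF Cons.prems(4)]
      unfolding 1 2 D_def[symmetric] by auto
  qed
  have \<beta>: "\<beta> (z - w) (- P) = \<theta> (z - w - P) * \<theta> \<gamma> / \<theta> P"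
    by (simp add: \<beta>_def \<theta>_neg[OF Im_tau])
  have prods: "(\<Prod>y\<leftarrow>zs. \<theta> (y - w - \<gamma>)) = (\<Prod>u\<in>set zs. \<theta> (u - w - \<gamma>))"
    using dist by (simp add: prod.distinct_set_conv_list)
  let ?S = "\<lambda>y. \<beta> (z - w) (- P) * (\<Prod>u\<in>set zs. \<theta> (u - w - \<gamma>)) *
      (\<theta> \<gamma> / D * (\<theta> (z - y + P) / \<theta> (z - y)) * (\<Prod>u\<in>set zs - {y}. ?\<rho> y u) * H y) +
    \<alpha> (z - w) (- P) * (\<theta> \<gamma> / D * \<theta> (y - w - P - \<gamma>) * (\<Prod>u\<in>set zs - {y}. ?q y u) * H y)"
  let ?G = "\<lambda>y. \<theta> \<gamma> / D * \<theta> (y - w - P) * (\<Prod>u\<in>set (z # zs) - {y}. ?q y u) * H y"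
  let ?Z = "\<beta> (z - w) (- P) * (\<Prod>u\<in>set zs. \<theta> (u - w - \<gamma>)) * (\<theta> P / D * (\<Prod>u\<in>set zs. ?\<rho> z u) * H z)"
  let ?Z' = "\<theta> \<gamma> / D * \<theta> (z - w - P) * (\<Prod>u\<in>set zs. ?q z u) * H z"
  have "F (z # zs) (c # ?r) = \<theta> P / D * (\<Prod>u\<in>set zs. ?\<rho> z u) * H z +
    (\<Sum>y\<in>set zs. \<theta> \<gamma> / D * (\<theta> (z - y + P) / \<theta> (z - y)) * (\<Prod>u\<in>set zs - {y}. ?\<rho> y u) * H y)"
    unfolding P_def D_def using Cons.prems(6)
    by (intro transport[OF Im_tau assms(1-3) Cons.prems(1-4)]) simp
  then have "(\<Sum>xs\<in>words (length (z # zs)). F (z # zs) xs *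
      colw \<Lambda> (z # zs) w xs n (replicate (length (z # zs)) n) c) =
    \<beta> (z - w) (- P) * (\<Prod>u\<in>set zs. \<theta> (u - w - \<gamma>)) * (\<theta> P / D * (\<Prod>u\<in>set zs. ?\<rho> z u) * H z +
    (\<Sum>y\<in>set zs. \<theta> \<gamma> / D * (\<theta> (z - y + P) / \<theta> (z - y)) * (\<Prod>u\<in>set zs - {y}. ?\<rho> y u) * H y)) +
    \<alpha> (z - w) (- P) * (\<Sum>y\<in>set zs. \<theta> \<gamma> / D * \<theta> (y - w - P - \<gamma>) * (\<Prod>u\<in>set zs - {y}. ?q y u) * H y)"
    unfolding sum_colw_exit_Cons[OF assms(1-3)] exits P prods by simp
  also have "\<dots> = ?Z +
    (\<Sum>y\<in>set zs. ?S y)"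
    by (simp only: distrib_left sum_distrib_left sum.distrib add.assoc)
  also have "?Z =
    ?Z'"
    unfolding \<beta> prod.distrib using nz by simp
  also have "(\<Sum>y\<in>set zs. ?S y) =
    (\<Sum>y\<in>set zs. ?G y)"
  proof (rule sum.cong[OF refl])
    fix y assume y: "y \<in> set zs"
    define A B where "A = (\<Prod>u\<in>set zs - {y}. \<theta> (u - w - \<gamma>))" and "B = (\<Prod>u\<in>set zs - {y}. ?\<rho> y u)"
    have AB: "(\<Prod>u\<in>set zs - {y}. ?q y u) = A * B" by (simp only: A_def B_def prod.distrib)
    have A: "(\<Prod>u\<in>set zs. \<theta> (u - w - \<gamma>)) = \<theta> (y - w - \<gamma>) * A"
      using y by (simp add: A_def prod.remove)
    have ins: "set (z # zs) - {y} = insert z (set zs - {y})" using y dist by auto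
    have C: "(\<Prod>u\<in>set (z # zs) - {y}. ?q y u) = \<theta> (z - w - \<gamma>) * (\<theta> (z - y + \<gamma>) / \<theta> (z - y)) * (A * B)"
      unfolding ins AB[symmetric] \<theta>_quotient_flip[OF Im_tau, of y z, symmetric]
      using dist by (subst prod.insert) simp_all
    have "\<theta> (z - y) \<noteq> 0" using y dist by (intro separatedD[OF Cons.prems(4)]) auto
    then have id: "\<alpha> (z - w) (- P) * \<theta> (y - w - P - \<gamma>) +
        \<beta> (z - w) (- P) * \<theta> (y - w - \<gamma>) * (\<theta> (z - y + P) / \<theta> (z - y)) =
        \<theta> (y - w - P) * \<theta> (z - w - \<gamma>) * (\<theta> (z - y + \<gamma>) / \<theta> (z - y))"
      using exit_identity[OF Im_tau nz, of "z - w" "y - w"] by simp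
    have "\<beta> (z - w) (- P) * (\<theta> (y - w - \<gamma>) * A) *
        (\<theta> \<gamma> / D * (\<theta> (z - y + P) / \<theta> (z - y)) * B * H y) +
      \<alpha> (z - w) (- P) * (\<theta> \<gamma> / D * \<theta> (y - w - P - \<gamma>) * (A * B) * H y) =
      \<theta> \<gamma> / D * (A * B) * H y * (\<alpha> (z - w) (- P) * \<theta> (y - w - P - \<gamma>) +
        \<beta> (z - w) (- P) * \<theta> (y - w - \<gamma>) * (\<theta> (z - y + P) / \<theta> (z - y)))"
      by (simp only: distrib_left mult_ac add_ac)
    also have "\<dots> = \<theta> \<gamma> / D * \<theta> (y - w - P) *
        (\<theta> (z - w - \<gamma>) * (\<theta> (z - y + \<gamma>) / \<theta> (z - y)) * (A * B)) * H y"
      unfolding id by (simp only: mult_ac)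
    finally show "?S y =
      ?G y"
      unfolding A C AB B_def[symmetric] .
  qed
  also have "?Z' +
    (\<Sum>y\<in>set zs. ?G y) =
    (\<Sum>y\<in>set (z # zs). ?G y)"
  proof -
    have "set (z # zs) - {z} = set zs" using dist by auto
    then show ?thesis using dist by (simp only: list.set sum.insert finite_set not_False_eq_True)
  qed
  finally show ?case
    unfolding P_def[symmetric] by (simp only: D_def length_Cons diff_Suc_1)
qed

lemma column_exit:
  assumes "n \<in> colours" "c \<in> colours" "c \<noteq> n" "as \<in> words (length zs2)" "n \<notin> set as"
    and "generic_dynamical \<Lambda>" "exchangeable \<Lambda> F" "distinct zs1" "separated (set zs1)" "zs1 \<noteq> []"
    and H: "\<And>ys y. mset (ys @ [y]) = mset zs1 \<Longrightarrow>
      F (ys @ y # zs2) (replicate (length zs1 - 1) n @ c # as) = H y"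
  shows "column n \<Lambda> w c F (zs1 @ zs2) (replicate (length zs1) n @ as) =
    (\<Sum>y\<in>set zs1. \<theta> \<gamma> / \<theta> (\<Lambda> c - \<Lambda> n + of_nat (length zs1 - 1) * \<gamma>) * \<theta> (y - w - (\<Lambda> c - \<Lambda> n)) *
      (\<Prod>u\<in>set zs1 - {y}. \<theta> (u - w - \<gamma>) * (\<theta> (y - u - \<gamma>) / \<theta> (y - u))) * H y) *
    pass n (shift \<Lambda> (c # replicate (length zs1 - 1) n)) w zs2 as"
proof -
  let ?r = "replicate (length zs1) n"
  \<comment> \<open>The word to the left of the upper block varies, but conservation fixes its
    content: one c and otherwise n. So the factor of the lower rows can be taken out of the
    sum.\<close>
  have shift: "colw \<Lambda> zs1 w xs n ?r c * pass n (shift \<Lambda> xs) w zs2 as =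
      colw \<Lambda> zs1 w xs n ?r c * pass n (shift \<Lambda> (c # replicate (length zs1 - 1) n)) w zs2 as" for xs
  proof (cases "colw \<Lambda> zs1 w xs n ?r c = 0")
    case False
    have "?r = n # replicate (length zs1 - 1) n" using assms(10) by (cases zs1) simp_all
    then have "mset xs = mset (c # replicate (length zs1 - 1) n)"
      using colw_conserve[OF False] by (simp add: add_mset_commute)
    then have "shift \<Lambda> xs = shift \<Lambda> (c # replicate (length zs1 - 1) n)" by (rule shift_mset)
    then show ?thesis by simp
  qed simp
  have "column n \<Lambda> w c F (zs1 @ zs2) (?r @ as) =
      (\<Sum>xs\<in>words (length zs1). F (zs1 @ zs2) (xs @ as) * colw \<Lambda> zs1 w xs n ?r c) *
      pass n (shift \<Lambda> (c # replicate (length zs1 - 1) n)) w zs2 as"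
    unfolding column_replicate_append[OF assms(1,2,4,5)] sum_distrib_right mult.assoc shift ..
  also have "(\<Sum>xs\<in>words (length zs1). F (zs1 @ zs2) (xs @ as) * colw \<Lambda> zs1 w xs n ?r c) =
    (\<Sum>y\<in>set zs1. \<theta> \<gamma> / \<theta> (\<Lambda> c - \<Lambda> n + of_nat (length zs1 - 1) * \<gamma>) * \<theta> (y - w - (\<Lambda> c - \<Lambda> n)) *
      (\<Prod>u\<in>set zs1 - {y}. \<theta> (u - w - \<gamma>) * (\<theta> (y - u - \<gamma>) / \<theta> (y - u))) * H y)"
    using H by (intro sum_colw_exit[OF assms(1-3,6) exchangeable_append[OF assms(7,4)] assms(8-10)]) simp
  finally show ?thesis .
qed

end
end

section \<open>The sum over the states of one layer\<close>

lemma sum_permutations_of_set_snoc: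
  assumes "finite A" "A \<noteq> {}"
  shows "(\<Sum>ys\<in>permutations_of_set A. f ys) = (\<Sum>y\<in>A. \<Sum>us\<in>permutations_of_set (A - {y}). f (us @ [y]))"
proof -
  have "permutations_of_set A = (\<lambda>(y, us). us @ [y]) ` (SIGMA y:A. permutations_of_set (A - {y}))"
  proof (intro equalityI subsetI)
    fix ys assume ys: "ys \<in> permutations_of_set A"
    then have "ys \<noteq> []" using assms(2) by (auto simp: permutations_of_set_def)
    then have split: "ys = butlast ys @ [last ys]" by simp
    then have "distinct (butlast ys @ [last ys])" "set (butlast ys @ [last ys]) = A"
      using ys by (simp_all add: permutations_of_set_def)
    then have "(last ys, butlast ys) \<in> (SIGMA y:A. permutations_of_set (A - {y}))"
      unfolding permutations_of_set_def by auto
    then show "ys \<in> (\<lambda>(y, us). us @ [y]) ` (SIGMA y:A. permutations_of_set (A - {y}))"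
      using split by (intro image_eqI[of _ _ "(last ys, butlast ys)"]) simp_all
  next
    fix ys assume "ys \<in> (\<lambda>(y, us). us @ [y]) ` (SIGMA y:A. permutations_of_set (A - {y}))"
    then obtain y us where "ys = us @ [y]" "y \<in> A" "set us = A - {y}" "distinct us"
      by (auto simp: permutations_of_set_def)
    then show "ys \<in> permutations_of_set A"
      by (simp add: permutations_of_set_def insert_absorb)
  qed
  moreover have "inj_on (\<lambda>(y, us). us @ [y]) (SIGMA y:A. permutations_of_set (A - {y}))"
    by (auto simp: inj_on_def)
  ultimately have "(\<Sum>ys\<in>permutations_of_set A. f ys) =
      (\<Sum>(y, us)\<in>(SIGMA y:A. permutations_of_set (A - {y})). f (us @ [y]))"
    by (simp add: sum.reindex split_def)
  also have "\<dots> = (\<Sum>y\<in>A. \<Sum>us\<in>permutations_of_set (A - {y}). f (us @ [y]))"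
    using assms(1) by (intro sum.Sigma[symmetric]) simp_all
  finally show ?thesis .
qed

context elliptic_lattice
begin

text \<open>In the notation of the weight function, with columns and rows counted from 0, \<open>exits n t s\<close> lists the
  positions \<open>s_a\<close> among the first \<open>s\<close> columns, and \<open>dyn n \<Lambda> d i\<close> is the argument of the denominator.\<close>

definition exits :: "nat \<Rightarrow> (nat \<Rightarrow> nat) \<Rightarrow> nat \<Rightarrow> nat list" where
  "exits n t s = filter (\<lambda>i. t i \<noteq> n) [0..<s]"

definition dyn :: "nat \<Rightarrow> (nat \<Rightarrow> complex) \<Rightarrow> nat list \<Rightarrow> nat \<Rightarrow> complex" where
  "dyn n \<Lambda> d i = \<Lambda> (d ! i) - \<Lambda> n - \<gamma> * of_nat (count_list (take i d) (d ! i))"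

text \<open>The factor of row i in the weight function, including one [\<gamma>] and cut off after s
  columns. Before the exit column q there are i exits, hence q - i columns of colour n; this is the
  source of - q \<gamma> + i \<gamma>.\<close>

definition row_factor :: "nat \<Rightarrow> (nat \<Rightarrow> complex) \<Rightarrow> (nat \<Rightarrow> complex) \<Rightarrow> nat \<Rightarrow> nat list \<Rightarrow> nat \<Rightarrow> nat
    \<Rightarrow> complex \<Rightarrow> complex" where
  "row_factor n \<Lambda> w s d i q y = (\<Prod>c<q. \<theta> (y - w c)) * (\<Prod>c\<in>{q<..<s}. \<theta> (y - w c - \<gamma>)) *
     (\<theta> \<gamma> * \<theta> (y - w q - dyn n \<Lambda> d i - of_nat q * \<gamma> + of_nat i * \<gamma>) / \<theta> (dyn n \<Lambda> d i))"

definition perm_weight :: "nat \<Rightarrow> (nat \<Rightarrow> complex) \<Rightarrow> (nat \<Rightarrow> complex) \<Rightarrow> (nat \<Rightarrow> nat) \<Rightarrow> nat \<Rightarrow> nat list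
    \<Rightarrow> complex list \<Rightarrow> complex" where
  "perm_weight n \<Lambda> w t s d ys =
     (\<Prod>i<length ys. row_factor n \<Lambda> w s d i (exits n t s ! i) (ys ! i)) *
     (\<Prod>b<length ys. \<Prod>a<b. \<theta> (ys ! a - ys ! b + \<gamma>) / \<theta> (ys ! a - ys ! b))"

text \<open>The weight of the lower rows, which go straight through all s columns. The dynamical
  parts [l + \<gamma>] / [l] of \<alpha> telescope, because l grows by \<gamma> from column to
  column.\<close>

definition rest_weight :: "nat \<Rightarrow> (nat \<Rightarrow> complex) \<Rightarrow> (nat \<Rightarrow> complex) \<Rightarrow> nat \<Rightarrow> nat list \<Rightarrow> nat
    \<Rightarrow> complex list \<Rightarrow> complex" where
  "rest_weight n \<Lambda> w s d j zs = (\<Prod>i<length zs. (\<Prod>c<s. \<theta> (zs ! i - w c)) *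
     (\<theta> (dyn n \<Lambda> d (j + i) + of_nat s * \<gamma>) / \<theta> (dyn n \<Lambda> d (j + i))))"

lemma exits_Suc: "exits n t (Suc s) = (if t s = n then exits n t s else exits n t s @ [s])"
  by (simp add: exits_def)

lemma exits_nth_less: "i < length (exits n t s) \<Longrightarrow> exits n t s ! i < s"
  using nth_mem[of i "exits n t s"] by (auto simp: exits_def)

lemma count_list_exits:
  "a \<noteq> n \<Longrightarrow> count_list (map t (exits n t s)) a = count_list (map t [0..<s]) a"
  "count_list (map t [0..<s]) n + length (exits n t s) = s"
  by (induction s) (auto simp: exits_def)

lemma count_list_replicate: "count_list (replicate m x) y = (if x = y then m else 0)"
  by (induction m) auto

lemma dyn_nonzero:
  assumes "generic_dynamical \<Lambda>" "n \<in> colours" "d ! i \<in> colours" "d ! i \<noteq> n"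
  shows "\<theta> (dyn n \<Lambda> d i + of_nat s * \<gamma>) \<noteq> 0"
  using genericD[OF assms(1,3,2,4), of "int s - int (count_list (take i d) (d ! i))"]
  by (simp add: dyn_def algebra_simps)

lemma row_factor_Suc:
  assumes "q < s"
  shows "row_factor n \<Lambda> w (Suc s) d i q y = \<theta> (y - w s - \<gamma>) * row_factor n \<Lambda> w s d i q y"
proof -
  have "{q<..<Suc s} = insert s {q<..<s}" using assms by auto
  then show ?thesis by (simp add: row_factor_def)
qed

lemma perm_weight_no_exit:
  assumes "t s = n" "length ys = length (exits n t s)"
  shows "perm_weight n \<Lambda> w t (Suc s) d ys = perm_weight n \<Lambda> w t s d ys * (\<Prod>y\<leftarrow>ys. \<theta> (y - w s - \<gamma>))"
proof -
  have "(\<Prod>y\<leftarrow>ys. \<theta> (y - w s - \<gamma>)) = (\<Prod>i<length ys. \<theta> (ys ! i - w s - \<gamma>))"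
    by (simp add: prod.list_conv_set_nth atLeast0LessThan)
  moreover have "(\<Prod>i<length ys. row_factor n \<Lambda> w (Suc s) d i (exits n t (Suc s) ! i) (ys ! i)) =
      (\<Prod>i<length ys. \<theta> (ys ! i - w s - \<gamma>) * row_factor n \<Lambda> w s d i (exits n t s ! i) (ys ! i))"
    using assms by (intro prod.cong refl) (simp add: exits_Suc row_factor_Suc exits_nth_less)
  ultimately show ?thesis by (simp add: perm_weight_def prod.distrib)
qed

lemma perm_weight_exit:
  assumes "t s \<noteq> n" "length us = length (exits n t s)"
  shows "perm_weight n \<Lambda> w t (Suc s) d (us @ [y]) = perm_weight n \<Lambda> w t s d us *
    (\<Prod>u\<leftarrow>us. \<theta> (u - w s - \<gamma>) * (\<theta> (u - y + \<gamma>) / \<theta> (u - y))) *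
    ((\<Prod>c<s. \<theta> (y - w c)) * (\<theta> \<gamma> * \<theta> (y - w s - dyn n \<Lambda> d (length us) - of_nat s * \<gamma> + of_nat (length us) * \<gamma>) /
      \<theta> (dyn n \<Lambda> d (length us))))"
proof -
  let ?j = "length us"
  have "(\<Prod>u\<leftarrow>us. \<theta> (u - w s - \<gamma>) * (\<theta> (u - y + \<gamma>) / \<theta> (u - y))) =
      (\<Prod>i<?j. \<theta> (us ! i - w s - \<gamma>)) * (\<Prod>i<?j. \<theta> (us ! i - y + \<gamma>) / \<theta> (us ! i - y))"
    unfolding prod.distrib[symmetric] by (simp add: prod.list_conv_set_nth atLeast0LessThan)
  moreover have "(\<Prod>i<?j. row_factor n \<Lambda> w (Suc s) d i (exits n t (Suc s) ! i) ((us @ [y]) ! i)) =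
      (\<Prod>i<?j. \<theta> (us ! i - w s - \<gamma>)) * (\<Prod>i<?j. row_factor n \<Lambda> w s d i (exits n t s ! i) (us ! i))"
    unfolding prod.distrib[symmetric] using assms
    by (intro prod.cong refl) (simp add: exits_Suc row_factor_Suc exits_nth_less nth_append)
  moreover have "{s<..<Suc s} = {}" by auto
  then have "row_factor n \<Lambda> w (Suc s) d ?j (exits n t (Suc s) ! ?j) ((us @ [y]) ! ?j) =
      (\<Prod>c<s. \<theta> (y - w c)) * (\<theta> \<gamma> * \<theta> (y - w s - dyn n \<Lambda> d ?j - of_nat s * \<gamma> + of_nat ?j * \<gamma>) / \<theta> (dyn n \<Lambda> d ?j))"
    using assms by (simp add: exits_Suc row_factor_def nth_append)
  moreover have "(\<Prod>b<?j. \<Prod>a<b. \<theta> ((us @ [y]) ! a - (us @ [y]) ! b + \<gamma>) / \<theta> ((us @ [y]) ! a - (us @ [y]) ! b)) =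
      (\<Prod>b<?j. \<Prod>a<b. \<theta> (us ! a - us ! b + \<gamma>) / \<theta> (us ! a - us ! b))"
    by (intro prod.cong refl) (simp add: nth_append)
  moreover have "(\<Prod>a<?j. \<theta> ((us @ [y]) ! a - (us @ [y]) ! ?j + \<gamma>) / \<theta> ((us @ [y]) ! a - (us @ [y]) ! ?j)) =
      (\<Prod>i<?j. \<theta> (us ! i - y + \<gamma>) / \<theta> (us ! i - y))"
    by (intro prod.cong refl) (simp add: nth_append)
  ultimately show ?thesis
    unfolding perm_weight_def length_append list.size(3,4) add_0_right add_Suc_right prod.lessThan_Suc
    by (simp only: mult_ac One_nat_def)
qed

text \<open>Here \<open>ts\<close> consists of the top colours so far and the left edges of the
  upper block. If j of the first s columns are exits, the colour n occurs s - j times among the tops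
  and j times in the block: s times in all, hence the term s \<gamma>.\<close>

lemma pass_shift_eq:
  assumes "n \<notin> set as" "length zs = length as"
    and "\<And>a. a \<noteq> n \<Longrightarrow> count_list ts a = count_list ds a" "count_list ts n = s"
  shows "pass n (shift \<Lambda> ts) v zs as =
    (\<Prod>i<length zs. \<alpha> (zs ! i - v) (dyn n \<Lambda> (ds @ as) (length ds + i) + of_nat s * \<gamma>))"
  unfolding pass_eq[OF assms(1,2)] assms(2)
proof (rule prod.cong[OF refl])
  fix i assume "i \<in> {..<length as}"
  then have "as ! i \<noteq> n" using assms(1) by (metis lessThan_iff nth_mem)
  then have "shift \<Lambda> ts (as ! i) - shift \<Lambda> ts n - \<gamma> * of_nat (count_list (take i as) (as ! i)) =
      dyn n \<Lambda> (ds @ as) (length ds + i) + of_nat s * \<gamma>"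
    using assms(3,4) unfolding dyn_def nth_append_length_plus
    by (simp add: shift_def algebra_simps)
  then show "\<alpha> (zs ! i - v) (shift \<Lambda> ts (as ! i) - shift \<Lambda> ts n - \<gamma> * of_nat (count_list (take i as) (as ! i))) =
    \<alpha> (zs ! i - v) (dyn n \<Lambda> (ds @ as) (length ds + i) + of_nat s * \<gamma>)" by simp
qed

lemma rest_weight_Suc:
  assumes "\<And>i. i < length zs \<Longrightarrow> \<theta> (dyn n \<Lambda> d (j + i) + of_nat s * \<gamma>) \<noteq> 0"
  shows "rest_weight n \<Lambda> w (Suc s) d j zs = rest_weight n \<Lambda> w s d j zs *
    (\<Prod>i<length zs. \<alpha> (zs ! i - w s) (dyn n \<Lambda> d (j + i) + of_nat s * \<gamma>))"
  unfolding rest_weight_def prod.distrib[symmetric]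
  by (rule prod.cong[OF refl]) (use assms in \<open>simp add: \<alpha>_def algebra_simps\<close>)

lemma columns_prefix_Suc:
  "columns n \<Lambda> F (map w [0..<Suc s]) (map t [0..<Suc s]) =
    column n (shift \<Lambda> (map t [0..<s])) (w s) (t s) (columns n \<Lambda> F (map w [0..<s]) (map t [0..<s]))"
  using columns_append[of "map w [0..<s]" "map t [0..<s]" n \<Lambda> F "[w s]" "[t s]"] by simp

lemma exchangeable_columns_prefix:
  assumes "Im \<tau> > 0" "generic_dynamical \<Lambda>" "exchangeable \<Lambda> F" "\<And>i. t i \<in> colours"
  shows "exchangeable (shift \<Lambda> (map t [0..<s])) (columns n \<Lambda> F (map w [0..<s]) (map t [0..<s]))"
proof (induction s)
  case (Suc s)
  then show ?case
    unfolding columns_prefix_Suc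
    using exchangeable_column[OF assms(1) generic_shift[OF assms(2)] Suc assms(4)[of s], of n "w s"] by simp
qed (use assms in simp)

text \<open>Only the value at the states \<open>n, \<dots>, n, as\<close> is computed. The symmetry of these values in the
  first variables, needed for \<open>column_exit\<close>, is read off from the formula itself; deriving it from
  \<open>exchangeable\<close> would require dividing by a possibly vanishing \<open>\<theta> (u - v - \<gamma>)\<close>.\<close>

theorem columns_eq_sum_permutations:
  assumes "Im \<tau> > 0" and gen: "generic_dynamical \<Lambda>" and ex: "exchangeable \<Lambda> F"
    and t: "\<And>i. t i \<in> colours" and n: "n \<in> colours"
    and "distinct zs1" "separated (set zs1)" "length zs1 = length (exits n t s)"
    and "as \<in> words (length zs2)" "n \<notin> set as"
  defines "d \<equiv> map t (exits n t s) @ as"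
  shows "columns n \<Lambda> F (map w [0..<s]) (map t [0..<s]) (zs1 @ zs2) (replicate (length zs1) n @ as) =
    (\<Sum>ys\<in>permutations_of_set (set zs1). perm_weight n \<Lambda> w t s d ys * F (ys @ zs2) d) *
    rest_weight n \<Lambda> w s d (length zs1) zs2"
  using assms(6-10) unfolding d_def
proof (induction s arbitrary: zs1 zs2 as)
  case 0
  have "\<theta> (dyn n \<Lambda> as i) \<noteq> 0" if "i < length zs2" for i
  proof -
    have "as ! i \<in> set as" using that 0(4) by (auto simp: words_def)
    then show ?thesis
      using dyn_nonzero[OF gen n, of as i 0] 0(4,5) by (auto simp: words_def)
  qed
  then show ?case using 0 by (simp add: exits_def perm_weight_def rest_weight_def)
next
  case (Suc s)
  let ?\<Psi> = "columns n \<Lambda> F (map w [0..<s]) (map t [0..<s])"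
  let ?\<Lambda> = "shift \<Lambda> (map t [0..<s])"
  let ?D = "map t (exits n t s)"
  define d where "d = map t (exits n t (Suc s)) @ as"
  have nz: "\<theta> (dyn n \<Lambda> d (length zs1 + i) + of_nat s * \<gamma>) \<noteq> 0" if "i < length zs2" for i
  proof -
    have "d ! (length zs1 + i) = as ! i" using Suc.prems(3) by (simp add: d_def nth_append)
    moreover have "as ! i \<in> set as" using that Suc.prems(4) by (auto simp: words_def)
    ultimately show ?thesis
      using dyn_nonzero[OF gen n, of d "length zs1 + i" s] Suc.prems(4,5) by (auto simp: words_def)
  qed
  have len: "length zs2 = length as" using Suc.prems(4) by (simp add: words_def)
  have rest: "rest_weight n \<Lambda> w (Suc s) d (length zs1) zs2 = rest_weight n \<Lambda> w s d (length zs1) zs2 *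
      (\<Prod>i<length zs2. \<alpha> (zs2 ! i - w s) (dyn n \<Lambda> d (length zs1 + i) + of_nat s * \<gamma>))"
    by (rule rest_weight_Suc) (rule nz)
  show ?case
  proof (cases "t s = n")
    case True
    have d: "d = ?D @ as" using True by (simp add: d_def exits_Suc)
    have len1: "length zs1 = length (exits n t s)" using Suc.prems(3) True by (simp add: exits_Suc)
    note IH = Suc.IH[OF Suc.prems(1,2) len1 Suc.prems(4,5)]
    have "pass n (shift ?\<Lambda> (replicate (length zs1) n)) (w s) zs2 as =
        (\<Prod>i<length zs2. \<alpha> (zs2 ! i - w s) (dyn n \<Lambda> d (length zs1 + i) + of_nat s * \<gamma>))"
      unfolding shift_shift
      using pass_shift_eq[OF Suc.prems(5) len, of "map t [0..<s] @ replicate (length zs1) n" ?D s]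
        len1 count_list_exits(1)[of _ n t s] count_list_exits(2)[of t s n] by (simp add: d count_list_replicate)
    then have "columns n \<Lambda> F (map w [0..<Suc s]) (map t [0..<Suc s]) (zs1 @ zs2) (replicate (length zs1) n @ as) =
        (\<Sum>ys\<in>permutations_of_set (set zs1). perm_weight n \<Lambda> w t s d ys * F (ys @ zs2) d) *
        (\<Prod>z\<leftarrow>zs1. \<theta> (z - w s - \<gamma>)) * rest_weight n \<Lambda> w (Suc s) d (length zs1) zs2"
      unfolding columns_prefix_Suc rest True column_no_exit[OF n Suc.prems(4,5)] IH d[symmetric] by simp
    also have "(\<Sum>ys\<in>permutations_of_set (set zs1). perm_weight n \<Lambda> w t s d ys * F (ys @ zs2) d) *
        (\<Prod>z\<leftarrow>zs1. \<theta> (z - w s - \<gamma>)) =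
      (\<Sum>ys\<in>permutations_of_set (set zs1). perm_weight n \<Lambda> w t (Suc s) d ys * F (ys @ zs2) d)"
      unfolding sum_distrib_right
    proof (rule sum.cong[OF refl])
      fix ys assume "ys \<in> permutations_of_set (set zs1)"
      then have ys: "distinct ys" "set ys = set zs1" by (auto simp: permutations_of_set_def)
      then have "(\<Prod>z\<leftarrow>zs1. \<theta> (z - w s - \<gamma>)) = (\<Prod>z\<leftarrow>ys. \<theta> (z - w s - \<gamma>))"
        using Suc.prems(1) by (metis prod.distinct_set_conv_list)
      moreover have "length ys = length (exits n t s)"
        using ys Suc.prems(1) len1 by (metis distinct_card)
      ultimately show "perm_weight n \<Lambda> w t s d ys * F (ys @ zs2) d * (\<Prod>z\<leftarrow>zs1. \<theta> (z - w s - \<gamma>)) =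
          perm_weight n \<Lambda> w t (Suc s) d ys * F (ys @ zs2) d"
        using perm_weight_no_exit[of t s n ys] True by simp
    qed
    finally show ?thesis unfolding d_def .
  next
    case False
    define c j X where "c = t s" and "j = length (exits n t s)" and "X = dyn n \<Lambda> d j"
    have c: "c \<in> colours" "c \<noteq> n" using t False by (auto simp: c_def)
    have d: "d = ?D @ c # as" using False by (simp add: d_def exits_Suc c_def)
    have j: "length zs1 = Suc j" using Suc.prems(3) False by (simp add: exits_Suc j_def)
    have ne: "zs1 \<noteq> []" using j by auto
    \<comment> \<open>The induction hypothesis with y on top of the lower block. The remaining
      variables enter only through a sum over all their orders, which supplies the symmetry that
      \<open>column_exit\<close> asks for.\<close>
    define H where "H y = (\<Sum>us\<in>permutations_of_set (set zs1 - {y}). perm_weight n \<Lambda> w t s d us * F (us @ y # zs2) d) *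
        rest_weight n \<Lambda> w s d j (y # zs2)" for y
    have H: "?\<Psi> (ys @ y # zs2) (replicate (length zs1 - 1) n @ c # as) = H y"
      if mset: "mset (ys @ [y]) = mset zs1" for ys y
    proof -
      have *: "distinct (ys @ [y])" "set (ys @ [y]) = set zs1" "length (ys @ [y]) = length zs1"
        using mset_eq_imp_distinct_iff[OF mset] mset_eq_setD[OF mset] mset_eq_length[OF mset] Suc.prems(1)
        by simp_all
      then have ys: "set ys = set zs1 - {y}" "length ys = j" "distinct ys" using j by auto
      have "separated (set ys)" using Suc.prems(2) by (rule separated_subset) (use ys in auto)
      then show ?thesis
        using Suc.IH[of ys "c # as" "y # zs2"] ys c Suc.prems(4,5) j
        unfolding H_def d by (simp add: j_def)
    qed
    \<comment> \<open>Exactly s - j of the first s columns have top colour n, and the occurrences of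
      c are already subtracted in \<open>dyn\<close>.\<close>
    have X: "?\<Lambda> c - ?\<Lambda> n = X + of_nat s * \<gamma> - of_nat j * \<gamma>"
    proof -
      have "of_nat s = (of_nat (count_list (map t [0..<s]) n) + of_nat j :: complex)"
        using count_list_exits(2)[of t s n] unfolding j_def by (metis of_nat_add)
      then show ?thesis
        using count_list_exits(1)[OF c(2), of t s]
        by (simp add: X_def dyn_def d j_def nth_append shift_def algebra_simps)
    qed
    have Xnz: "\<theta> (X + of_nat s * \<gamma>) \<noteq> 0"
      unfolding X_def using c by (intro dyn_nonzero[OF gen n]) (simp_all add: d j_def nth_append)
    have pass: "pass n (shift ?\<Lambda> (c # replicate (length zs1 - 1) n)) (w s) zs2 as =
        (\<Prod>i<length zs2. \<alpha> (zs2 ! i - w s) (dyn n \<Lambda> d (length zs1 + i) + of_nat s * \<gamma>))"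
      unfolding shift_shift
      using pass_shift_eq[OF Suc.prems(5) len, of "map t [0..<s] @ c # replicate (length zs1 - 1) n" "?D @ [c]" s]
        c count_list_exits(1)[of _ n t s] count_list_exits(2)[of t s n] by (simp add: d j j_def count_list_replicate)
    \<comment> \<open>Removing y from the lower block frees the factor [X + s \<gamma>] / [X]. Its
      numerator cancels the denominator in \<open>column_exit\<close>, and [X] remains as the
      denominator of the weight function.\<close>
    have rest_H: "rest_weight n \<Lambda> w s d j (y # zs2) =
        (\<Prod>c<s. \<theta> (y - w c)) * (\<theta> (X + of_nat s * \<gamma>) / \<theta> X) * rest_weight n \<Lambda> w s d (length zs1) zs2" for y
      unfolding rest_weight_def length_Cons prod.lessThan_Suc_shift by (simp add: j X_def)
    have "columns n \<Lambda> F (map w [0..<Suc s]) (map t [0..<Suc s]) (zs1 @ zs2) (replicate (length zs1) n @ as) =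
      (\<Sum>y\<in>set zs1. \<theta> \<gamma> / \<theta> (?\<Lambda> c - ?\<Lambda> n + of_nat (length zs1 - 1) * \<gamma>) * \<theta> (y - w s - (?\<Lambda> c - ?\<Lambda> n)) *
        (\<Prod>u\<in>set zs1 - {y}. \<theta> (u - w s - \<gamma>) * (\<theta> (y - u - \<gamma>) / \<theta> (y - u))) * H y) *
      (\<Prod>i<length zs2. \<alpha> (zs2 ! i - w s) (dyn n \<Lambda> d (length zs1 + i) + of_nat s * \<gamma>))"
      unfolding columns_prefix_Suc c_def[symmetric] pass[symmetric]
      by (rule column_exit[OF assms(1) n c Suc.prems(4,5) generic_shift[OF gen]
            exchangeable_columns_prefix[OF assms(1) gen ex t] Suc.prems(1,2) ne H])
    also have "\<dots> = (\<Sum>y\<in>set zs1. \<Sum>us\<in>permutations_of_set (set zs1 - {y}).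
        perm_weight n \<Lambda> w t (Suc s) d (us @ [y]) * F ((us @ [y]) @ zs2) d) *
      rest_weight n \<Lambda> w (Suc s) d (length zs1) zs2"
    proof -
      have "\<theta> \<gamma> / \<theta> (?\<Lambda> c - ?\<Lambda> n + of_nat (length zs1 - 1) * \<gamma>) * \<theta> (y - w s - (?\<Lambda> c - ?\<Lambda> n)) *
          (\<Prod>u\<in>set zs1 - {y}. \<theta> (u - w s - \<gamma>) * (\<theta> (y - u - \<gamma>) / \<theta> (y - u))) * H y =
        (\<Sum>us\<in>permutations_of_set (set zs1 - {y}).
          perm_weight n \<Lambda> w t (Suc s) d (us @ [y]) * F ((us @ [y]) @ zs2) d) *
          rest_weight n \<Lambda> w s d (length zs1) zs2" if y: "y \<in> set zs1" for y
      proof -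
        define Q where "Q = (\<Prod>u\<in>set zs1 - {y}. \<theta> (u - w s - \<gamma>) * (\<theta> (y - u - \<gamma>) / \<theta> (y - u)))"
        have e1: "?\<Lambda> c - ?\<Lambda> n + of_nat (length zs1 - 1) * \<gamma> = X + of_nat s * \<gamma>" by (simp add: X j)
        have e2: "y - w s - (?\<Lambda> c - ?\<Lambda> n) = y - w s - X - of_nat s * \<gamma> + of_nat j * \<gamma>" by (simp add: X)
        have weight: "perm_weight n \<Lambda> w t (Suc s) d (us @ [y]) = perm_weight n \<Lambda> w t s d us * Q *
            ((\<Prod>c<s. \<theta> (y - w c)) * (\<theta> \<gamma> * \<theta> (y - w s - X - of_nat s * \<gamma> + of_nat j * \<gamma>) / \<theta> X))"
          if us: "us \<in> permutations_of_set (set zs1 - {y})" for us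
        proof -
          have us': "distinct us" "set us = set zs1 - {y}" using us by (auto simp: permutations_of_set_def)
          have "length us = j"
            using distinct_card[OF us'(1)] distinct_card[OF Suc.prems(1)] y j us'(2) by simp
          moreover have "(\<Prod>u\<leftarrow>us. \<theta> (u - w s - \<gamma>) * (\<theta> (u - y + \<gamma>) / \<theta> (u - y))) = Q"
            unfolding Q_def us'(2)[symmetric] \<theta>_quotient_flip[OF assms(1), of y]
            using us'(1) by (simp only: prod.distinct_set_conv_list)
          ultimately show ?thesis
            using perm_weight_exit[of t s n us] False by (simp add: j_def X_def)
        qed
        show ?thesis
          unfolding H_def rest_H Q_def[symmetric] e1 e2 sum_distrib_left sum_distrib_right
          using Xnz by (intro sum.cong refl) (simp add: weight)
      qed
      then show ?thesis unfolding rest by (simp add: sum_distrib_right mult.assoc)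
    qed
    also have "(\<Sum>y\<in>set zs1. \<Sum>us\<in>permutations_of_set (set zs1 - {y}).
        perm_weight n \<Lambda> w t (Suc s) d (us @ [y]) * F ((us @ [y]) @ zs2) d) =
      (\<Sum>ys\<in>permutations_of_set (set zs1). perm_weight n \<Lambda> w t (Suc s) d ys * F (ys @ zs2) d)"
      using ne by (intro sum_permutations_of_set_snoc[symmetric]) simp_all
    finally show ?thesis unfolding d_def .
  qed
qed

end

section \<open>Edge colourings and iterated layers\<close>

lemma sum_PiE_insert:
  assumes "i \<notin> I"
  shows "(\<Sum>g\<in>PiE (insert i I) X. F g) = (\<Sum>x\<in>X i. \<Sum>g\<in>PiE I X. F (g(i := x)))"
proof -
  have "(\<Sum>g\<in>PiE (insert i I) X. F g) = (\<Sum>(x, g)\<in>X i \<times> PiE I X. F (g(i := x)))"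
    unfolding PiE_insert_eq
    by (subst sum.reindex[OF inj_combinator[OF assms]]) (simp add: split_def)
  then show ?thesis by (simp add: sum.cartesian_product)
qed

text \<open>An iterated transfer matrix, used on two levels: inside a layer the states are words on
  a cut, between layers a state is the family of all horizontal words of a layer.\<close>

primrec chain :: "(nat \<Rightarrow> 'a set) \<Rightarrow> (nat \<Rightarrow> 'a \<Rightarrow> 'a \<Rightarrow> complex) \<Rightarrow> ('a \<Rightarrow> complex) \<Rightarrow> nat \<Rightarrow> 'a \<Rightarrow> complex" where
  "chain X T F 0 y = F y"
| "chain X T F (Suc n) y = (\<Sum>x\<in>X n. chain X T F n x * T n x y)"

lemma sum_PiE_chain:
  "(\<Sum>g\<in>PiE {..<n} X. F ((g(n := y)) 0) * (\<Prod>s<n. T s (g s) ((g(n := y)) (Suc s)))) = chain X T F n y"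
proof (induction n arbitrary: y)
  case (Suc n)
  have "(\<Sum>g\<in>PiE {..<Suc n} X. F ((g(Suc n := y)) 0) * (\<Prod>s<Suc n. T s (g s) ((g(Suc n := y)) (Suc s)))) =
    (\<Sum>x\<in>X n. \<Sum>g\<in>PiE {..<n} X. F ((g(n := x)) 0) * (\<Prod>s<n. T s (g s) ((g(n := x)) (Suc s))) * T n x y)"
    unfolding lessThan_Suc
    by (subst sum_PiE_insert, simp, intro sum.cong refl) (auto intro!: prod.cong simp: mult.assoc)
  also have "\<dots> = chain X T F (Suc n) y"
    by (simp only: sum_distrib_right[symmetric] Suc chain.simps)
  finally show ?case .
qed simp

text \<open>Splits an edge colouring into one function per column. The hypothesis
  \<open>cong\<close> confines \<open>F\<close> to \<open>E\<close>, since the reassembled function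
  may differ from \<open>f\<close> outside it.\<close>

lemma sum_PiE_regroup:
  assumes E: "E = {(p, r, s). (p, s) \<in> I \<and> r \<in> J (p, s)}"
    and cong: "\<And>f g. (\<And>e. e \<in> E \<Longrightarrow> f e = g e) \<Longrightarrow> F f = F g"
  shows "(\<Sum>f\<in>E \<rightarrow>\<^sub>E A. F f) = (\<Sum>g\<in>PiE I (\<lambda>i. J i \<rightarrow>\<^sub>E A). F (\<lambda>(p, r, s). g (p, s) r))"
proof (rule sum.reindex_bij_witness[where i = "\<lambda>g. restrict (\<lambda>(p, r, s). g (p, s) r) E"
      and j = "\<lambda>f. restrict (\<lambda>(p, s). restrict (\<lambda>r. f (p, r, s)) (J (p, s))) I"])
  fix f assume f: "f \<in> E \<rightarrow>\<^sub>E A"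
  let ?g = "restrict (\<lambda>(p, s). restrict (\<lambda>r. f (p, r, s)) (J (p, s))) I"
  have g: "?g (p, s) r = f (p, r, s)" if "(p, r, s) \<in> E" for p r s
    using that by (simp add: E)
  show "restrict (\<lambda>(p, r, s). ?g (p, s) r) E = f"
  proof (rule extensionalityI[of _ E])
    show "f \<in> extensional E" using f by (simp add: PiE_def)
    show "restrict (\<lambda>(p, r, s). ?g (p, s) r) E e = f e" if "e \<in> E" for e
      using that g by (cases e) simp
  qed simp
  show "?g \<in> PiE I (\<lambda>i. J i \<rightarrow>\<^sub>E A)"
  proof (rule PiE_I)
    fix i assume i: "i \<in> I"
    obtain p s where ps: "i = (p, s)" by (cases i)
    have "(\<lambda>r. f (p, r, s)) r \<in> A" if "r \<in> J (p, s)" for r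
      using f i that by (intro PiE_mem[OF f]) (simp add: E ps)
    then show "?g i \<in> J i \<rightarrow>\<^sub>E A" using i by (simp add: ps)
  qed simp
  show "F (\<lambda>(p, r, s). ?g (p, s) r) = F f"
  proof (rule cong)
    show "(case e of (p, r, s) \<Rightarrow> ?g (p, s) r) = f e" if "e \<in> E" for e
      using that g by (cases e) simp
  qed
next
  fix g assume g: "g \<in> PiE I (\<lambda>i. J i \<rightarrow>\<^sub>E A)"
  show "restrict (\<lambda>(p, r, s). g (p, s) r) E \<in> E \<rightarrow>\<^sub>E A"
  proof (rule PiE_I)
    fix e assume e: "e \<in> E"
    then obtain p r s where "e = (p, r, s)" "(p, s) \<in> I" "r \<in> J (p, s)" by (auto simp: E)
    then show "restrict (\<lambda>(p, r, s). g (p, s) r) E e \<in> A"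
      using PiE_mem[OF PiE_mem[OF g]] e by simp
  qed simp
  show "restrict (\<lambda>(p, s). restrict (\<lambda>r. restrict (\<lambda>(p, r, s). g (p, s) r) E (p, r, s)) (J (p, s))) I = g"
  proof (rule extensionalityI[of _ I])
    show "g \<in> extensional I" using g by (simp add: PiE_def)
    fix i assume i: "i \<in> I"
    obtain p s where ps: "i = (p, s)" by (cases i)
    have ext: "g (p, s) \<in> extensional (J (p, s))" using PiE_mem[OF g i] by (simp add: ps PiE_def)
    have "restrict (\<lambda>r. restrict (\<lambda>(p, r, s). g (p, s) r) E (p, r, s)) (J (p, s)) = g (p, s)"
      using i by (intro extensionalityI[OF restrict_extensional ext]) (simp add: E ps)
    then show "restrict (\<lambda>(p, s). restrict (\<lambda>r. restrict (\<lambda>(p, r, s). g (p, s) r) E (p, r, s)) (J (p, s))) I i = g i"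
      using i by (simp add: ps)
  qed simp
qed

section \<open>Columnwise weights and path independence of the dynamical parameter\<close>

context elliptic_lattice
begin

lemma sum_PiE_words:
  "(\<Sum>f\<in>{1..n} \<rightarrow>\<^sub>E colours. F (map f [1..<Suc n])) = (\<Sum>xs\<in>words n. F xs)"
proof (rule sum.reindex_bij_witness[where i = "\<lambda>xs. restrict (\<lambda>r. xs ! (r - 1)) {1..n}"
      and j = "\<lambda>f. map f [1..<Suc n]"])
  fix xs assume "xs \<in> words n"
  then have xs: "length xs = n" "set xs \<subseteq> colours" by (auto simp: words_def)
  show "map (restrict (\<lambda>r. xs ! (r - 1)) {1..n}) [1..<Suc n] = xs"
    using xs by (intro nth_equalityI) (simp_all del: upt_Suc)
  show "restrict (\<lambda>r. xs ! (r - 1)) {1..n} \<in> {1..n} \<rightarrow>\<^sub>E colours"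
    using xs nth_mem by (fastforce simp: PiE_iff)
next
  fix f assume f: "f \<in> {1..n} \<rightarrow>\<^sub>E colours"
  show "restrict (\<lambda>r. map f [1..<Suc n] ! (r - 1)) {1..n} = f"
    using f by (auto simp: fun_eq_iff PiE_def extensional_def simp del: upt_Suc)
  show "map f [1..<Suc n] \<in> words n" using f by (auto simp: words_def)
qed simp

lemma colw_nth:
  assumes "length xs = length zs" "length ys = length zs" "t \<in> colours"
  shows "colw \<Lambda> zs w xs b ys t = (\<Sum>ms\<in>words (length zs). if (t # ms) ! length zs = b then
    \<Prod>i<length zs. R (zs ! i - w) (shift \<Lambda> (take i xs)) (xs ! i) (ms ! i) (ys ! i) ((t # ms) ! i) else 0)"
  using assms
proof (induction zs arbitrary: xs ys t \<Lambda>)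
  case (Cons z zs)
  obtain x xs' y ys' where eqs: "xs = x # xs'" "ys = y # ys'" "length xs' = length zs" "length ys' = length zs"
    using Cons.prems by (auto simp: length_Suc_conv)
  show ?case
    unfolding eqs colw.simps length_Cons sum_words_Suc prod.lessThan_Suc_shift
    by (intro sum.cong refl) (simp add: Cons.IH eqs sum_distrib_left if_distrib[of "(*) _"] cong: if_cong)
qed auto

lemma columns_chain:
  "columns n \<Lambda> F (map w [0..<s]) (map t [0..<s]) zs ys =
    chain (\<lambda>_. words (length zs)) (\<lambda>i xs ys. colw (shift \<Lambda> (map t [0..<i])) zs (w i) xs n ys (t i)) (F zs) s ys"
  by (induction s arbitrary: ys) (simp_all only: columns_prefix_Suc column_def chain.simps, simp)


lemma count_list_map_upt: "of_nat (count_list (map f [a..<b]) j) = (\<Sum>i\<in>{a..<b}. mu (f i) j)"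
  by (induction b) (auto simp: mu_def)

text \<open>The definition goes down the left boundary and then along a row; the other path goes
  along the top and then down the left side of column s. By conservation at each vertex both cross
  the same colours.\<close>

lemma corner_eq_shift:
  assumes conserve: "\<And>r s. r \<in> {1..k p} \<Longrightarrow> s \<in> {1..N p} \<Longrightarrow>
      {#h (p, r, s - 1), v (p, r, s)#} = {#h (p, r, s), v (p, r - 1, s)#}"
    and "r \<in> {1..k p}" "s \<in> {1..N p}"
  shows "corner col lam h v p r s =
    shift (shift (lam_shift col lam p) (map (\<lambda>s. v (p, 0, s)) [1..<s])) (map (\<lambda>r. h (p, r, s - 1)) [1..<r])"
proof
  fix j
  have mu_add: "mu a j + mu b j = mu c j + mu d j" if "{#a, b#} = {#c, d#}" for a b c d
    using that by (auto simp: add_eq_conv_ex)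
  have row: "(\<Sum>s'\<in>{1..<Suc s}. mu (v (p, r, s')) j) + mu (h (p, r, 0)) j =
      (\<Sum>s'\<in>{1..<Suc s}. mu (v (p, r - 1, s')) j) + mu (h (p, r, s)) j"
    if "r \<in> {1..k p}" "s \<le> N p" for r s
    using that(2)
  proof (induction s)
    case (Suc s)
    have "mu (h (p, r, s)) j + mu (v (p, r, Suc s)) j = mu (h (p, r, Suc s)) j + mu (v (p, r - 1, Suc s)) j"
      using conserve[of r "Suc s"] that(1) Suc.prems by (intro mu_add) simp
    moreover have "(\<Sum>s'\<in>{1..<Suc s}. mu (v (p, r, s')) j) + mu (h (p, r, 0)) j =
        (\<Sum>s'\<in>{1..<Suc s}. mu (v (p, r - 1, s')) j) + mu (h (p, r, s)) j"
      using Suc by simp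
    ultimately have "(\<Sum>s'\<in>{1..<Suc s}. mu (v (p, r, s')) j) + mu (v (p, r, Suc s)) j + mu (h (p, r, 0)) j =
        (\<Sum>s'\<in>{1..<Suc s}. mu (v (p, r - 1, s')) j) + mu (v (p, r - 1, Suc s)) j + mu (h (p, r, Suc s)) j"
      by algebra
    then show ?case unfolding sum.op_ivl_Suc[of _ _ "Suc s"] by simp
  qed simp
  \<comment> \<open>Adding up the rows gives the balance of the rectangle formed by the first r rows
    and the first s - 1 columns.\<close>
  have block: "(\<Sum>r'\<in>{1..<Suc r}. mu (h (p, r', 0)) j) + (\<Sum>s'\<in>{1..<s}. mu (v (p, r, s')) j) =
      (\<Sum>s'\<in>{1..<s}. mu (v (p, 0, s')) j) + (\<Sum>r'\<in>{1..<Suc r}. mu (h (p, r', s - 1)) j)"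
    if "r \<le> k p" for r
    using that
  proof (induction r)
    case (Suc r)
    have "(\<Sum>s'\<in>{1..<s}. mu (v (p, Suc r, s')) j) + mu (h (p, Suc r, 0)) j =
        (\<Sum>s'\<in>{1..<s}. mu (v (p, r, s')) j) + mu (h (p, Suc r, s - 1)) j"
      using row[of "Suc r" "s - 1"] assms(3) Suc.prems by (cases s) (simp_all del: sum.op_ivl_Suc)
    moreover have "r \<le> k p" using Suc.prems by simp
    note Suc.IH[OF this]
    ultimately have "(\<Sum>r'\<in>{1..<Suc r}. mu (h (p, r', 0)) j) + mu (h (p, Suc r, 0)) j +
        (\<Sum>s'\<in>{1..<s}. mu (v (p, Suc r, s')) j) =
      (\<Sum>s'\<in>{1..<s}. mu (v (p, 0, s')) j) +
        ((\<Sum>r'\<in>{1..<Suc r}. mu (h (p, r', s - 1)) j) + mu (h (p, Suc r, s - 1)) j)"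
      by algebra
    then show ?case unfolding sum.op_ivl_Suc[of _ _ "Suc r"] by simp
  qed simp
  show "corner col lam h v p r s j = shift (shift (lam_shift col lam p) (map (\<lambda>s. v (p, 0, s)) [1..<s]))
      (map (\<lambda>r. h (p, r, s - 1)) [1..<r]) j"
  proof -
    have "(\<Sum>r'\<in>{1..<r}. mu (h (p, r', 0)) j) + (\<Sum>s'\<in>{1..<s}. mu (v (p, r - 1, s')) j) =
      (\<Sum>s'\<in>{1..<s}. mu (v (p, 0, s')) j) + (\<Sum>r'\<in>{1..<r}. mu (h (p, r', s - 1)) j)"
      using block[of "r - 1"] assms(2) by (cases r) auto
    then have "\<gamma> * (\<Sum>r'\<in>{1..<r}. mu (h (p, r', 0)) j) + \<gamma> * (\<Sum>s'\<in>{1..<s}. mu (v (p, r - 1, s')) j) =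
      \<gamma> * (\<Sum>s'\<in>{1..<s}. mu (v (p, 0, s')) j) + \<gamma> * (\<Sum>r'\<in>{1..<r}. mu (h (p, r', s - 1)) j)"
      by (simp only: distrib_left[symmetric])
    then show ?thesis
      unfolding corner_def shift_def count_list_map_upt by (simp add: algebra_simps)
  qed
qed

text \<open>The change of path needs conservation at all vertices. If it fails at one of them, both
  products contain a zero whatever the parameters are.\<close>

lemma layer_weight_eq:
  fixes x :: "nat \<Rightarrow> nat \<Rightarrow> complex" and p :: nat and h v :: edge_colours
  defines "W \<equiv> \<lambda>\<Lambda> r s. R (x r s) (\<Lambda> r s)
    (h (p, r, s - 1)) (v (p, r, s)) (h (p, r, s)) (v (p, r - 1, s))"
  shows "(\<Prod>r\<in>{1..k p}. \<Prod>s\<in>{1..N p}. W (corner col lam h v p) r s) =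
    (\<Prod>s\<in>{1..N p}. \<Prod>r\<in>{1..k p}. W (\<lambda>r s. shift (shift (lam_shift col lam p)
      (map (\<lambda>s. v (p, 0, s)) [1..<s])) (map (\<lambda>r. h (p, r, s - 1)) [1..<r])) r s)" (is "?L = ?R")
proof (cases "\<forall>r\<in>{1..k p}. \<forall>s\<in>{1..N p}.
      {#h (p, r, s - 1), v (p, r, s)#} = {#h (p, r, s), v (p, r - 1, s)#}")
  case True
  have "?L = (\<Prod>s\<in>{1..N p}. \<Prod>r\<in>{1..k p}. W (corner col lam h v p) r s)"
    by (rule prod.swap)
  also have "\<dots> = ?R"
    unfolding W_def by (intro prod.cong refl) (subst corner_eq_shift, use True in auto)
  finally show ?thesis .
next
  case False
  then obtain r s where rs: "r \<in> {1..k p}" "s \<in> {1..N p}"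
    and "{#h (p, r, s - 1), v (p, r, s)#} \<noteq> {#h (p, r, s), v (p, r - 1, s)#}" by blast
  then have zero: "W \<Lambda> r s = 0" for \<Lambda> using R_conserve unfolding W_def by blast
  have "(\<Prod>s\<in>{1..N p}. \<Prod>r\<in>{1..k p}. W \<Lambda> r s) = 0" for \<Lambda>
  proof (rule prod_zero[OF finite_atLeastAtMost], rule bexI[OF _ rs(2)])
    show "(\<Prod>r\<in>{1..k p}. W \<Lambda> r s) = 0"
      using rs(1) zero by (intro prod_zero[OF finite_atLeastAtMost]) blast
  qed
  then show ?thesis by (subst prod.swap) presburger
qed

text \<open>The top and bottom boundary conditions are part of the weight, so that \<open>u\<close>
  can range over all colourings of the vertical edges of a column.\<close>

definition entry_weight :: "nat \<Rightarrow> (nat \<Rightarrow> complex) \<Rightarrow> complex list \<Rightarrow> complex \<Rightarrow> nat list \<Rightarrow> nat list \<Rightarrow> nat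
    \<Rightarrow> (nat \<Rightarrow> nat) \<Rightarrow> complex" where
  "entry_weight b \<Lambda> zs w xs ys t u = (if u 0 = t \<and> u (length zs) = b then
     \<Prod>i<length zs. R (zs ! i - w) (shift \<Lambda> (take i xs)) (xs ! i) (u (Suc i)) (ys ! i) (u i) else 0)"

lemma sum_entry_weight:
  assumes "length xs = length zs" "length ys = length zs" "t \<in> colours"
  shows "(\<Sum>u\<in>{0..length zs} \<rightarrow>\<^sub>E colours. entry_weight b \<Lambda> zs w xs ys t u) = colw \<Lambda> zs w xs b ys t"
proof -
  let ?n = "length zs"
  let ?f = "\<lambda>ms. if (t # ms) ! ?n = b then
    \<Prod>i<?n. R (zs ! i - w) (shift \<Lambda> (take i xs)) (xs ! i) (ms ! i) (ys ! i) ((t # ms) ! i) else 0"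
  have ins: "{0..?n} = insert 0 {1..?n}" by auto
  have upd: "entry_weight b \<Lambda> zs w xs ys t (u(0 := t')) = (if t' = t then ?f (map u [1..<Suc ?n]) else 0)" for t' u
  proof -
    have nth: "(t # map u [1..<Suc ?n]) ! i = (u(0 := t)) i" if "i \<le> ?n" for i
      using that by (cases i) (simp_all del: upt_Suc)
    show ?thesis
      using nth by (auto simp: entry_weight_def simp del: upt_Suc intro!: prod.cong)
  qed
  have "(\<Sum>u\<in>{0..?n} \<rightarrow>\<^sub>E colours. entry_weight b \<Lambda> zs w xs ys t u) =
      (\<Sum>t'\<in>colours. if t' = t then \<Sum>u\<in>{1..?n} \<rightarrow>\<^sub>E colours. ?f (map u [1..<Suc ?n]) else 0)"
    unfolding ins by (subst sum_PiE_insert) (simp, intro sum.cong refl, simp add: upd del: upt_Suc)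
  also have "\<dots> = colw \<Lambda> zs w xs b ys t"
    using assms sum_PiE_words[of ?f ?n] by (simp add: colw_nth)
  finally show ?thesis .
qed

end

lemma ball_atLeast1_iff: "(\<forall>s\<in>{1..n}. P s) \<longleftrightarrow> (\<forall>i<n. P (Suc i))"
proof
  assume *: "\<forall>i<n. P (Suc i)"
  show "\<forall>s\<in>{1..n}. P s"
  proof
    fix s assume "s \<in> {1..n}"
    then show "P s" using *[rule_format, of "s - 1"] by (cases s) simp_all
  qed
qed simp

lemma map_upt_eq_replicate_iff: "map f [1..<Suc n] = replicate n c \<longleftrightarrow> (\<forall>r\<in>{1..n}. f r = c)"
  unfolding ball_atLeast1_iff by (simp add: list_eq_iff_nth_eq del: upt_Suc)

lemma ball_nth_map_upt: "(\<forall>s\<in>{1..n}. f s = map g [1..<Suc n] ! (s - 1)) \<longleftrightarrow> (\<forall>s\<in>{1..n}. f s = g s)"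
  unfolding ball_atLeast1_iff by (simp del: upt_Suc)

lemma ball_nth_append:
  assumes "length xs = a" "length ys = b"
  shows "(\<forall>s\<in>{1..a + b}. f s = (xs @ ys) ! (s - 1)) \<longleftrightarrow>
    (\<forall>s\<in>{1..a}. f s = xs ! (s - 1)) \<and> (\<forall>s\<in>{1..b}. f (a + s) = ys ! (s - 1))"
proof -
  have "(\<forall>i<a + b. f (Suc i) = (xs @ ys) ! i) \<longleftrightarrow> (\<forall>i<a. f (Suc i) = xs ! i) \<and> (\<forall>i<b. f (a + Suc i) = ys ! i)"
  proof (intro iffI conjI allI impI)
    fix i assume *: "\<forall>i<a + b. f (Suc i) = (xs @ ys) ! i"
    show "f (Suc i) = xs ! i" if "i < a" using *[rule_format, of i] that assms by (simp add: nth_append)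
    show "f (a + Suc i) = ys ! i" if "i < b"
      using *[rule_format, of "a + i"] that assms by (simp add: nth_append)
  next
    fix i assume *: "(\<forall>i<a. f (Suc i) = xs ! i) \<and> (\<forall>i<b. f (a + Suc i) = ys ! i)" "i < a + b"
    show "f (Suc i) = (xs @ ys) ! i"
    proof (cases "i < a")
      case False
      then obtain j where "i = a + j" by (metis le_add_diff_inverse not_less)
      then show ?thesis using * assms by (simp add: nth_append)
    qed (use * assms in \<open>simp add: nth_append\<close>)
  qed
  then show ?thesis unfolding ball_atLeast1_iff by simp
qed

section \<open>The lattice with a fixed admissible colouring\<close>

locale coloured_lattice = elliptic_lattice \<tau> \<gamma> M k LI LII LM
  for \<tau> \<gamma> :: complex and M :: nat and k LI LII :: "nat \<Rightarrow> nat" and LM :: nat +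
  fixes z wI wII :: "nat \<Rightarrow> nat \<Rightarrow> complex" and wM :: "nat \<Rightarrow> complex"
    and col :: "nat \<Rightarrow> nat" and lam :: "nat \<Rightarrow> complex"
  assumes Im_tau: "Im \<tau> > 0" and M_pos: "M \<ge> 1"
    and admissible_col: "admissible col"
    and generic_lam: "generic_dynamical lam"
    and generic_z: "generic_spectral z"
begin

definition rows :: "nat \<Rightarrow> complex list" where
  "rows p = map (z p) [1..<Suc (k p)]"

definition cols :: "nat \<Rightarrow> complex list \<Rightarrow> complex list" where
  "cols p us = (if p < M then map (wI p) [1..<Suc (LI p)] @ us @ map (wII p) [1..<Suc (LII p)]
     else map wM [1..<Suc LM])"

definition tops :: "nat \<Rightarrow> nat list \<Rightarrow> nat list" where
  "tops p xs = (if p < M then map (\<lambda>i. col (coordI p i)) [1..<Suc (LI p)] @ xs @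
       map (\<lambda>i. col (coordII p i)) [1..<Suc (LII p)]
     else map (\<lambda>i. col (coordM i)) [1..<Suc LM])"

text \<open>The layers 1, ..., p as a function of the variables and colours on the left boundary of
  layer p + 1. The indicator at 0 is the boundary condition of colour 1 to the left of layer
  1.\<close>

primrec layers :: "nat \<Rightarrow> complex list \<Rightarrow> nat list \<Rightarrow> complex" where
  "layers 0 us xs = (if set xs \<subseteq> {1} then 1 else 0)"
| "layers (Suc p) us xs = columns (p + 2) (lam_shift col lam (Suc p)) (layers p)
     (cols (Suc p) us) (tops (Suc p) xs) (rows (Suc p)) (replicate (k (Suc p)) (p + 2))"

lemma length_rows [simp]: "length (rows p) = k p"
  by (simp add: rows_def)

lemma length_cols: "(p < M \<Longrightarrow> length us = k (p + 1)) \<Longrightarrow> length (cols p us) = N p"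
  by (auto simp: cols_def N_def)

lemma length_tops: "(p < M \<Longrightarrow> length xs = k (p + 1)) \<Longrightarrow> length (tops p xs) = N p"
  by (auto simp: tops_def N_def)

lemma col_layer: "p \<in> {1..M} \<Longrightarrow> c \<in> layer p \<Longrightarrow> col c \<in> {1..p + 1}"
  using admissible_col unfolding admissible_def by blast

lemma set_tops:
  assumes "p \<in> {1..M}" and xs: "set xs \<subseteq> colours"
  shows "set (tops p xs) \<subseteq> colours"
proof -
  have "col c \<in> colours" if "c \<in> layer p" for c
    using col_layer[OF assms(1) that] assms(1) by (auto simp: colours_def)
  then show ?thesis
    using xs unfolding tops_def layer_def
    by (cases "p < M") (auto simp: atLeastLessThanSuc_atLeastAtMost simp del: upt_Suc)
qed

definition hword :: "(nat \<times> nat \<times> nat \<Rightarrow> nat) \<Rightarrow> nat \<Rightarrow> nat \<Rightarrow> nat list" where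
  "hword h p s = map (\<lambda>r. h (p, r, s)) [1..<Suc (k p)]"

lemma length_hword [simp]: "length (hword h p s) = k p"
  by (simp add: hword_def)

lemma tops_hword_iff:
  assumes "p \<in> {1..M}"
  shows "(\<forall>s\<in>{1..N p}. f s = tops p (hword h (p + 1) 0) ! (s - 1)) \<longleftrightarrow>
    (if p < M then (\<forall>i\<in>{1..LI p}. f i = col (coordI p i)) \<and>
        (\<forall>r\<in>{1..k (p + 1)}. f (LI p + r) = h (p + 1, r, 0)) \<and>
        (\<forall>i\<in>{1..LII p}. f (LI p + k (p + 1) + i) = col (coordII p i))
      else \<forall>i\<in>{1..LM}. f i = col (coordM i))"
proof (cases "p < M")
  case True
  have "(\<forall>s\<in>{1..N p}. f s = tops p (hword h (p + 1) 0) ! (s - 1)) \<longleftrightarrow>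
      (\<forall>s\<in>{1..LI p + (k (p + 1) + LII p)}. f s = (map (\<lambda>i. col (coordI p i)) [1..<Suc (LI p)] @
        (hword h (p + 1) 0 @ map (\<lambda>i. col (coordII p i)) [1..<Suc (LII p)])) ! (s - 1))"
    using True by (simp add: N_def tops_def add.assoc del: upt_Suc)
  also have "\<dots> \<longleftrightarrow> (\<forall>s\<in>{1..LI p}. f s = map (\<lambda>i. col (coordI p i)) [1..<Suc (LI p)] ! (s - 1)) \<and>
      (\<forall>s\<in>{1..k (p + 1)}. f (LI p + s) = hword h (p + 1) 0 ! (s - 1)) \<and>
      (\<forall>s\<in>{1..LII p}. f (LI p + (k (p + 1) + s)) = map (\<lambda>i. col (coordII p i)) [1..<Suc (LII p)] ! (s - 1))"
    by (subst ball_nth_append, simp, simp, subst ball_nth_append) simp_all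
  finally show ?thesis
    using True unfolding hword_def ball_nth_map_upt by (simp only: if_True add.assoc)
next
  case False
  then show ?thesis
    unfolding N_def tops_def if_not_P[OF False] ball_nth_map_upt by simp
qed

lemma cols_nth:
  assumes "p \<in> {1..M}" "s \<in> {1..N p}" "p < M \<Longrightarrow> us = map (y (p + 1)) [1..<Suc (k (p + 1))]"
  shows "cols p us ! (s - 1) = col_var y wI wII wM p s"
  using assms by (auto simp: cols_def col_var_def N_def nth_append Suc_diff_Suc simp del: upt_Suc)

text \<open>The conditions on horizontal edges alone. The gluing of consecutive layers is not among
  them: it enters as a condition on top edges, through \<open>tops\<close> with the first word of
  the next layer.\<close>

definition hboundary :: "(nat \<times> nat \<times> nat \<Rightarrow> nat) \<Rightarrow> bool" where
  "hboundary h \<longleftrightarrow> (\<forall>p\<in>{1..M}. hword h p (N p) = replicate (k p) (p + 1)) \<and> hword h 1 0 = replicate (k 1) 1"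

lemma boundary_iff:
  "boundary col h v \<longleftrightarrow> hboundary h \<and>
    (\<forall>p\<in>{1..M}. \<forall>s\<in>{1..N p}. v (p, 0, s) = tops p (hword h (p + 1) 0) ! (s - 1) \<and> v (p, k p, s) = p + 1)"
proof -
  have M: "{1..M} = insert M {1..<M}" using M_pos by auto
  have "(\<forall>p\<in>{1..M}. \<forall>s\<in>{1..N p}. v (p, 0, s) = tops p (hword h (p + 1) 0) ! (s - 1) \<and> v (p, k p, s) = p + 1) \<longleftrightarrow>
    (\<forall>p\<in>{1..M}. \<forall>s\<in>{1..N p}. v (p, k p, s) = p + 1) \<and>
    (\<forall>p\<in>{1..M}. \<forall>s\<in>{1..N p}. v (p, 0, s) = tops p (hword h (p + 1) 0) ! (s - 1))" by blast
  also have "(\<forall>p\<in>{1..M}. \<forall>s\<in>{1..N p}. v (p, 0, s) = tops p (hword h (p + 1) 0) ! (s - 1)) \<longleftrightarrow>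
    (\<forall>p\<in>{1..M}. if p < M then (\<forall>i\<in>{1..LI p}. v (p, 0, i) = col (coordI p i)) \<and>
        (\<forall>r\<in>{1..k (p + 1)}. v (p, 0, LI p + r) = h (p + 1, r, 0)) \<and>
        (\<forall>i\<in>{1..LII p}. v (p, 0, LI p + k (p + 1) + i) = col (coordII p i))
      else \<forall>i\<in>{1..LM}. v (p, 0, i) = col (coordM i))"
    using tops_hword_iff[of _ "\<lambda>s. v (_, 0, s)" h] by (intro ball_cong refl) blast
  also have "\<dots> \<longleftrightarrow> (\<forall>p\<in>{1..<M}. (\<forall>i\<in>{1..LI p}. v (p, 0, i) = col (coordI p i)) \<and>
        (\<forall>r\<in>{1..k (p + 1)}. v (p, 0, LI p + r) = h (p + 1, r, 0)) \<and>
        (\<forall>i\<in>{1..LII p}. v (p, 0, LI p + k (p + 1) + i) = col (coordII p i))) \<and>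
      (\<forall>i\<in>{1..LM}. v (M, 0, i) = col (coordM i))"
    unfolding M by auto
  finally show ?thesis
    unfolding boundary_def hboundary_def hword_def map_upt_eq_replicate_iff by (auto simp del: atLeastAtMost_iff atLeastLessThan_iff)
qed

end

context coloured_lattice
begin

text \<open>A cell is a whole column of a layer, not a single vertex.\<close>

definition cells :: "(nat \<times> nat) set" where
  "cells = (SIGMA p:{1..M}. {1..N p})"

definition cell_weight :: "(nat \<times> nat \<times> nat \<Rightarrow> nat) \<Rightarrow> nat \<times> nat \<Rightarrow> (nat \<Rightarrow> nat) \<Rightarrow> complex" where
  "cell_weight h = (\<lambda>(p, s). entry_weight (p + 1)
     (shift (lam_shift col lam p) (take (s - 1) (tops p (hword h (p + 1) 0)))) (rows p)
     (cols p (rows (p + 1)) ! (s - 1)) (hword h p (s - 1)) (hword h p s) (tops p (hword h (p + 1) 0) ! (s - 1)))"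

definition cell_transfer :: "(nat \<Rightarrow> nat \<Rightarrow> nat list) \<Rightarrow> nat \<Rightarrow> nat \<Rightarrow> complex" where
  "cell_transfer f p s = colw (shift (lam_shift col lam p) (take (s - 1) (tops p (f (p + 1) 0)))) (rows p)
     (cols p (rows (p + 1)) ! (s - 1)) (f p (s - 1)) (p + 1) (f p s) (tops p (f (p + 1) 0) ! (s - 1))"

text \<open>For fixed h, path independence expresses every parameter in a column by
  \<open>tops\<close> and the word to its left, both determined by h. Thus the columns decouple as
  functions of v; a violated vertical boundary condition makes one factor vanish.\<close>

lemma config_weight:
  "(if boundary col h v then \<Prod>p\<in>{1..M}. \<Prod>r\<in>{1..k p}. \<Prod>s\<in>{1..N p}.
      R (z p r - col_var z wI wII wM p s) (corner col lam h v p r s)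
        (h (p, r, s - 1)) (v (p, r, s)) (h (p, r, s)) (v (p, r - 1, s)) else 0) =
   (if hboundary h then \<Prod>(p, s)\<in>cells. cell_weight h (p, s) (\<lambda>r. v (p, r, s)) else 0)"
proof (cases "hboundary h")
  case hb: True
  let ?top = "\<lambda>p. tops p (hword h (p + 1) 0)"
  show ?thesis
  proof (cases "\<forall>p\<in>{1..M}. \<forall>s\<in>{1..N p}. v (p, 0, s) = ?top p ! (s - 1) \<and> v (p, k p, s) = p + 1")
    case True
    have "(\<Prod>r\<in>{1..k p}. \<Prod>s\<in>{1..N p}. R (z p r - col_var z wI wII wM p s) (corner col lam h v p r s)
        (h (p, r, s - 1)) (v (p, r, s)) (h (p, r, s)) (v (p, r - 1, s))) =
      (\<Prod>s\<in>{1..N p}. cell_weight h (p, s) (\<lambda>r. v (p, r, s)))" if p: "p \<in> {1..M}" for p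
    proof (rule trans[OF layer_weight_eq[where p = p and x = "\<lambda>r s. z p r - col_var z wI wII wM p s"] prod.cong[OF refl]])
      fix s assume s: "s \<in> {1..N p}"
      have len: "length (?top p) = N p" by (intro length_tops) simp
      have "v (p, 0, Suc i) = ?top p ! i" if "i < N p" for i
        using True[rule_format, OF p, of "Suc i"] that by simp
      then have map: "map (\<lambda>s. v (p, 0, s)) [1..<s] = take (s - 1) (?top p)"
        using s len by (intro nth_equalityI) auto
      have take: "map (\<lambda>r. h (p, r, s - 1)) [1..<Suc i] = take i (hword h p (s - 1))" if "i < k p" for i
        using that by (simp add: hword_def take_map del: upt_Suc)
      have cols: "cols p (rows (p + 1)) ! (s - 1) = col_var z wI wII wM p s"
        by (rule cols_nth[OF p s]) (simp add: rows_def)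
      have prod1: "(\<Prod>r\<in>{1..k p}. f r) = (\<Prod>i<k p. f (Suc i))" for f :: "nat \<Rightarrow> complex"
        by (simp add: prod.atLeast1_atMost_eq)
      show "(\<Prod>r\<in>{1..k p}. R (z p r - col_var z wI wII wM p s)
          (shift (shift (lam_shift col lam p) (map (\<lambda>s. v (p, 0, s)) [1..<s])) (map (\<lambda>r. h (p, r, s - 1)) [1..<r]))
          (h (p, r, s - 1)) (v (p, r, s)) (h (p, r, s)) (v (p, r - 1, s))) =
        cell_weight h (p, s) (\<lambda>r. v (p, r, s))"
        unfolding cell_weight_def case_prod_conv entry_weight_def map prod1
          cols length_rows
        using True[rule_format, OF p s] take
        by (auto intro!: prod.cong simp: rows_def hword_def simp del: upt_Suc shift_shift)
    qed
    then show ?thesis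
      using hb True by (simp add: boundary_iff cells_def prod.Sigma[symmetric] del: atLeastAtMost_iff)
  next
    case False
    then obtain p s where ps: "(p, s) \<in> cells" "\<not> (v (p, 0, s) = ?top p ! (s - 1) \<and> v (p, k p, s) = p + 1)"
      unfolding cells_def by blast
    have "finite cells" by (simp add: cells_def)
    moreover have "cell_weight h (p, s) (\<lambda>r. v (p, r, s)) = 0"
      using ps(2) unfolding cell_weight_def case_prod_conv entry_weight_def length_rows by (intro if_not_P)
    ultimately have "(\<Prod>(p, s)\<in>cells. cell_weight h (p, s) (\<lambda>r. v (p, r, s))) = 0"
      using ps(1) by (intro prod_zero bexI[of _ "(p, s)"]) simp_all
    then show ?thesis using False by (simp only: boundary_iff if_False if_cancel simp_thms)
  qed
qed (simp add: boundary_iff)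

text \<open>Different cells have disjoint vertical edges, so for fixed h the sum over v is a product
  of sums, one \<open>colw\<close> per cell.\<close>

lemma partition_function_eq_sum_h:
  "partition_function z wI wII wM col lam = (\<Sum>h\<in>h_edges \<rightarrow>\<^sub>E colours. if hboundary h then
     \<Prod>(p, s)\<in>cells. cell_transfer (hword h) p s else 0)"
proof -
  have h_edges: "h_edges \<subseteq> {1..M} \<times> (\<Union>p\<in>{1..M}. {1..k p}) \<times> (\<Union>p\<in>{1..M}. {0..N p})"
    by (auto simp: h_edges_def)
  have v_edges: "v_edges \<subseteq> {1..M} \<times> (\<Union>p\<in>{1..M}. {0..k p}) \<times> (\<Union>p\<in>{1..M}. {1..N p})"
    by (auto simp: v_edges_def)
  have fin: "finite (h_edges \<rightarrow>\<^sub>E colours)" "finite (v_edges \<rightarrow>\<^sub>E colours)"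
    by (intro finite_PiE finite_subset[OF h_edges] finite_subset[OF v_edges] finite_cartesian_product; simp)+
  have configs: "configs col = {x \<in> (h_edges \<rightarrow>\<^sub>E colours) \<times> (v_edges \<rightarrow>\<^sub>E colours). boundary col (fst x) (snd x)}"
    by (auto simp: configs_def colours_def)
  have "partition_function z wI wII wM col lam =
    (\<Sum>(h, v)\<in>(h_edges \<rightarrow>\<^sub>E colours) \<times> (v_edges \<rightarrow>\<^sub>E colours).
      if boundary col h v then \<Prod>p\<in>{1..M}. \<Prod>r\<in>{1..k p}. \<Prod>s\<in>{1..N p}.
        R (z p r - col_var z wI wII wM p s) (corner col lam h v p r s)
          (h (p, r, s - 1)) (v (p, r, s)) (h (p, r, s)) (v (p, r - 1, s)) else 0)"
    unfolding partition_function_def configs sum.inter_filter[OF finite_cartesian_product[OF fin]]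
    by (rule sum.cong[OF refl]) (simp only: split_def)
  also have "\<dots> = (\<Sum>h\<in>h_edges \<rightarrow>\<^sub>E colours. \<Sum>v\<in>v_edges \<rightarrow>\<^sub>E colours.
      if hboundary h then \<Prod>(p, s)\<in>cells. cell_weight h (p, s) (\<lambda>r. v (p, r, s)) else 0)"
    unfolding config_weight by (rule sum.cartesian_product[symmetric])
  also have "\<dots> = (\<Sum>h\<in>h_edges \<rightarrow>\<^sub>E colours. if hboundary h then
     \<Prod>(p, s)\<in>cells. cell_transfer (hword h) p s else 0)"
  proof (rule sum.cong[OF refl])
    fix h assume h: "h \<in> h_edges \<rightarrow>\<^sub>E colours"
    have "(\<Sum>v\<in>v_edges \<rightarrow>\<^sub>E colours. \<Prod>(p, s)\<in>cells. cell_weight h (p, s) (\<lambda>r. v (p, r, s))) =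
      (\<Sum>g\<in>(\<Pi>\<^sub>E i\<in>cells. {0..k (fst i)} \<rightarrow>\<^sub>E colours). \<Prod>i\<in>cells. cell_weight h i (g i))"
    proof (subst sum_PiE_regroup[where I = cells and J = "\<lambda>i. {0..k (fst i)}"])
      show "v_edges = {(p, r, s). (p, s) \<in> cells \<and> r \<in> {0..k (fst (p, s))}}"
        by (auto simp: v_edges_def cells_def)
      fix f g :: "nat \<times> nat \<times> nat \<Rightarrow> nat" assume "\<And>e. e \<in> v_edges \<Longrightarrow> f e = g e"
      then show "(\<Prod>(p, s)\<in>cells. cell_weight h (p, s) (\<lambda>r. f (p, r, s))) =
          (\<Prod>(p, s)\<in>cells. cell_weight h (p, s) (\<lambda>r. g (p, r, s)))"
        by (intro prod.cong refl) (auto simp: cells_def v_edges_def cell_weight_def entry_weight_def intro!: prod.cong)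
    qed (simp add: split_def)
    also have "\<dots> = (\<Prod>i\<in>cells. \<Sum>u\<in>{0..k (fst i)} \<rightarrow>\<^sub>E colours. cell_weight h i u)"
      by (rule prod_sum_PiE[symmetric]) (auto simp: cells_def intro!: finite_PiE)
    also have "\<dots> = (\<Prod>(p, s)\<in>cells. cell_transfer (hword h) p s)"
    proof (rule prod.cong[OF refl])
      fix i assume "i \<in> cells"
      then obtain p s where i: "i = (p, s)" "p \<in> {1..M}" "s \<in> {1..N p}" by (auto simp: cells_def)
      let ?t = "tops p (hword h (p + 1) 0)"
      have "?t ! (s - 1) \<in> colours"
      proof (cases "p < M")
        case True
        have "set (hword h (p + 1) 0) \<subseteq> colours"
          using True by (auto simp: hword_def h_edges_def intro!: PiE_mem[OF h])
        moreover have "?t ! (s - 1) \<in> set ?t" using i length_tops[of p "hword h (p + 1) 0"] by (intro nth_mem) auto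
        ultimately show ?thesis using set_tops[OF i(2)] by blast
      next
        case False
        \<comment> \<open>For p = M the word of layer M + 1 lies outside the lattice and need not
          consist of colours, but \<open>tops M\<close> ignores it.\<close>
        have "?t = tops p []" using False by (simp add: tops_def)
        moreover have "?t ! (s - 1) \<in> set ?t" using i length_tops[of p "hword h (p + 1) 0"] by (intro nth_mem) auto
        ultimately show ?thesis using set_tops[OF i(2), of "[]"] by auto
      qed
      then show "(\<Sum>u\<in>{0..k (fst i)} \<rightarrow>\<^sub>E colours. cell_weight h i u) =
        (case i of (p, s) \<Rightarrow> cell_transfer (hword h) p s)"
        using sum_entry_weight[of "hword h p (s - 1)" "rows p" "hword h p s" "?t ! (s - 1)"]
        by (simp add: i(1) cell_weight_def cell_transfer_def)
    qed
    finally show "(\<Sum>v\<in>v_edges \<rightarrow>\<^sub>E colours. if hboundary h then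
        \<Prod>(p, s)\<in>cells. cell_weight h (p, s) (\<lambda>r. v (p, r, s)) else 0) =
      (if hboundary h then
       \<Prod>(p, s)\<in>cells. cell_transfer (hword h) p s else 0)"
      by (cases "hboundary h") (simp_all only: if_True if_False sum.neutral_const)
  qed
  finally show ?thesis .
qed

end

lemma take_eq_map_nth: "s \<le> length xs \<Longrightarrow> take s xs = map ((!) xs) [0..<s]"
  by (intro nth_equalityI) simp_all

lemma prod_if_zero:
  fixes f :: "nat \<Rightarrow> complex"
  shows "(\<Prod>i<n. if P i then f i else 0) = (if \<forall>i<n. P i then \<Prod>i<n. f i else 0)"
  by (induction n) (auto simp: less_Suc_eq)

context coloured_lattice
begin

text \<open>The index i = p - 1 numbers the layers from 0, as \<open>chain\<close> requires.\<close>

lemma sum_h_eq_sum_words: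
  assumes cong: "\<And>f g. (\<And>p s. p \<in> {1..M} \<Longrightarrow> s \<le> N p \<Longrightarrow> f p s = g p s) \<Longrightarrow> F f = F g"
  shows "(\<Sum>h\<in>h_edges \<rightarrow>\<^sub>E colours. F (hword h)) =
    (\<Sum>G\<in>(\<Pi>\<^sub>E i\<in>{..<M}. {..N (Suc i)} \<rightarrow>\<^sub>E words (k (Suc i))). F (\<lambda>p. G (p - 1)))"
proof (rule sum.reindex_bij_witness[
      where i = "\<lambda>G. restrict (\<lambda>(p, r, s). G (p - 1) s ! (r - 1)) h_edges"
      and j = "\<lambda>h. \<lambda>i\<in>{..<M}. \<lambda>s\<in>{..N (Suc i)}. hword h (Suc i) s"])
  fix h assume h: "h \<in> h_edges \<rightarrow>\<^sub>E colours"
  let ?G = "\<lambda>i\<in>{..<M}. \<lambda>s\<in>{..N (Suc i)}. hword h (Suc i) s"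
  have G: "?G (p - 1) s = hword h p s" if "p \<in> {1..M}" "s \<le> N p" for p s
    using that by auto
  show "restrict (\<lambda>(p, r, s). ?G (p - 1) s ! (r - 1)) h_edges = h"
  proof (rule extensionalityI[of _ h_edges])
    show "h \<in> extensional h_edges" using h by (simp add: PiE_def)
    fix e assume e: "e \<in> h_edges"
    then obtain p r s where prs: "e = (p, r, s)" "p \<in> {1..M}" "r \<in> {1..k p}" "s \<le> N p"
      by (auto simp: h_edges_def)
    then have nth: "hword h p s ! (r - 1) = h (p, r, s)" by (auto simp: hword_def simp del: upt_Suc)
    show "restrict (\<lambda>(p, r, s). ?G (p - 1) s ! (r - 1)) h_edges e = h e"
      by (subst restrict_apply'[OF e]) (simp only: prs(1) case_prod_conv G[OF prs(2,4)] nth)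
  qed simp
  show "?G \<in> (\<Pi>\<^sub>E i\<in>{..<M}. {..N (Suc i)} \<rightarrow>\<^sub>E words (k (Suc i)))"
  proof (rule PiE_I)
    fix i assume i: "i \<in> {..<M}"
    have "hword h (Suc i) s \<in> words (k (Suc i))" if "s \<in> {..N (Suc i)}" for s
    proof -
      have "h (Suc i, r, s) \<in> colours" if "r \<in> {1..k (Suc i)}" for r
        using i that \<open>s \<in> _\<close> by (intro PiE_mem[OF h]) (simp add: h_edges_def)
      then show ?thesis unfolding words_def hword_def by auto
    qed
    then show "?G i \<in> {..N (Suc i)} \<rightarrow>\<^sub>E words (k (Suc i))"
      using i by (simp only: restrict_apply') (rule restrict_PiE_iff[THEN iffD2], blast)
  qed simp
  show "F (\<lambda>p. ?G (p - 1)) = F (hword h)" by (rule cong) (rule G)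
next
  fix G assume G: "G \<in> (\<Pi>\<^sub>E i\<in>{..<M}. {..N (Suc i)} \<rightarrow>\<^sub>E words (k (Suc i)))"
  let ?h = "restrict (\<lambda>(p, r, s). G (p - 1) s ! (r - 1)) h_edges"
  have Gw: "G i s \<in> words (k (Suc i))" if "i < M" "s \<le> N (Suc i)" for i s
    using PiE_mem[OF PiE_mem[OF G]] that by auto
  show "?h \<in> h_edges \<rightarrow>\<^sub>E colours"
  proof (rule PiE_I)
    fix e assume e: "e \<in> h_edges"
    then obtain p r s where prs: "e = (p, r, s)" "p \<in> {1..M}" "r \<in> {1..k p}" "s \<le> N p"
      by (auto simp: h_edges_def)
    then have "G (p - 1) s \<in> words (k p)" using Gw[of "p - 1" s] by auto
    then have nth: "G (p - 1) s ! (r - 1) \<in> colours"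
      using prs(3) nth_mem[of "r - 1" "G (p - 1) s"] by (auto simp: words_def)
    show "?h e \<in> colours"
      by (subst restrict_apply'[OF e]) (simp only: prs(1) case_prod_conv nth)
  qed simp
  have "hword ?h (Suc i) s = G i s" if "i < M" "s \<le> N (Suc i)" for i s
  proof -
    have len: "length (G i s) = k (Suc i)" using Gw[OF that] by (simp add: words_def)
    have "?h (Suc i, Suc r, s) = G i s ! r" if "r < k (Suc i)" for r
      using that \<open>i < M\<close> \<open>s \<le> N (Suc i)\<close> by (simp add: h_edges_def)
    then show ?thesis using len unfolding hword_def by (intro nth_equalityI) (simp_all del: upt_Suc restrict_apply)
  qed
  note hword = this
  show "(\<lambda>i\<in>{..<M}. \<lambda>s\<in>{..N (Suc i)}. hword ?h (Suc i) s) = G"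
  proof (rule extensionalityI[of _ "{..<M}"])
    show "G \<in> extensional {..<M}" using G by (simp add: PiE_def)
    fix i assume i: "i \<in> {..<M}"
    have ext: "G i \<in> extensional {..N (Suc i)}" using PiE_mem[OF G i] by (simp add: PiE_def)
    have "(\<lambda>s\<in>{..N (Suc i)}. hword ?h (Suc i) s) = G i"
    proof (rule extensionalityI[OF restrict_extensional ext])
      fix s assume s: "s \<in> {..N (Suc i)}"
      show "(\<lambda>s\<in>{..N (Suc i)}. hword ?h (Suc i) s) s = G i s"
        by (subst restrict_apply'[OF s]) (use hword i s in blast)
    qed
    then show "(\<lambda>i\<in>{..<M}. \<lambda>s\<in>{..N (Suc i)}. hword ?h (Suc i) s) i = G i"
      by (subst restrict_apply'[OF i])
  qed simp
qed

text \<open>\<open>f\<close> and \<open>f'\<close> hold the horizontal words of the layers i + 1 and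
  i + 2. They interact only through \<open>f' 0\<close>, the top colours of those columns of layer i
  + 1 that carry row variables of layer i + 2.\<close>

definition layer_transfer :: "nat \<Rightarrow> (nat \<Rightarrow> nat list) \<Rightarrow> (nat \<Rightarrow> nat list) \<Rightarrow> complex" where
  "layer_transfer i f f' = (if f (N (Suc i)) = replicate (k (Suc i)) (i + 2) then
     \<Prod>s<N (Suc i). colw (shift (lam_shift col lam (Suc i)) (take s (tops (Suc i) (f' 0)))) (rows (Suc i))
       (cols (Suc i) (rows (i + 2)) ! s) (f s) (i + 2) (f (Suc s)) (tops (Suc i) (f' 0) ! s) else 0)"

text \<open>A chain inside a chain: once the last word of a layer is fixed by the boundary
  condition, summing over its other words is the chain of its columns, by
  \<open>columns_chain\<close>.\<close>

lemma layers_eq_chain: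
  assumes "i \<le> M" "i < M \<Longrightarrow> f' 0 \<in> words (k (Suc i))"
  shows "chain (\<lambda>i. {..N (Suc i)} \<rightarrow>\<^sub>E words (k (Suc i))) layer_transfer
    (\<lambda>f. if f 0 = replicate (k 1) 1 then 1 else 0) i f' = layers i (rows (Suc i)) (f' 0)"
  using assms
proof (induction i arbitrary: f')
  case 0
  then have len: "length (f' 0) = k 1" using M_pos by (simp add: words_def)
  have "f' 0 = replicate (k 1) 1 \<longleftrightarrow> set (f' 0) \<subseteq> {1}"
  proof
    assume "set (f' 0) \<subseteq> {1}"
    then show "f' 0 = replicate (k 1) 1" using len by (intro replicate_eqI) auto
  qed auto
  then show ?case by simp
next
  case (Suc i)
  define n \<Lambda> w t K where "n = N (Suc i)" and "\<Lambda> = lam_shift col lam (Suc i)"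
    and "w = cols (Suc i) (rows (i + 2))" and "t = tops (Suc i) (f' 0)" and "K = words (k (Suc i))"
  let ?r = "replicate (k (Suc i)) (i + 2)"
  let ?L = "layers i (rows (Suc i))"
  let ?T = "\<lambda>s xs ys. colw (shift \<Lambda> (map ((!) t) [0..<s])) (rows (Suc i)) (w ! s) xs (i + 2) ys (t ! s)"
  have len: "length w = n" "length t = n"
    using Suc.prems(2) unfolding w_def t_def n_def
    by (auto intro!: length_cols length_tops simp: words_def)
  have r: "?r \<in> K" using Suc.prems(1) by (auto simp: K_def words_def colours_def)
  have n: "{..n} = insert n {..<n}" by auto
  have "chain (\<lambda>i. {..N (Suc i)} \<rightarrow>\<^sub>E words (k (Suc i))) layer_transfer
      (\<lambda>f. if f 0 = replicate (k 1) 1 then 1 else 0) (Suc i) f' =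
    (\<Sum>f\<in>{..n} \<rightarrow>\<^sub>E K. ?L (f 0) * layer_transfer i f f')"
    unfolding chain.simps n_def K_def
  proof (intro sum.cong refl)
    fix f assume "f \<in> {..N (Suc i)} \<rightarrow>\<^sub>E words (k (Suc i))"
    then have "f 0 \<in> words (k (Suc i))" by auto
    then show "chain (\<lambda>i. {..N (Suc i)} \<rightarrow>\<^sub>E words (k (Suc i))) layer_transfer
        (\<lambda>f. if f 0 = replicate (k 1) 1 then 1 else 0) i f * layer_transfer i f f' =
      ?L (f 0) * layer_transfer i f f'"
      using Suc.IH[of f] Suc.prems(1) by simp
  qed
  also have "\<dots> = (\<Sum>y\<in>K. if y = ?r then
      \<Sum>g\<in>{..<n} \<rightarrow>\<^sub>E K. ?L ((g(n := ?r)) 0) * (\<Prod>s<n. ?T s (g s) ((g(n := ?r)) (Suc s))) else 0)"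
    unfolding n
  proof (subst sum_PiE_insert, simp, rule sum.cong[OF refl])
    fix y
    have "?L ((g(n := y)) 0) * layer_transfer i (g(n := y)) f' =
      (if y = ?r then ?L ((g(n := ?r)) 0) * (\<Prod>s<n. ?T s (g s) ((g(n := ?r)) (Suc s))) else 0)" for g
    proof -
      have prod: "(\<Prod>s<n. colw (shift \<Lambda> (take s t)) (rows (Suc i)) (w ! s) ((g(n := y)) s) (i + 2)
          ((g(n := y)) (Suc s)) (t ! s)) = (\<Prod>s<n. ?T s (g s) ((g(n := y)) (Suc s)))"
        by (rule prod.cong[OF refl]) (simp add: take_eq_map_nth len)
      show ?thesis
        unfolding layer_transfer_def n_def[symmetric] \<Lambda>_def[symmetric] w_def[symmetric] t_def[symmetric]
          prod fun_upd_same
        by (cases "y = ?r") (simp_all only: if_True if_False simp_thms mult_zero_right)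
    qed
    then show "(\<Sum>g\<in>{..<n} \<rightarrow>\<^sub>E K. ?L ((g(n := y)) 0) * layer_transfer i (g(n := y)) f') =
      (if y = ?r then \<Sum>g\<in>{..<n} \<rightarrow>\<^sub>E K. ?L ((g(n := ?r)) 0) * (\<Prod>s<n. ?T s (g s) ((g(n := ?r)) (Suc s))) else 0)"
      by (simp only: sum.neutral_const split: if_split) simp
  qed
  also have "\<dots> = chain (\<lambda>_. K) ?T ?L n ?r"
    using r sum_PiE_chain[where X = "\<lambda>_. K" and F = ?L and y = ?r and T = ?T and n = n] by (simp only: sum.delta K_def finite_words if_True)
  also have "\<dots> = columns (i + 2) \<Lambda> (layers i) (map ((!) w) [0..<n]) (map ((!) t) [0..<n]) (rows (Suc i)) ?r"
    unfolding columns_chain length_rows K_def ..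
  also have "\<dots> = layers (Suc i) (rows (Suc (Suc i))) (f' 0)"
    using map_nth[of w] map_nth[of t] by (simp add: len) (simp add: w_def t_def \<Lambda>_def)
  finally show ?case .
qed

lemma layers_M: "layers M us xs = layers M us' xs'"
proof -
  have "layers (Suc i) us xs = layers (Suc i) us' xs'" if "\<not> Suc i < M" for i
    using that by (simp add: cols_def tops_def)
  from this[of "M - 1"] show ?thesis using M_pos by simp
qed

theorem partition_function_eq_layers:
  "partition_function z wI wII wM col lam = layers M us xs"
proof -
  define F where "F f = (if (\<forall>p\<in>{1..M}. f p (N p) = replicate (k p) (p + 1)) \<and> f 1 0 = replicate (k 1) 1
     then \<Prod>(p, s)\<in>cells. cell_transfer f p s else 0)" for f
  have tops_M: "tops M xs = tops M []" for xs by (simp add: tops_def)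
  have cong: "F f = F g" if eq: "\<And>p s. p \<in> {1..M} \<Longrightarrow> s \<le> N p \<Longrightarrow> f p s = g p s" for f g
  proof -
    have tops: "tops p (f (p + 1) 0) = tops p (g (p + 1) 0)" if "p \<in> {1..M}" for p
      using that eq[of "p + 1" 0] tops_M[of "f (p + 1) 0"] tops_M[of "g (p + 1) 0"]
      by (cases "p = M") auto
    have "(\<forall>p\<in>{1..M}. f p (N p) = replicate (k p) (p + 1)) \<and> f 1 0 = replicate (k 1) 1 \<longleftrightarrow>
        (\<forall>p\<in>{1..M}. g p (N p) = replicate (k p) (p + 1)) \<and> g 1 0 = replicate (k 1) 1"
      using eq M_pos by auto
    moreover have "(\<Prod>(p, s)\<in>cells. cell_transfer f p s) = (\<Prod>(p, s)\<in>cells. cell_transfer g p s)"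
      unfolding cell_transfer_def by (rule prod.cong[OF refl]) (auto simp: cells_def eq tops[simplified])
    ultimately show ?thesis unfolding F_def by simp
  qed
  have "partition_function z wI wII wM col lam = (\<Sum>h\<in>h_edges \<rightarrow>\<^sub>E colours. F (hword h))"
    unfolding partition_function_eq_sum_h F_def hboundary_def ..
  also have "\<dots> = (\<Sum>G\<in>(\<Pi>\<^sub>E i\<in>{..<M}. {..N (Suc i)} \<rightarrow>\<^sub>E words (k (Suc i))). F (\<lambda>p. G (p - 1)))"
    by (rule sum_h_eq_sum_words) (rule cong)
  also have "\<dots> = (\<Sum>G\<in>(\<Pi>\<^sub>E i\<in>{..<M}. {..N (Suc i)} \<rightarrow>\<^sub>E words (k (Suc i))).
      (\<lambda>f. if f 0 = replicate (k 1) 1 then 1 else 0) ((G(M := \<lambda>_. xs)) 0) *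
      (\<Prod>i<M. layer_transfer i (G i) ((G(M := \<lambda>_. xs)) (Suc i))))"
  proof (rule sum.cong[OF refl])
    fix G :: "nat \<Rightarrow> nat \<Rightarrow> nat list"
    \<comment> \<open>The state at M is a dummy end point for \<open>chain\<close>, since layer M
      has no successor.\<close>
    let ?G = "G(M := \<lambda>_. xs)"
    have tops: "tops (Suc i) (?G (Suc i) 0) = tops (Suc i) (G (Suc i) 0)" if "i < M" for i
      using that unfolding tops_def by auto
    have "F (\<lambda>p. G (p - 1)) = (if G 0 0 = replicate (k 1) 1 then
        if \<forall>i<M. G i (N (Suc i)) = replicate (k (Suc i)) (i + 2) then
          \<Prod>i<M. \<Prod>s<N (Suc i). colw (shift (lam_shift col lam (Suc i)) (take s (tops (Suc i) (G (Suc i) 0))))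
            (rows (Suc i)) (cols (Suc i) (rows (i + 2)) ! s) (G i s) (i + 2) (G i (Suc s)) (tops (Suc i) (G (Suc i) 0) ! s)
        else 0 else 0)"
      unfolding F_def cell_transfer_def ball_atLeast1_iff cells_def
      by (subst prod.Sigma[symmetric]) (simp_all add: prod.atLeast1_atMost_eq, blast)
    also have "\<dots> = (if G 0 0 = replicate (k 1) 1 then \<Prod>i<M. layer_transfer i (G i) (?G (Suc i)) else 0)"
      unfolding layer_transfer_def prod_if_zero using tops by (auto intro!: prod.cong)
    also have "\<dots> = (if ?G 0 0 = replicate (k 1) 1 then 1 else 0) * (\<Prod>i<M. layer_transfer i (G i) (?G (Suc i)))"
      using M_pos by simp
    finally show "F (\<lambda>p. G (p - 1)) = (\<lambda>f. if f 0 = replicate (k 1) 1 then 1 else 0) (?G 0) *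
      (\<Prod>i<M. layer_transfer i (G i) (?G (Suc i)))" .
  qed
  also have "\<dots> = layers M (rows (Suc M)) xs"
    using layers_eq_chain[of M "\<lambda>_. xs"]
    by (subst sum_PiE_chain[where T = layer_transfer]) simp
  also have "\<dots> = layers M us xs" by (rule layers_M)
  finally show ?thesis .
qed

end

section \<open>Coordinates, and the exchange relation handed to the next layer\<close>

lemma sorted_list_of_set_eqI:
  "sorted_wrt (<) xs \<Longrightarrow> set xs = A \<Longrightarrow> sorted_list_of_set A = xs" for xs :: "nat list"
  by (metis sorted_list_of_set.idem_if_sorted_distinct strict_sorted_iff)

context coloured_lattice
begin

lemma coordI_bounds:
  assumes "i \<in> {1..LI q}"
  shows "(\<Sum>q\<in>{1..<q}. LI q) < coordI q i" "q \<ge> 1 \<Longrightarrow> coordI q i \<le> (\<Sum>q\<in>{1..<Suc q}. LI q)"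
  using assms by (auto simp: coordI_def)

lemma sum_LI_mono: "p \<le> q \<Longrightarrow> (\<Sum>q\<in>{1..<p}. LI q) \<le> (\<Sum>q\<in>{1..<q}. LI q)"
  by (intro sum_mono2) auto

text \<open>This identifies the parameter in layer p past the columns of \<open>w_I^(p)\<close> with
  the initial parameter of layer p + 1.\<close>

lemma lam_shift_Suc:
  assumes "1 \<le> p" "p < M"
  shows "lam_shift col lam (Suc p) = shift (lam_shift col lam p) (map (\<lambda>i. col (coordI p i)) [1..<Suc (LI p)])"
proof
  fix j
  let ?I = "\<lambda>q. coordI q ` {1..LI q}"
  have disj: "?I p \<inter> (\<Union>q\<in>{Suc p..<M}. ?I q) = {}"
  proof -
    have "coordI p i < coordI q i'" if "i \<in> {1..LI p}" "i' \<in> {1..LI q}" "q \<in> {Suc p..<M}" for i i' q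
      using coordI_bounds(2)[OF that(1) assms(1)] coordI_bounds(1)[OF that(2)] sum_LI_mono[of "Suc p" q] that(3)
      by auto
    then show ?thesis by fastforce
  qed
  have "{p..<M} = insert p {Suc p..<M}" using assms by auto
  then have "(\<Sum>c\<in>(\<Union>q\<in>{p..<M}. ?I q). mu (col c) j) =
      (\<Sum>c\<in>?I p. mu (col c) j) + (\<Sum>c\<in>(\<Union>q\<in>{Suc p..<M}. ?I q). mu (col c) j)"
    using disj by (simp add: sum.union_disjoint)
  also have "(\<Sum>c\<in>?I p. mu (col c) j) = (\<Sum>i\<in>{1..<Suc (LI p)}. mu (col (coordI p i)) j)"
    unfolding atLeastLessThanSuc_atLeastAtMost
    by (subst sum.reindex) (auto simp: inj_on_def coordI_def)
  finally show "lam_shift col lam (Suc p) j =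
      shift (lam_shift col lam p) (map (\<lambda>i. col (coordI p i)) [1..<Suc (LI p)]) j"
    unfolding shift_def count_list_map_upt lam_shift_def by (simp add: algebra_simps del: sum.op_ivl_Suc)
qed

lemma generic_lam_shift: "generic_dynamical (lam_shift col lam p)"
  unfolding generic_dynamical_def colours_def[symmetric]
proof (intro ballI impI allI)
  fix i j and m :: int assume ij: "i \<in> colours" "j \<in> colours" "i \<noteq> j"
  let ?U = "\<Union>q\<in>{p..<M}. coordI q ` {1..LI q}"
  define f where "f j = card {c \<in> ?U. j = col c}" for j
  have "finite ?U" by simp
  then have "(\<Sum>c\<in>?U. mu (col c) j) = of_nat (f j)" for j
    by (simp add: mu_def f_def sum.inter_filter[symmetric] del: UN_iff)
  then have "lam_shift col lam p i - lam_shift col lam p j + of_int m * \<gamma> =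
      lam i - lam j + of_int (m + int (f i) - int (f j)) * \<gamma>"
    by (simp add: lam_shift_def algebra_simps)
  then show "\<theta> (lam_shift col lam p i - lam_shift col lam p j + of_int m * \<gamma>) \<noteq> 0"
    using genericD[OF generic_lam ij] by metis
qed

text \<open>A case distinction suffices: the zipper in layer p works for any left boundary, so
  nothing about layer p - 1 enters. For p = 0 only the vertex with all colours 1
  contributes.\<close>

lemma exchangeable_layers:
  assumes "p < M"
  shows "exchangeable (lam_shift col lam (Suc p)) (layers p)"
proof (cases p)
  case 0
  show ?thesis
    unfolding exchangeable_def 0
  proof (intro allI ballI)
    fix zs1 zs2 :: "complex list" and u v xs1 xs2 c d
    assume "xs1 \<in> words (length zs1)" "xs2 \<in> words (length zs2)" "c \<in> colours" "d \<in> colours"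
    let ?\<Lambda> = "shift (lam_shift col lam (Suc 0)) xs1"
    have 1: "1 \<in> colours" by (simp add: colours_def)
    let ?g = "if set xs1 \<subseteq> {1} \<and> set xs2 \<subseteq> {1} then 1 else 0 :: complex"
    have "R (u - v) ?\<Lambda> a b c d * layers 0 (zs1 @ u # v # zs2) (xs1 @ a # b # xs2) =
      (if b = 1 then if a = 1 then R (u - v) ?\<Lambda> 1 1 c d * ?g else 0 else 0)" for a b
      by auto
    then have "(\<Sum>a\<in>colours. \<Sum>b\<in>colours. R (u - v) ?\<Lambda> a b c d *
        layers 0 (zs1 @ u # v # zs2) (xs1 @ a # b # xs2)) = R (u - v) ?\<Lambda> 1 1 c d * ?g"
      using 1 by simp
    also have "\<dots> = \<theta> (u - v - \<gamma>) * layers 0 (zs1 @ v # u # zs2) (xs1 @ d # c # xs2)"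
      by (auto simp: vertex_weight_def)
    finally show "(\<Sum>a\<in>colours. \<Sum>b\<in>colours. R (u - v) ?\<Lambda> a b c d *
        layers 0 (zs1 @ u # v # zs2) (xs1 @ a # b # xs2)) =
      \<theta> (u - v - \<gamma>) * layers 0 (zs1 @ v # u # zs2) (xs1 @ d # c # xs2)" .
  qed
next
  case (Suc q)
  have layers: "layers p = (\<lambda>us xs. columns (q + 2) (lam_shift col lam p) (layers q)
      (map (wI p) [1..<Suc (LI p)] @ us @ map (wII p) [1..<Suc (LII p)])
      (map (\<lambda>i. col (coordI p i)) [1..<Suc (LI p)] @ xs @ map (\<lambda>i. col (coordII p i)) [1..<Suc (LII p)])
      (rows p) (replicate (k p) (q + 2)))"
    using assms unfolding Suc by (intro ext) (simp add: cols_def tops_def del: upt_Suc)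
  have "q + 2 \<in> colours" using assms Suc by (simp add: colours_def)
  moreover from this have "replicate (k p) (q + 2) \<in> words (length (rows p))"
    by (auto simp: words_def)
  moreover have "lam_shift col lam (Suc p) =
      shift (lam_shift col lam p) (map (\<lambda>i. col (coordI p i)) [1..<Suc (LI p)])"
    using assms Suc by (intro lam_shift_Suc) simp_all
  ultimately show ?thesis
    unfolding layers using exchangeable_columns[OF Im_tau generic_lam_shift] by (simp del: upt_Suc)
qed

text \<open>The coordinates whose colours stand above the columns of layer p, from left to right, as
  \<open>map_col_coords\<close> shows. \<open>coords'\<close> keeps those whose colour goes on to
  the left boundary of layer p.\<close>

definition coords :: "nat \<Rightarrow> nat list" where
  "coords p = sorted_list_of_set {c \<in> Ihat p. col c \<in> {1..p + 1}}"

definition coords' :: "nat \<Rightarrow> nat list" where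
  "coords' p = sorted_list_of_set (Iset col p)"

lemma finite_layer: "finite (layer p)"
  by (simp add: layer_def)

lemma finite_Ihat: "finite (Ihat p)"
  by (simp add: Ihat_def finite_layer)

lemma Ihat_bounds:
  assumes "c \<in> Ihat (Suc p)" "p < M"
  shows "(\<Sum>q\<in>{1..<Suc p}. LI q) < c"
    and "c \<le> (\<Sum>q\<in>{1..<M}. LI q) + LM + (\<Sum>q\<in>{p<..<M}. LII q)"
proof -
  obtain q where q: "q \<in> {Suc p..M}" "c \<in> layer q" using assms by (auto simp: Ihat_def)
  have "(\<Sum>q\<in>{1..<Suc p}. LI q) < c \<and> c \<le> (\<Sum>q\<in>{1..<M}. LI q) + LM + (\<Sum>q\<in>{p<..<M}. LII q)"
  proof (cases "q < M")
    case True
    then consider i where "i \<in> {1..LI q}" "c = coordI q i" | i where "i \<in> {1..LII q}" "c = coordII q i"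
      using q by (auto simp: layer_def)
    then show ?thesis
    proof cases
      case 1
      then show ?thesis
        using coordI_bounds[OF 1(1)] sum_LI_mono[of "Suc p" q] sum_LI_mono[of "Suc q" M] q True by auto
    next
      case 2
      have "{q..<M} = insert q {q<..<M}" using True by auto
      then have "LII q + (\<Sum>q\<in>{q<..<M}. LII q) = (\<Sum>q\<in>{q..<M}. LII q)" by simp
      also have "\<dots> \<le> (\<Sum>q\<in>{p<..<M}. LII q)" using q by (intro sum_mono2) auto
      finally show ?thesis
        using 2 sum_LI_mono[of "Suc p" M] q True by (auto simp: coordII_def)
    qed
  next
    case False
    then show ?thesis
      using q sum_LI_mono[of "Suc p" M] assms(2) by (auto simp: layer_def coordM_def)
  qed
  then show "(\<Sum>q\<in>{1..<Suc p}. LI q) < c"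
    and "c \<le> (\<Sum>q\<in>{1..<M}. LI q) + LM + (\<Sum>q\<in>{p<..<M}. LII q)" by auto
qed

text \<open>The w-variables are ordered so that \<open>w_I^(p)\<close> precedes and
  \<open>w_II^(p)\<close> follows all coordinates of deeper layers; increasing coordinates therefore
  match the columns of layer p.\<close>

lemma coords_less_M:
  assumes "1 \<le> p" "p < M"
  shows "coords p = map (coordI p) [1..<Suc (LI p)] @ coords' (Suc p) @ map (coordII p) [1..<Suc (LII p)]"
  unfolding coords_def
proof (rule sorted_list_of_set_eqI)
  have fin: "finite (Iset col (Suc p))" using finite_Ihat by (simp add: Iset_def)
  have set: "set (coords' (Suc p)) = {c \<in> Ihat (Suc p). col c \<in> {1..Suc p}}"
    unfolding coords'_def by (simp add: fin) (simp add: Iset_def)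
  have I: "set (map (coordI p) [1..<Suc (LI p)]) = coordI p ` {1..LI p}"
    and II: "set (map (coordII p) [1..<Suc (LII p)]) = coordII p ` {1..LII p}"
    by (simp_all only: set_map set_upt atLeastLessThanSuc_atLeastAtMost)
  have layer: "layer p = coordI p ` {1..LI p} \<union> coordII p ` {1..LII p}"
    using assms by (simp add: layer_def)
  have "{p..M} = insert p {Suc p..M}" using assms by auto
  then have Ihat: "Ihat p = layer p \<union> Ihat (Suc p)" by (simp add: Ihat_def)
  have "col c \<in> {1..p + 1}" if "c \<in> layer p" for c using col_layer[OF _ that] assms by simp
  then show "set (map (coordI p) [1..<Suc (LI p)] @ coords' (Suc p) @ map (coordII p) [1..<Suc (LII p)]) =
      {c \<in> Ihat p. col c \<in> {1..p + 1}}"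
    unfolding set_append set I II Ihat layer by auto
  have "sorted_wrt (<) (coords' (Suc p))"
    unfolding coords'_def by (rule strict_sorted_list_of_set)
  moreover have "sorted_wrt (<) (map (coordI p) [1..<Suc (LI p)])" "sorted_wrt (<) (map (coordII p) [1..<Suc (LII p)])"
    by (simp_all add: sorted_wrt_map coordI_def coordII_def del: upt_Suc)
  moreover have "x < y" if "x \<in> coordI p ` {1..LI p}" "y \<in> set (coords' (Suc p))" for x y
    using that coordI_bounds(2)[of _ p] Ihat_bounds(1)[of y p] assms unfolding set by fastforce
  moreover have "x < y" if "x \<in> set (coords' (Suc p))" "y \<in> coordII p ` {1..LII p}" for x y
    using that Ihat_bounds(2)[of x p] assms unfolding set by (auto simp: coordII_def)
  moreover have "x < y" if "x \<in> coordI p ` {1..LI p}" "y \<in> coordII p ` {1..LII p}" for x y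
    using that coordI_bounds(2)[of _ p] sum_LI_mono[of "Suc p" M] assms by (fastforce simp: coordII_def)
  ultimately show "sorted_wrt (<) (map (coordI p) [1..<Suc (LI p)] @ coords' (Suc p) @ map (coordII p) [1..<Suc (LII p)])"
    unfolding sorted_wrt_append set_append I II by blast
qed

lemma coords_M: "coords M = map coordM [1..<Suc LM]"
  unfolding coords_def
proof (rule sorted_list_of_set_eqI)
  show "sorted_wrt (<) (map coordM [1..<Suc LM])"
    by (simp add: sorted_wrt_map coordM_def del: upt_Suc)
  have "Ihat M = coordM ` {1..LM}" by (simp add: Ihat_def layer_def)
  moreover have "col c \<in> {1..M + 1}" if "c \<in> coordM ` {1..LM}" for c
    using col_layer[of M c] that M_pos by (simp add: layer_def)
  ultimately show "set (map coordM [1..<Suc LM]) = {c \<in> Ihat M. col c \<in> {1..M + 1}}"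
    unfolding set_map set_upt atLeastLessThanSuc_atLeastAtMost by auto
qed

lemma map_col_coords:
  assumes "p \<in> {1..M}"
  shows "map col (coords p) = tops p (map col (coords' (Suc p)))"
proof (cases "p < M")
  case True
  then show ?thesis using assms by (simp add: coords_less_M tops_def)
next
  case False
  then have "p = M" using assms by simp
  then show ?thesis using coords_M by (simp add: tops_def)
qed

lemma coords'_eq_filter: "coords' p = filter (\<lambda>c. col c \<noteq> p + 1) (coords p)"
  unfolding coords'_def
proof (rule sorted_list_of_set_eqI)
  have "sorted_wrt (<) (coords p)" unfolding coords_def by (rule strict_sorted_list_of_set)
  then show "sorted_wrt (<) (filter (\<lambda>c. col c \<noteq> p + 1) (coords p))" by (rule sorted_wrt_filter)
  have "finite {c \<in> Ihat p. col c \<in> {1..p + 1}}" using finite_Ihat by simp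
  then show "set (filter (\<lambda>c. col c \<noteq> p + 1) (coords p)) = Iset col p"
    unfolding coords_def by (auto simp: Iset_def)
qed

lemma length_coords': "j \<in> {1..M} \<Longrightarrow> length (coords' j) = k j"
  using admissible_col by (simp add: coords'_def admissible_def)

end

section \<open>Comparison with the weight function\<close>

lemma set_take_strict_sorted:
  fixes xs :: "nat list"
  assumes "sorted_wrt (<) xs" "s < length xs"
  shows "set (take (Suc s) xs) = {x \<in> set xs. x \<le> xs ! s}"
proof (intro equalityI subsetI)
  fix x assume "x \<in> set (take (Suc s) xs)"
  then obtain i where i: "i \<le> s" "x = xs ! i" using assms(2) by (auto simp: in_set_conv_nth less_Suc_eq_le)
  then have "x \<le> xs ! s"
    using assms sorted_wrt_nth_less[OF assms(1), of i s] by (cases "i = s") auto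
  then show "x \<in> {x \<in> set xs. x \<le> xs ! s}" using i assms(2) by auto
next
  fix x assume "x \<in> {x \<in> set xs. x \<le> xs ! s}"
  then obtain i where i: "i < length xs" "x = xs ! i" "xs ! i \<le> xs ! s" by (auto simp: in_set_conv_nth)
  then have "i \<le> s" using sorted_wrt_nth_less[OF assms(1), of s i] by (cases "i \<le> s") auto
  then show "x \<in> set (take (Suc s) xs)" using i assms(2) by (auto simp: in_set_conv_nth less_Suc_eq_le)
qed

lemma prod_pairs_less:
  fixes g :: "nat \<Rightarrow> nat \<Rightarrow> complex"
  shows "(\<Prod>(a, b)\<in>{(a, b). a \<in> {1..n} \<and> b \<in> {1..n} \<and> a < b}. g a b) = (\<Prod>b<n. \<Prod>a<b. g (Suc a) (Suc b))"
proof -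
  have "(\<Prod>b<n. \<Prod>a<b. g (Suc a) (Suc b)) = (\<Prod>(b, a)\<in>(SIGMA b:{..<n}. {..<b}). g (Suc a) (Suc b))"
    by (rule prod.Sigma) auto
  also have "\<dots> = (\<Prod>(a, b)\<in>{(a, b). a \<in> {1..n} \<and> b \<in> {1..n} \<and> a < b}. g a b)"
    by (rule prod.reindex_bij_witness[where i = "\<lambda>(a, b). (b - 1, a - 1)" and j = "\<lambda>(b, a). (Suc a, Suc b)"]) auto
  finally show ?thesis ..
qed

text \<open>Permutations act injectively on the list of values of f; surjectivity follows by
  counting, both sets having n! elements.\<close>

lemma sum_permutations_of_set_permutes:
  assumes "inj_on f {1..n}"
  shows "(\<Sum>ys\<in>permutations_of_set (f ` {1..n}). F ys) =
    (\<Sum>\<pi> | \<pi> permutes {1..n}. F (map (\<lambda>a. f (\<pi> a)) [1..<Suc n]))"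
proof -
  let ?P = "{\<pi>. \<pi> permutes {1..n}}" and ?g = "\<lambda>\<pi>. map (\<lambda>a. f (\<pi> a)) [1..<Suc n]"
  have inj: "inj_on ?g ?P"
  proof (rule inj_onI)
    fix \<pi> \<pi>' assume \<pi>: "\<pi> \<in> ?P" "\<pi>' \<in> ?P" and eq: "?g \<pi> = ?g \<pi>'"
    show "\<pi> = \<pi>'"
    proof
      fix a show "\<pi> a = \<pi>' a"
      proof (cases "a \<in> {1..n}")
        case True
        then have "f (\<pi> a) = f (\<pi>' a)" using eq by (auto simp: map_eq_conv simp del: upt_Suc)
        moreover have "\<pi> a \<in> {1..n}" "\<pi>' a \<in> {1..n}"
          using \<pi> True by (metis mem_Collect_eq permutes_in_image)+
        ultimately show ?thesis using assms by (metis inj_onD)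
      next
        case False
        then show ?thesis using \<pi> by (auto simp: permutes_def)
      qed
    qed
  qed
  have sub: "?g ` ?P \<subseteq> permutations_of_set (f ` {1..n})"
  proof
    fix ys assume "ys \<in> ?g ` ?P"
    then obtain \<pi> where \<pi>: "\<pi> permutes {1..n}" "ys = ?g \<pi>" by auto
    have "set ys = f ` \<pi> ` {1..n}"
      unfolding \<pi>(2) set_map set_upt atLeastLessThanSuc_atLeastAtMost by (simp add: image_image)
    moreover have "inj_on (f \<circ> \<pi>) {1..n}"
      using assms permutes_inj_on[OF \<pi>(1)] permutes_image[OF \<pi>(1)] by (intro comp_inj_on) simp_all
    then have "distinct ys"
      unfolding \<pi>(2) distinct_map set_upt atLeastLessThanSuc_atLeastAtMost by (simp add: o_def)
    ultimately show "ys \<in> permutations_of_set (f ` {1..n})"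
      using permutes_image[OF \<pi>(1)] by (simp add: permutations_of_set_def)
  qed
  have "card (?g ` ?P) = card (permutations_of_set (f ` {1..n}))"
    unfolding card_image[OF inj] using card_permutations[of "{1..n}" n] card_image[OF assms] by simp
  with sub have "?g ` ?P = permutations_of_set (f ` {1..n})"
    by (intro card_subset_eq) simp_all
  then show ?thesis
    using sum.reindex[OF inj, of F] by (simp add: o_def)
qed

context elliptic_lattice
begin

lemma exits_exits_nth:
  "i < length (exits n t s) \<Longrightarrow> exits n t (exits n t s ! i) = take i (exits n t s)"
proof (induction s)
  case (Suc s)
  show ?case
  proof (cases "i < length (exits n t s)")
    case True
    then show ?thesis using Suc by (simp add: exits_Suc nth_append)
  next
    case False
    then show ?thesis using Suc.prems by (auto simp: exits_Suc nth_append split: if_splits)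
  qed
qed (simp add: exits_def)

end

section \<open>Exit columns expressed by coordinates\<close>

context coloured_lattice
begin

text \<open>The default p + 1 beyond the last column keeps all values in \<open>colours\<close>, as
  \<open>columns_eq_sum_permutations\<close> asks for every index.\<close>

definition top_colour :: "nat \<Rightarrow> nat \<Rightarrow> nat" where
  "top_colour p s = (if s < N p then col (coords p ! s) else p + 1)"

abbreviation "exit_list p \<equiv> exits (Suc p) (top_colour p) (N p)"

lemma sorted_coords: "sorted_wrt (<) (coords p)" and distinct_coords: "distinct (coords p)"
  unfolding coords_def by (rule strict_sorted_list_of_set, simp)

lemma set_coords: "set (coords p) = {c \<in> Ihat p. col c \<in> {1..p + 1}}"
  using finite_Ihat[of p] by (simp add: coords_def)

lemma length_coords:
  assumes "p \<in> {1..M}"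
  shows "length (coords p) = N p"
proof -
  have "length (map col (coords p)) = N p"
    unfolding map_col_coords[OF assms] by (rule length_tops) (simp add: length_coords')
  then show ?thesis by simp
qed

lemma map_top_colour:
  assumes "p \<in> {1..M}" "s \<le> N p"
  shows "map (top_colour p) [0..<s] = map col (take s (coords p))"
  using assms by (intro nth_equalityI) (simp_all add: length_coords top_colour_def)

lemma coords'_eq_exits:
  assumes "p \<in> {1..M}"
  shows "coords' p = map ((!) (coords p)) (exit_list p)"
proof -
  have "coords' p = filter (\<lambda>c. col c \<noteq> p + 1) (map ((!) (coords p)) [0..<N p])"
    unfolding coords'_eq_filter length_coords[OF assms, symmetric] map_nth ..
  also have "\<dots> = map ((!) (coords p)) (exit_list p)"
    unfolding filter_map exits_def
    by (intro arg_cong[of _ _ "map _"] filter_cong refl) (simp add: top_colour_def)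
  finally show ?thesis .
qed

lemma length_exit_list: "p \<in> {1..M} \<Longrightarrow> length (exit_list p) = k p"
  using length_coords'[of p] coords'_eq_exits[of p] by simp

lemma map_top_colour_exits: "p \<in> {1..M} \<Longrightarrow> map (top_colour p) (exit_list p) = map col (coords' p)"
  using exits_nth_less[of _ "Suc p" "top_colour p" "N p"]
  by (intro nth_equalityI) (simp_all add: coords'_eq_exits top_colour_def)

text \<open>One count for two purposes: with Q always true it evaluates the relabelling in
  \<open>Itilde\<close>, with Q fixing a colour the numbers \<open>C\<close>.\<close>

lemma card_rank:
  assumes "p \<in> {1..M}" "s < N p"
  shows "card {c \<in> Ihat p. col c \<in> {1..p + 1} \<and> c \<le> coords p ! s \<and> Q c} =
    length (filter Q (take (Suc s) (coords p)))"
proof -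
  have "{c \<in> Ihat p. col c \<in> {1..p + 1} \<and> c \<le> coords p ! s \<and> Q c} = set (filter Q (take (Suc s) (coords p)))"
    using set_take_strict_sorted[OF sorted_coords, of s p] assms
    by (auto simp: length_coords set_coords)
  moreover have "distinct (filter Q (take (Suc s) (coords p)))" using distinct_coords by simp
  ultimately show ?thesis using distinct_card by metis
qed

lemma nth_least_Iset:
  assumes "p \<in> {1..M}" "i < k p"
  shows "nth_least (Iset col p) (Suc i) = coords p ! (exit_list p ! i)"
proof -
  have "nth_least (Iset col p) (Suc i) = coords' p ! i"
    by (simp add: nth_least_def coords'_def)
  then show ?thesis using assms by (simp add: coords'_eq_exits length_exit_list)
qed

text \<open>For p < M the relabelling is the rank in \<open>coords p\<close>, hence the column. For
  p = M the coordinates of the layer are consecutive, and the subtraction removes those before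
  it.\<close>

lemma pos_eq_exit:
  assumes "p \<in> {1..M}" "i < k p"
  shows "pos col p (Suc i) = Suc (exit_list p ! i)"
proof (cases "p < M")
  case True
  let ?r = "\<lambda>c. card {c' \<in> Ihat p. col c' \<in> {1..p + 1} \<and> c' \<le> c}"
  have "set (coords' p) = Iset col p"
    using finite_Ihat by (simp add: coords'_def Iset_def)
  then have "Itilde col p = ?r ` set (coords' p)" by (simp add: Itilde_def)
  also have "\<dots> = (\<lambda>s. ?r (coords p ! s)) ` set (exit_list p)"
    unfolding coords'_eq_exits[OF assms(1)] by (simp add: image_image)
  also have "\<dots> = Suc ` set (exit_list p)"
  proof (rule image_cong[OF refl])
    fix s assume "s \<in> set (exit_list p)"
    then have s: "s < N p" by (simp add: exits_def)
    then show "?r (coords p ! s) = Suc s"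
      using card_rank[OF assms(1) s, of "\<lambda>_. True"] by (simp add: length_coords[OF assms(1)])
  qed
  finally have "sorted_list_of_set (Itilde col p) = map Suc (exit_list p)"
    by (intro sorted_list_of_set_eqI) (simp_all add: exits_def sorted_wrt_map sorted_wrt_filter)
  then show ?thesis
    using True assms by (simp add: pos_def nth_least_def length_exit_list)
next
  case False
  then have p: "p = M" using assms(1) by simp
  have "exit_list p ! i < LM"
    using exits_nth_less[of i "Suc p" "top_colour p" "N p"] assms length_exit_list[OF assms(1)]
    by (simp add: p N_def)
  then have "coords p ! (exit_list p ! i) = (\<Sum>q\<in>{1..<M}. LI q) + Suc (exit_list p ! i)"
    unfolding p coords_M by (simp add: coordM_def del: upt_Suc)
  then show ?thesis
    using nth_least_Iset[OF assms] by (simp add: pos_def p)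
qed

lemma C_eq_count_list:
  assumes "p \<in> {1..M}" "s < N p" "l \<in> {1..p + 1}"
  shows "C col p (coords p ! s) l = count_list (map (top_colour p) [0..<Suc s]) l"
proof -
  have "C col p (coords p ! s) l = card {c \<in> Ihat p. col c \<in> {1..p + 1} \<and> c \<le> coords p ! s \<and> col c = l}"
    using assms(3) unfolding C_def by (intro arg_cong[of _ _ card]) auto
  also have "\<dots> = length (filter (\<lambda>c. col c = l) (take (Suc s) (coords p)))"
    by (rule card_rank[OF assms(1,2)])
  also have "\<dots> = count_list (map col (take (Suc s) (coords p))) l"
    by (simp add: count_list_eq_length_filter filter_map o_def eq_commute)
  finally show ?thesis using map_top_colour[OF assms(1), of "Suc s"] assms(2) by simp
qed

definition bracket_row :: "nat \<Rightarrow> (nat \<Rightarrow> complex) \<Rightarrow> (nat \<Rightarrow> complex) \<Rightarrow> nat \<Rightarrow> complex" where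
  "bracket_row p y m a =
     (let s = pos col p a; I = nth_least (Iset col p) a; c = col I; L = lam_shift col lam p
      in (\<Prod>i\<in>{1..<s}. \<theta> (y a - m i)) * (\<Prod>i\<in>{s<..N p}. \<theta> (y a - m i - \<gamma>)) *
         (\<theta> (y a - m s + L (p+1) - L c + \<gamma> * (of_nat (C col p I c) - of_nat (C col p I (p+1)) - 1)) /
          \<theta> (L c - L (p+1) + \<gamma> * (1 - of_nat (C col p I c)))))"

definition bracket :: "nat \<Rightarrow> (nat \<Rightarrow> complex) \<Rightarrow> (nat \<Rightarrow> complex) \<Rightarrow> complex" where
  "bracket p y m = (\<Prod>a\<in>{1..k p}. bracket_row p y m a) *
     (\<Prod>(a, b)\<in>{(a, b). a \<in> {1..k p} \<and> b \<in> {1..k p} \<and> a < b}. \<theta> (y a - y b + \<gamma>) / \<theta> (y a - y b))"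

text \<open>Let s be the exit column of row i, counted from 0. C(I, c) includes the column itself
  and exceeds the count in \<open>dyn\<close> by one; C(I, p + 1) is s - i, as i of the s earlier
  columns are exits. So the arguments agree with those in \<open>row_factor\<close>, which also
  contributes one [\<gamma>] per row.\<close>

lemma perm_weight_eq_bracket:
  assumes p: "p \<in> {1..M}"
  shows "perm_weight (p + 1) (lam_shift col lam p) (\<lambda>s. m (Suc s)) (top_colour p) (N p)
      (map col (coords' p)) (map y [1..<Suc (k p)]) = \<theta> \<gamma> ^ k p * bracket p y m"
proof -
  define n t d L where "n = p + 1" and "t = top_colour p" and "d = map col (coords' p)" and "L = lam_shift col lam p"
  let ?e = "exits n t (N p)"
  have row: "row_factor n L (\<lambda>s. m (Suc s)) (N p) d i (?e ! i) (y (Suc i)) = \<theta> \<gamma> * bracket_row p y m (Suc i)"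
    if i: "i < k p" for i
  proof -
    define s where "s = ?e ! i"
    have len: "length ?e = k p" using length_exit_list[OF p] by (simp add: n_def t_def)
    have s: "s < N p" using exits_nth_less[of i n t "N p"] i len by (simp add: s_def)
    have "s \<in> set ?e" using i len by (simp add: s_def)
    then have ts: "t s \<noteq> n" by (simp add: exits_def)
    have cs: "col (coords p ! s) = t s" using s by (simp add: t_def top_colour_def)
    have d: "d = map t ?e" using map_top_colour_exits[OF p] by (simp add: d_def n_def t_def)
    have di: "d ! i = t s" using i len by (simp add: d s_def)
    have before: "exits n t s = take i ?e" using exits_exits_nth[of i n t "N p"] i len by (simp add: s_def)
    have "t s \<in> {1..p + 1}"
      using nth_mem[of s "coords p"] s unfolding cs[symmetric] length_coords[OF p] set_coords by blast
    then have "C col p (coords p ! s) (t s) = count_list (map t [0..<Suc s]) (t s)"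
      and "C col p (coords p ! s) n = count_list (map t [0..<Suc s]) n"
      using C_eq_count_list[OF p s] by (simp_all add: n_def t_def)
    moreover have "count_list (map t [0..<s]) (t s) = count_list (take i d) (t s)"
      using count_list_exits(1)[OF ts, of t s] by (simp add: before d take_map)
    moreover have "count_list (map t [0..<s]) n + i = s"
      using count_list_exits(2)[of t s n] i len by (simp add: before)
    then have "of_nat (count_list (map t [0..<s]) n) = (of_nat s - of_nat i :: complex)"
      by (metis add_diff_cancel_right' of_nat_add)
    ultimately have C: "C col p (coords p ! s) (t s) = Suc (count_list (take i d) (t s))"
      "of_nat (C col p (coords p ! s) n) = (of_nat s - of_nat i :: complex)"
      using ts by simp_all
    have pos: "pos col p (Suc i) = Suc s" and I: "nth_least (Iset col p) (Suc i) = coords p ! s"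
      using pos_eq_exit[OF p i] nth_least_Iset[OF p i] by (simp_all add: s_def n_def t_def)
    have 1: "(\<Prod>i'\<in>{1..<Suc s}. f i') = (\<Prod>c<s. f (Suc c))" for f :: "nat \<Rightarrow> complex"
      by (simp add: atLeastLessThanSuc_atLeastAtMost prod.atLeast1_atMost_eq)
    have 2: "(\<Prod>i'\<in>{Suc s<..N p}. f i') = (\<Prod>c\<in>{s<..<N p}. f (Suc c))" for f :: "nat \<Rightarrow> complex"
      by (rule prod.reindex_bij_witness[where i = Suc and j = "\<lambda>c. c - 1"]) auto
    have 3: "y (Suc i) - m (Suc s) + L n - L (t s) +
        \<gamma> * (of_nat (C col p (coords p ! s) (t s)) - of_nat (C col p (coords p ! s) n) - 1) =
      y (Suc i) - m (Suc s) - dyn n L d i - of_nat s * \<gamma> + of_nat i * \<gamma>"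
      unfolding C dyn_def di by (simp add: algebra_simps)
    have 4: "L (t s) - L n + \<gamma> * (1 - of_nat (C col p (coords p ! s) (t s))) = dyn n L d i"
      unfolding C dyn_def di by (simp add: algebra_simps)
    show ?thesis
      unfolding bracket_row_def pos I cs Let_def n_def[symmetric] L_def[symmetric] 1 2 3 4 row_factor_def
        s_def[symmetric] by simp
  qed
  have "(\<Prod>i<k p. row_factor n L (\<lambda>s. m (Suc s)) (N p) d i (?e ! i) (map y [1..<Suc (k p)] ! i)) =
    \<theta> \<gamma> ^ k p * (\<Prod>a\<in>{1..k p}. bracket_row p y m a)"
  proof -
    have 1: "(\<Prod>a\<in>{1..k p}. f a) = (\<Prod>i<k p. f (Suc i))" for f :: "nat \<Rightarrow> complex"
      by (simp add: prod.atLeast1_atMost_eq)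
    have "(\<Prod>i<k p. row_factor n L (\<lambda>s. m (Suc s)) (N p) d i (?e ! i) (map y [1..<Suc (k p)] ! i)) =
        (\<Prod>i<k p. \<theta> \<gamma> * bracket_row p y m (Suc i))"
      by (rule prod.cong[OF refl]) (subst row[symmetric], simp_all del: upt_Suc)
    then show ?thesis unfolding 1 prod.distrib by simp
  qed
  moreover have "(\<Prod>b<k p. \<Prod>a<b. \<theta> (map y [1..<Suc (k p)] ! a - map y [1..<Suc (k p)] ! b + \<gamma>) /
      \<theta> (map y [1..<Suc (k p)] ! a - map y [1..<Suc (k p)] ! b)) =
    (\<Prod>(a, b)\<in>{(a, b). a \<in> {1..k p} \<and> b \<in> {1..k p} \<and> a < b}. \<theta> (y a - y b + \<gamma>) / \<theta> (y a - y b))"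
    unfolding prod_pairs_less by (intro prod.cong refl) (simp del: upt_Suc)
  ultimately show ?thesis
    unfolding perm_weight_def bracket_def n_def[symmetric] t_def[symmetric] d_def[symmetric] L_def[symmetric]
    by (simp add: mult.assoc del: upt_Suc)
qed

end

section \<open>Iteration over the layers\<close>

context coloured_lattice
begin

lemma weight_function_eq_bracket:
  "weight_function z wI wII wM col lam = \<theta> \<gamma> ^ (\<Sum>p\<in>{1..M}. k p) *
    (\<Sum>\<sigma>\<in>(\<Pi>\<^sub>E p\<in>{1..M}. {\<pi>. \<pi> permutes {1..k p}}).
      \<Prod>p\<in>{1..M}. bracket p (\<lambda>a. z p (\<sigma> p a)) (col_var (\<lambda>p a. z p (\<sigma> p a)) wI wII wM p))"
  unfolding weight_function_def bracket_def bracket_row_def Let_def ..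

lemma col_var_cong:
  "(p < M \<Longrightarrow> y (p + 1) = y' (p + 1)) \<Longrightarrow> col_var y wI wII wM p = col_var y' wI wII wM p"
  by (auto simp: col_var_def)

text \<open>The one-layer formula at the right boundary: all rows form the upper block, and with an
  empty lower block \<open>rest_weight\<close> is 1.\<close>

lemma layers_Suc_eq_sum:
  assumes p: "Suc p \<le> M"
    and us: "Suc p < M \<Longrightarrow> us = map (y (p + 2)) [1..<Suc (k (p + 2))]"
  shows "layers (Suc p) us (map col (coords' (Suc (Suc p)))) =
    (\<Sum>\<pi> | \<pi> permutes {1..k (Suc p)}. \<theta> \<gamma> ^ k (Suc p) *
      bracket (Suc p) (\<lambda>a. z (Suc p) (\<pi> a)) (col_var y wI wII wM (Suc p)) *
      layers p (map (\<lambda>a. z (Suc p) (\<pi> a)) [1..<Suc (k (Suc p))]) (map col (coords' (Suc p))))"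
proof -
  define P L m t d where "P = Suc p" and "L = lam_shift col lam P" and "m = col_var y wI wII wM P"
    and "t = top_colour P" and "d = map col (coords' P)"
  have P: "P \<in> {1..M}" using p by (simp add: P_def)
  have t: "t s \<in> colours" for s
  proof (cases "s < N P")
    case True
    then have "coords P ! s \<in> set (coords P)" using length_coords[OF P] by (intro nth_mem) simp
    then show ?thesis using True P by (auto simp: t_def top_colour_def set_coords colours_def)
  qed (use P in \<open>simp add: t_def top_colour_def colours_def\<close>)
  have cols: "cols P us = map (\<lambda>s. m (Suc s)) [0..<N P]"
  proof (rule nth_equalityI)
    have "P < M \<Longrightarrow> length us = k (P + 1)" using us by (simp add: P_def)
    then show len: "length (cols P us) = length (map (\<lambda>s. m (Suc s)) [0..<N P])" using length_cols by simp
    fix s assume "s < length (cols P us)"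
    then show "cols P us ! s = map (\<lambda>s. m (Suc s)) [0..<N P] ! s"
      using cols_nth[OF P, of "Suc s" us y] us len unfolding m_def by (simp add: P_def del: upt_Suc)
  qed
  have tops: "tops P (map col (coords' (Suc P))) = map t [0..<N P]"
    using map_col_coords[OF P] map_top_colour[OF P, of "N P"] length_coords[OF P] by (simp add: t_def)
  have inj: "inj_on (z P) {1..k P}" and sep: "separated (z P ` {1..k P})"
  proof -
    have nz: "\<theta> (z P a - z P b) \<noteq> 0" if "a \<in> {1..k P}" "b \<in> {1..k P}" "a \<noteq> b" for a b
      using generic_z P that unfolding generic_spectral_def by blast
    \<comment> \<open>By oddness [0] = 0, so genericity of the row variables also makes them
      pairwise different.\<close>
    have "\<theta> 0 = 0" using \<theta>_neg[OF Im_tau, of 0] by simp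
    then show "inj_on (z P) {1..k P}" using nz by (metis cancel_comm_monoid_add_class.diff_cancel inj_onI)
    show "separated (z P ` {1..k P})" unfolding separated_def using nz by blast
  qed
  have set_rows: "set (rows P) = z P ` {1..k P}"
    unfolding rows_def set_map set_upt atLeastLessThanSuc_atLeastAtMost ..
  have "layers (Suc p) us (map col (coords' (Suc (Suc p)))) =
      columns (P + 1) L (layers p) (map (\<lambda>s. m (Suc s)) [0..<N P]) (map t [0..<N P])
        (rows P @ []) (replicate (length (rows P)) (P + 1) @ [])"
    unfolding cols[symmetric] tops[symmetric] by (simp add: P_def L_def)
  also have "\<dots> = (\<Sum>ys\<in>permutations_of_set (set (rows P)).
      perm_weight (P + 1) L (\<lambda>s. m (Suc s)) t (N P) (map t (exits (P + 1) t (N P)) @ []) ys *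
      layers p (ys @ []) (map t (exits (P + 1) t (N P)) @ [])) *
      rest_weight (P + 1) L (\<lambda>s. m (Suc s)) (N P) (map t (exits (P + 1) t (N P)) @ []) (length (rows P)) []"
  proof (rule columns_eq_sum_permutations[OF Im_tau _ _ t])
    show "generic_dynamical L" unfolding L_def by (rule generic_lam_shift)
    show "exchangeable L (layers p)" unfolding L_def P_def using p by (intro exchangeable_layers) simp
    show "P + 1 \<in> colours" using P by (simp add: colours_def)
    show "distinct (rows P)"
      using inj unfolding rows_def by (simp add: distinct_map atLeastLessThanSuc_atLeastAtMost del: upt_Suc)
    show "separated (set (rows P))" unfolding set_rows by (rule sep)
    show "length (rows P) = length (exits (P + 1) t (N P))"
      using length_exit_list[OF P] by (simp add: t_def)
  qed simp_all
  also have "\<dots> = (\<Sum>ys\<in>permutations_of_set (z P ` {1..k P}).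
      perm_weight (P + 1) L (\<lambda>s. m (Suc s)) t (N P) d ys * layers p ys d)"
    using map_top_colour_exits[OF P] by (simp add: rest_weight_def set_rows d_def t_def)
  also have "\<dots> = (\<Sum>\<pi> | \<pi> permutes {1..k P}. \<theta> \<gamma> ^ k P * bracket P (\<lambda>a. z P (\<pi> a)) m *
      layers p (map (\<lambda>a. z P (\<pi> a)) [1..<Suc (k P)]) d)"
    unfolding sum_permutations_of_set_permutes[OF inj] d_def t_def L_def perm_weight_eq_bracket[OF P] ..
  finally show ?thesis unfolding P_def m_def d_def .
qed

text \<open>\<open>f\<close> has to be arbitrary for the induction: it stands for the row variables
  of the next layer, which arrive already permuted by that layer's own symmetrization.\<close>

lemma layers_eq_sum_bracket:
  assumes "p \<le> M"
  shows "layers p (map f [1..<Suc (k (Suc p))]) (map col (coords' (Suc p))) =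
    \<theta> \<gamma> ^ (\<Sum>q\<in>{1..p}. k q) * (\<Sum>\<sigma>\<in>(\<Pi>\<^sub>E q\<in>{1..p}. {\<pi>. \<pi> permutes {1..k q}}).
      \<Prod>q\<in>{1..p}. bracket q (\<lambda>a. z q (\<sigma> q a))
        (col_var ((\<lambda>q a. z q (\<sigma> q a))(Suc p := f)) wI wII wM q))"
  using assms
proof (induction p arbitrary: f)
  case 0
  have "set (map col (coords' (Suc 0))) \<subseteq> {1}"
    using finite_Ihat by (auto simp: coords'_def Iset_def)
  then show ?case by simp
next
  case (Suc p)
  let ?P = "\<lambda>q. {\<pi>. \<pi> permutes {1..k q}}"
  let ?z = "\<lambda>\<sigma> q a. z q (\<sigma> q a)"
  have ins: "{1..Suc p} = insert (Suc p) {1..p}" by auto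
  have "layers (Suc p) (map f [1..<Suc (k (Suc (Suc p)))]) (map col (coords' (Suc (Suc p)))) =
    (\<Sum>\<pi>\<in>?P (Suc p). \<theta> \<gamma> ^ k (Suc p) *
      bracket (Suc p) (\<lambda>a. z (Suc p) (\<pi> a)) (col_var (\<lambda>_. f) wI wII wM (Suc p)) *
      (\<theta> \<gamma> ^ (\<Sum>q\<in>{1..p}. k q) * (\<Sum>\<sigma>\<in>PiE {1..p} ?P. \<Prod>q\<in>{1..p}. bracket q (?z \<sigma> q)
        (col_var ((?z \<sigma>)(Suc p := \<lambda>a. z (Suc p) (\<pi> a))) wI wII wM q))))"
    by (subst layers_Suc_eq_sum[OF Suc.prems, where y = "\<lambda>_. f"])
      (simp_all only: add_2_eq_Suc' Suc.IH[OF Suc_leD[OF Suc.prems]])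
  also have "\<dots> = \<theta> \<gamma> ^ (\<Sum>q\<in>{1..Suc p}. k q) * (\<Sum>\<pi>\<in>?P (Suc p). \<Sum>\<sigma>\<in>PiE {1..p} ?P.
      bracket (Suc p) (\<lambda>a. z (Suc p) (\<pi> a)) (col_var (\<lambda>_. f) wI wII wM (Suc p)) *
      (\<Prod>q\<in>{1..p}. bracket q (?z \<sigma> q)
        (col_var ((?z \<sigma>)(Suc p := \<lambda>a. z (Suc p) (\<pi> a))) wI wII wM q)))"
    by (simp add: sum_distrib_left power_add mult_ac)
  also have "(\<Sum>\<pi>\<in>?P (Suc p). \<Sum>\<sigma>\<in>PiE {1..p} ?P.
      bracket (Suc p) (\<lambda>a. z (Suc p) (\<pi> a)) (col_var (\<lambda>_. f) wI wII wM (Suc p)) *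
      (\<Prod>q\<in>{1..p}. bracket q (?z \<sigma> q)
        (col_var ((?z \<sigma>)(Suc p := \<lambda>a. z (Suc p) (\<pi> a))) wI wII wM q))) =
    (\<Sum>\<pi>\<in>?P (Suc p). \<Sum>\<sigma>\<in>PiE {1..p} ?P. \<Prod>q\<in>{1..Suc p}. bracket q (?z (\<sigma>(Suc p := \<pi>)) q)
        (col_var ((?z (\<sigma>(Suc p := \<pi>)))(Suc (Suc p) := f)) wI wII wM q))"
  proof ((rule sum.cong[OF refl])+)
    fix \<pi> and \<sigma> :: "nat \<Rightarrow> nat \<Rightarrow> nat"
    have "col_var (\<lambda>_. f) wI wII wM (Suc p) =
        col_var ((?z (\<sigma>(Suc p := \<pi>)))(Suc (Suc p) := f)) wI wII wM (Suc p)"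
      by (rule col_var_cong) simp
    moreover have "bracket q (?z \<sigma> q) (col_var ((?z \<sigma>)(Suc p := \<lambda>a. z (Suc p) (\<pi> a))) wI wII wM q) =
      bracket q (?z (\<sigma>(Suc p := \<pi>)) q)
        (col_var ((?z (\<sigma>(Suc p := \<pi>)))(Suc (Suc p) := f)) wI wII wM q)" if "q \<in> {1..p}" for q
    proof -
      have "col_var ((?z \<sigma>)(Suc p := \<lambda>a. z (Suc p) (\<pi> a))) wI wII wM q =
          col_var ((?z (\<sigma>(Suc p := \<pi>)))(Suc (Suc p) := f)) wI wII wM q"
        using that by (intro col_var_cong) auto
      then show ?thesis using that by simp
    qed
    ultimately show "bracket (Suc p) (\<lambda>a. z (Suc p) (\<pi> a)) (col_var (\<lambda>_. f) wI wII wM (Suc p)) *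
      (\<Prod>q\<in>{1..p}. bracket q (?z \<sigma> q)
        (col_var ((?z \<sigma>)(Suc p := \<lambda>a. z (Suc p) (\<pi> a))) wI wII wM q)) =
      (\<Prod>q\<in>{1..Suc p}. bracket q (?z (\<sigma>(Suc p := \<pi>)) q)
        (col_var ((?z (\<sigma>(Suc p := \<pi>)))(Suc (Suc p) := f)) wI wII wM q))"
      unfolding ins by simp
  qed
  also have "\<dots> = (\<Sum>\<sigma>\<in>PiE {1..Suc p} ?P. \<Prod>q\<in>{1..Suc p}. bracket q (?z \<sigma> q)
        (col_var ((?z \<sigma>)(Suc (Suc p) := f)) wI wII wM q))"
    unfolding ins by (rule sum_PiE_insert[symmetric]) simp
  finally show ?case .
qed

theorem partition_function_eq_weight_function:
  "partition_function z wI wII wM col lam = weight_function z wI wII wM col lam"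
proof -
  have "(\<Prod>p\<in>{1..M}. bracket p (\<lambda>a. z p (\<sigma> p a)) (col_var ((\<lambda>p a. z p (\<sigma> p a))(Suc M := f)) wI wII wM p)) =
      (\<Prod>p\<in>{1..M}. bracket p (\<lambda>a. z p (\<sigma> p a)) (col_var (\<lambda>p a. z p (\<sigma> p a)) wI wII wM p))" for \<sigma> f
    by (intro prod.cong refl arg_cong[of _ _ "bracket _ _"] col_var_cong) simp
  then show ?thesis
    \<comment> \<open>The arguments of \<open>layers M\<close> can be chosen freely; these have the
      shape required by \<open>layers_eq_sum_bracket\<close>.\<close>
    unfolding partition_function_eq_layers[of "map (\<lambda>_. 0) [1..<Suc (k (Suc M))]" "map col (coords' (Suc M))"]
      layers_eq_sum_bracket[OF order_refl] weight_function_eq_bracket by simp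
qed

end

theorem theorem3p4:
  fixes \<tau> \<gamma> :: complex and M :: nat
    and k LI LII :: "nat \<Rightarrow> nat" and LM :: nat
    and z wI wII :: "nat \<Rightarrow> nat \<Rightarrow> complex" and wM :: "nat \<Rightarrow> complex"
    and col :: "nat \<Rightarrow> nat" and lam :: "nat \<Rightarrow> complex"
  assumes "Im \<tau> > 0" and "\<gamma> \<noteq> 0" and "M \<ge> 1"
    and "elliptic_lattice.admissible M k LI LII LM col"
    and "elliptic_lattice.generic_dynamical \<tau> \<gamma> M lam"
    and "elliptic_lattice.generic_spectral \<tau> M k z"
  shows "elliptic_lattice.partition_function \<tau> \<gamma> M k LI LII LM z wI wII wM col lam =
         elliptic_lattice.weight_function \<tau> \<gamma> M k LI LII LM z wI wII wM col lam"
proof -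
  interpret coloured_lattice \<tau> \<gamma> M k LI LII LM z wI wII wM col lam
    using assms by unfold_locales
  show ?thesis by (rule partition_function_eq_weight_function)
qed

end
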